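(* Let $\mathcal{O}\subset\mathbb{R}^n$ be a domain (not necessarily bounded), and let $b:\mathcal{O}\to\mathbb{R}^n$ and $\sigma:\mathcal{O}\to\mathbb{M}(n)$ be measurable. Assume that for every $x\in\mathcal{O}$ the stochastic differential equation $$\mathrm{d}X_i(t)=\sum_{k=1}^n\sigma_{ik}(X(t))\,\mathrm{d}W_k(t)+b_i(X(t))\,\mathrm{d}t,\quad i=1,\dots,n,\qquad X(0)=x$$ admits a weak solution which is unique in law and defined up until the explosion time $S:=\inf\{t\ge 0: X(t)\notin\mathcal{O}\}$; let $\mathbb{P}_x$ denote the distribution of $X(\cdot)$ started at $x$, and let $U(t,x):=\mathbb{P}_x[S>t]$, $(t,x)\in[0,\infty)\times\mathcal{O}$. Put $a=\sigma\sigma^T$. Then $U$ is dominated by any nonnegative classical supersolution $\mathcal{U}\in C([0,\infty)\times\mathcal{O})\cap C^{1,2}((0,\infty)\times\mathcal{O})$ of the Cauchy problem $$u_t(t,x)-\frac12\sum_{i,j=1}^n a_{ij}(x)\,u_{x_ix_j}(t,x)-\sum_{i=1}^n b_i(x)\,u_{x_i}(t,x)=0,\quad (t,x)\in(0,\infty)\times\mathcal{O},\qquad u(0,x)=1,\quad x\in\mathcal{O};$$ that is, $U\le\mathcal{U}$ on $[0,\infty)\times\mathcal{O}$.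
   Context: $\mathbb{M}(n)$ is the set of $n\times n$ real matrices. A weak solution is a pair $(X(\cdot),W(\cdot))$ on a filtered probability space $(\Omega,\mathscr{F},\mathbb{P})$, $\{\mathscr{F}(t)\}_{0\le t<\infty}$, with $W$ an $n$-dimensional Brownian motion and $X$ a continuous adapted process satisfying the equation up until $S$. As a consequence of uniqueness in law, $X(\cdot)$ is strongly Markovian. A classical supersolution of the Cauchy problem is a function $u\in C([0,\infty)\times\mathcal{O})\cap C^{1,2}((0,\infty)\times\mathcal{O})$ with $u_t-\frac12\sum_{i,j}a_{ij}u_{x_ix_j}-\sum_i b_iu_{x_i}\ge 0$ on $(0,\infty)\times\mathcal{O}$ and $u(0,\cdot)\ge 1$ on $\mathcal{O}$. *)

theory Defs
  imports "HOL-Probability.Probability"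
begin

section \<open>Brownian motion\<close>

text \<open>Only the indices \<open>t \<ge> 0\<close> of a filtration are relevant; the library locale forces it to be
  indexed by all of \<open>real\<close>.\<close>

definition filtered_prob_space :: "'w measure \<Rightarrow> (real \<Rightarrow> 'w measure) \<Rightarrow> bool" where
  "filtered_prob_space M F \<longleftrightarrow>
     prob_space M \<and> filtration (space M) F \<and> (\<forall>t\<ge>0. subalgebra M (F t))"

definition brownian_motion ::
    "'w measure \<Rightarrow> (real \<Rightarrow> 'w measure) \<Rightarrow> (real \<Rightarrow> 'w \<Rightarrow> real^'n) \<Rightarrow> bool" where
  "brownian_motion M F W \<longleftrightarrow>
     (\<forall>t\<ge>0. W t \<in> borel_measurable (F t)) \<and>
     (\<forall>\<omega>\<in>space M. continuous_on {0..} (\<lambda>t. W t \<omega>)) \<and>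
     (AE \<omega> in M. W 0 \<omega> = 0) \<and>
     (\<forall>s\<ge>0. \<forall>t>s.
        prob_space.indep_set M (sets (F s))
          {(\<lambda>\<omega>. W t \<omega> - W s \<omega>) -` A \<inter> space M | A. A \<in> sets borel} \<and>
        distributed M lborel (\<lambda>\<omega>. W t \<omega> - W s \<omega>)
          (\<lambda>y. ennreal (\<Prod>i\<in>UNIV. normal_density 0 (sqrt (t - s)) (y $ i))))"

section \<open>The Ito integral\<close>

text \<open>An entry \<open>(r, u, \<xi>)\<close> of the list stands for the integrand \<open>\<xi> 1\<^bsub>(r,u]\<^esub>\<close>; the list denotes the
  sum of its entries, whose intervals may overlap.\<close>

type_synonym 'w elementary = "(real \<times> real \<times> ('w \<Rightarrow> real)) list"

definition elementary :: "'w measure \<Rightarrow> (real \<Rightarrow> 'w measure) \<Rightarrow> 'w elementary \<Rightarrow> bool" where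
  "elementary M F L \<longleftrightarrow>
     (\<forall>(r, u, \<xi>)\<in>set L. 0 \<le> r \<and> r \<le> u \<and> \<xi> \<in> borel_measurable (F r) \<and>
        (\<exists>C. \<forall>\<omega>\<in>space M. \<bar>\<xi> \<omega>\<bar> \<le> C))"

definition elementary_process :: "'w elementary \<Rightarrow> real \<Rightarrow> 'w \<Rightarrow> real" where
  "elementary_process L t \<omega> = (\<Sum>(r, u, \<xi>)\<leftarrow>L. \<xi> \<omega> * indicator {r<..u} t)"

definition elementary_integral ::
    "(real \<Rightarrow> 'w \<Rightarrow> real) \<Rightarrow> 'w elementary \<Rightarrow> real \<Rightarrow> 'w \<Rightarrow> real" where
  "elementary_integral B L t \<omega> = (\<Sum>(r, u, \<xi>)\<leftarrow>L. \<xi> \<omega> * (B (min u t) \<omega> - B (min r t) \<omega>))"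

definition progressive :: "(real \<Rightarrow> 'w measure) \<Rightarrow> (real \<Rightarrow> 'w \<Rightarrow> real) \<Rightarrow> bool" where
  "progressive F H \<longleftrightarrow>
     (\<forall>t\<ge>0. (\<lambda>(s, \<omega>). H s \<omega>) \<in> borel_measurable (restrict_space borel {0..t} \<Otimes>\<^sub>M F t))"

text \<open>\<open>I\<close> is a version of the process \<open>\<integral>\<^sub>0\<^sup>\<cdot> H dB\<close>, for a one-dimensional Brownian motion \<open>B\<close> and a
  progressively measurable \<open>H\<close> that is almost surely locally square integrable: the limit, uniformly
  on compact time intervals in probability, of integrals of elementary processes approximating \<open>H\<close>.
  The filtration is not assumed complete, so a continuous version need only be adapted up to null
  sets; this is automatic, and only measurability with respect to \<open>M\<close> is demanded.\<close>

definition is_ito_integral ::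
    "'w measure \<Rightarrow> (real \<Rightarrow> 'w measure) \<Rightarrow> (real \<Rightarrow> 'w \<Rightarrow> real) \<Rightarrow> (real \<Rightarrow> 'w \<Rightarrow> real)
      \<Rightarrow> (real \<Rightarrow> 'w \<Rightarrow> real) \<Rightarrow> bool" where
  "is_ito_integral M F B H I \<longleftrightarrow>
     progressive F H \<and>
     (AE \<omega> in M. \<forall>T\<ge>0. (\<integral>\<^sup>+s\<in>{0..T}. ennreal ((H s \<omega>)\<^sup>2) \<partial>lborel) < \<infinity>) \<and>
     (\<forall>t\<ge>0. I t \<in> borel_measurable M) \<and>
     (\<forall>\<omega>\<in>space M. continuous_on {0..} (\<lambda>t. I t \<omega>)) \<and>
     (\<exists>L. (\<forall>m. elementary M F (L m)) \<and>
        (\<forall>T\<ge>0. \<forall>\<epsilon>>0.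
           (\<lambda>m. measure M {\<omega>\<in>space M.
              ennreal \<epsilon> < (\<integral>\<^sup>+s\<in>{0..T}. ennreal ((elementary_process (L m) s \<omega> - H s \<omega>)\<^sup>2) \<partial>lborel)})
             \<longlonglongrightarrow> 0 \<and>
           (\<lambda>m. measure M {\<omega>\<in>space M.
              \<exists>t\<in>{0..T}. \<epsilon> < \<bar>elementary_integral B (L m) t \<omega> - I t \<omega>\<bar>})
             \<longlonglongrightarrow> 0))"

section \<open>Paths with explosion\<close>

text \<open>The state space is the one-point compactification of \<open>\<O>\<close>, with \<open>None\<close> as the cemetery. A path
  is continuous there and stays in the cemetery once it has reached it.\<close>

definition state_algebra :: "'a::topological_space set \<Rightarrow> 'a option measure" where
  "state_algebra \<O> = sigma (insert None (Some ` \<O>))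
     {V. openin (Alexandroff_compactification (top_of_set \<O>)) V}"

definition explosive_paths :: "'a::topological_space set \<Rightarrow> (real \<Rightarrow> 'a option) set" where
  "explosive_paths \<O> = {w.
     continuous_map (top_of_set {0..}) (Alexandroff_compactification (top_of_set \<O>)) w \<and>
     (\<forall>s\<ge>0. \<forall>t\<ge>s. w s = None \<longrightarrow> w t = None)}"

definition path_space :: "'a::topological_space set \<Rightarrow> (real \<Rightarrow> 'a option) measure" where
  "path_space \<O> = restrict_space (\<Pi>\<^sub>M t\<in>{0..}. state_algebra \<O>) (explosive_paths \<O>)"

text \<open>For \<open>D = \<O>\<close> this is the explosion time \<open>S\<close>.\<close>

definition exit_time :: "'a set \<Rightarrow> (real \<Rightarrow> 'a option) \<Rightarrow> ereal" where
  "exit_time D w = Inf {ereal t | t. 0 \<le> t \<and> w t \<notin> Some ` D}"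

definition extend_by_zero :: "('a \<Rightarrow> real) \<Rightarrow> 'a option \<Rightarrow> real" where
  "extend_by_zero f z = (case z of None \<Rightarrow> 0 | Some y \<Rightarrow> f y)"

section \<open>Weak solutions up to explosion\<close>

text \<open>The equation holds up until the explosion time: it is required up to the exit time from every
  open \<open>D\<close> that is relatively compact in \<open>\<O>\<close>. Together with the continuity of \<open>X\<close>, these exit times
  exhaust the interval up to the explosion time.\<close>

definition weak_solution ::
    "(real^'n) set \<Rightarrow> (real^'n \<Rightarrow> real^'n) \<Rightarrow> (real^'n \<Rightarrow> real^'n^'n) \<Rightarrow> real^'n \<Rightarrow>
     'w measure \<Rightarrow> (real \<Rightarrow> 'w measure) \<Rightarrow> (real \<Rightarrow> 'w \<Rightarrow> real^'n) \<Rightarrow>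
     (real \<Rightarrow> 'w \<Rightarrow> (real^'n) option) \<Rightarrow> bool" where
  "weak_solution \<O> b \<sigma> x M F W X \<longleftrightarrow>
     filtered_prob_space M F \<and>
     brownian_motion M F W \<and>
     (\<forall>t\<ge>0. X t \<in> F t \<rightarrow>\<^sub>M state_algebra \<O>) \<and>
     (\<forall>\<omega>\<in>space M. (\<lambda>t. X t \<omega>) \<in> explosive_paths \<O>) \<and>
     (AE \<omega> in M. X 0 \<omega> = Some x) \<and>
     (\<forall>D. open D \<and> compact (closure D) \<and> closure D \<subseteq> \<O> \<longrightarrow>
        (let S = (\<lambda>\<omega>. exit_time D (\<lambda>t. X t \<omega>));
             stopped = (\<lambda>t \<omega>. real_of_ereal (min (ereal t) (S \<omega>)))
         in
           (AE \<omega> in M. \<forall>t\<ge>0. \<forall>i.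
              set_integrable lborel {0..stopped t \<omega>} (\<lambda>s. extend_by_zero (\<lambda>y. b y $ i) (X s \<omega>))) \<and>
           (\<exists>I. (\<forall>i k. is_ito_integral M F (\<lambda>t \<omega>. W t \<omega> $ k)
                    (\<lambda>s \<omega>. if ereal s \<le> S \<omega> then extend_by_zero (\<lambda>y. \<sigma> y $ i $ k) (X s \<omega>) else 0)
                    (I i k)) \<and>
                (AE \<omega> in M. \<forall>t\<ge>0.
                   X (stopped t \<omega>) \<omega> = Some (\<chi> i. x $ i
                     + (\<Sum>k\<in>UNIV. I i k t \<omega>)
                     + (LINT s:{0..stopped t \<omega>}|lborel. extend_by_zero (\<lambda>y. b y $ i) (X s \<omega>)))))))"

text \<open>The type argument is the type of the sample points of the underlying probability spaces.\<close>

definition is_solution_law ::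
    "'w itself \<Rightarrow> (real^'n) set \<Rightarrow> (real^'n \<Rightarrow> real^'n) \<Rightarrow> (real^'n \<Rightarrow> real^'n^'n) \<Rightarrow> real^'n \<Rightarrow>
     (real \<Rightarrow> (real^'n) option) measure \<Rightarrow> bool" where
  "is_solution_law _ \<O> b \<sigma> x Q \<longleftrightarrow>
     (\<exists>(M :: 'w measure) F W X. weak_solution \<O> b \<sigma> x M F W X \<and>
        Q = distr M (path_space \<O>) (\<lambda>\<omega>. restrict (\<lambda>t. X t \<omega>) {0..}))"

definition solution_law ::
    "'w itself \<Rightarrow> (real^'n) set \<Rightarrow> (real^'n \<Rightarrow> real^'n) \<Rightarrow> (real^'n \<Rightarrow> real^'n^'n) \<Rightarrow> real^'n \<Rightarrow>
     (real \<Rightarrow> (real^'n) option) measure" where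
  "solution_law w \<O> b \<sigma> x = (THE Q. is_solution_law w \<O> b \<sigma> x Q)"

definition explosion_tail ::
    "'w itself \<Rightarrow> (real^'n) set \<Rightarrow> (real^'n \<Rightarrow> real^'n) \<Rightarrow> (real^'n \<Rightarrow> real^'n^'n) \<Rightarrow>
     real \<Rightarrow> real^'n \<Rightarrow> real" where
  "explosion_tail w \<O> b \<sigma> t x =
     measure (solution_law w \<O> b \<sigma> x)
       {p \<in> space (solution_law w \<O> b \<sigma> x). ereal t < exit_time \<O> p}"

section \<open>Classical supersolutions\<close>

definition dt :: "(real \<Rightarrow> real^'n \<Rightarrow> real) \<Rightarrow> real \<Rightarrow> real^'n \<Rightarrow> real" where
  "dt u t x = deriv (\<lambda>s. u s x) t"

definition dx :: "'n \<Rightarrow> (real \<Rightarrow> real^'n \<Rightarrow> real) \<Rightarrow> real \<Rightarrow> real^'n \<Rightarrow> real" where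
  "dx i u t x = deriv (\<lambda>h. u t (x + h *\<^sub>R axis i 1)) 0"

definition C12 :: "(real^'n) set \<Rightarrow> (real \<Rightarrow> real^'n \<Rightarrow> real) \<Rightarrow> bool" where
  "C12 \<O> u \<longleftrightarrow>
     (\<forall>t>0. \<forall>x\<in>\<O>.
        (\<lambda>s. u s x) field_differentiable at t \<and>
        (\<forall>i. (\<lambda>h. u t (x + h *\<^sub>R axis i 1)) field_differentiable at 0) \<and>
        (\<forall>i j. (\<lambda>h. dx i u t (x + h *\<^sub>R axis j 1)) field_differentiable at 0)) \<and>
     continuous_on ({0<..} \<times> \<O>) (\<lambda>(t, x). u t x) \<and>
     continuous_on ({0<..} \<times> \<O>) (\<lambda>(t, x). dt u t x) \<and>
     (\<forall>i. continuous_on ({0<..} \<times> \<O>) (\<lambda>(t, x). dx i u t x)) \<and>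
     (\<forall>i j. continuous_on ({0<..} \<times> \<O>) (\<lambda>(t, x). dx j (dx i u) t x))"

definition classical_supersolution ::
    "(real^'n) set \<Rightarrow> (real^'n \<Rightarrow> real^'n) \<Rightarrow> (real^'n \<Rightarrow> real^'n^'n) \<Rightarrow>
     (real \<Rightarrow> real^'n \<Rightarrow> real) \<Rightarrow> bool" where
  "classical_supersolution \<O> b \<sigma> u \<longleftrightarrow>
     continuous_on ({0..} \<times> \<O>) (\<lambda>(t, x). u t x) \<and>
     C12 \<O> u \<and>
     (\<forall>t>0. \<forall>x\<in>\<O>.
        dt u t x
          - 1/2 * (\<Sum>i\<in>UNIV. \<Sum>j\<in>UNIV. (\<sigma> x ** transpose (\<sigma> x)) $ i $ j * dx j (dx i u) t x)
          - (\<Sum>i\<in>UNIV. b x $ i * dx i u t x) \<ge> 0) \<and>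
     (\<forall>x\<in>\<O>. u 0 x \<ge> 1)"

end

theory Submission
  imports Defs
begin

text \<open>Instead of applying Ito's formula to a stopped process, the supersolution is followed along a
  time grid. Let \<open>I\<close> be the stochastic integral in the equation and \<open>B = X - I\<close>. Replace \<open>I\<close> by elementary
  integrals \<open>M\<close> converging to it, almost surely uniformly in time along a subsequence; on a grid that
  contains all their switching times, the increments of \<open>M\<close> are Gaussian given the past, and a
  second-order Taylor expansion controls the conditional expectation of \<open>u(T - t, \<cdot>)\<close> along
  \<open>Z = M + B\<close>. Localisation is done by a decreasing sequence of weights \<open>w\<^sub>k \<in> {0, 1}\<close>, known at the grid
  time \<open>t\<^sub>k\<close>, which vanish once \<open>X\<close> was seen outside a compact set \<open>K0\<close>, \<open>M\<close> is far from \<open>I\<close>, or the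
  accumulated variation of \<open>B\<close> or \<open>M\<close> exceeds a bound. Since \<open>u \<ge> 0\<close>, dropping weight only decreases
  \<open>w\<^sub>k u(T - t\<^sub>k, Z\<^sub>k)\<close>, so its expectation grows by at most that of a bounded sum which, path by path,
  converges to the integral of the nonpositive expression \<open>- u\<^sub>t + 1/2 \<Sum> a\<^sub>i\<^sub>j u\<^sub>i\<^sub>j + \<Sum> b\<^sub>i u\<^sub>i\<close>
  along \<open>X\<close>. Hence \<open>inf u(\<delta>, \<cdot>)\<close> near \<open>K0\<close> times the probability of staying in \<open>K0\<close> up to \<open>T\<close> is at most
  \<open>u(T, x)\<close>; now let \<open>\<delta> \<rightarrow> 0\<close> and exhaust the domain by compact sets.\<close>

section \<open>Gaussian increments\<close>

text \<open>The coefficients are merely measurable, so \<open>\<sigma>\<close> along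
  \<open>X\<close> cannot be frozen at grid times. Elementary integrands can: they are constant
  between grid points and known at the left end. Their bounds may blow up as the approximation
  improves, which is harmless because of the order of choices: for each single approximation the
  bound is known first, and the Taylor constants and the mesh are then made small enough to beat it.
  The passage to the limit uses only square integrability along each path and a domination that
  comes from the weights, not from the bounds of the integrands. The grid stops short of
  \<open>T\<close> because \<open>u\<close> is differentiable at positive times only. Weights change
  only at grid times and their measurability there is immediate. The price is that a path may leave
  the good region between two grid points and return unnoticed; the continuity of each single path
  excludes this once the mesh is fine enough.\<close>

lemma integral_lborel_vec_prod:
  fixes g :: "'n::finite \<Rightarrow> real \<Rightarrow> real"
  assumes int: "\<And>i. integrable lborel (g i)"
  shows "integrable lborel (\<lambda>y::real^'n. \<Prod>i\<in>UNIV. g i (y $ i))"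
    and "(\<integral>y. (\<Prod>i\<in>UNIV. g i ((y::real^'n) $ i)) \<partial>lborel) = (\<Prod>i\<in>UNIV. \<integral>x. g i x \<partial>lborel)"
proof -
  interpret P: product_sigma_finite "\<lambda>_::real^'n. lborel :: real measure"
    by standard
  \<comment> \<open>The product measure behind \<open>lborel\<close> is indexed by
    \<open>Basis\<close>, the factors \<open>g\<close> by coordinates; \<open>ix\<close> recovers
    the coordinate from its unit vector.\<close>
  define ix where "ix b = (THE i. b = axis i (1::real))" for b :: "real^'n"
  have ix[simp]: "ix (axis i 1) = i" for i
    unfolding ix_def by (rule the_equality) (auto simp: axis_eq_axis)
  have B: "(Basis :: (real^'n) set) = (\<lambda>i. axis i 1) ` UNIV"
    by (auto simp: Basis_vec_def)
  have inj: "inj (\<lambda>i::'n. axis i (1::real))"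
    by (auto simp: inj_on_def axis_eq_axis)
  have comp: "(\<Sum>b\<in>Basis. f b *\<^sub>R b) $ i = f (axis i 1)" for f and i :: 'n
  proof -
    have "(\<Sum>b\<in>Basis. f b *\<^sub>R b) $ i = (\<Sum>j\<in>UNIV. f (axis j 1) * axis j 1 $ i)"
      unfolding B by (simp add: sum.reindex[OF inj] del: vec_component)
    also have "\<dots> = (\<Sum>j\<in>UNIV. if j = i then f (axis i 1) else 0)"
      by (rule sum.cong) (auto simp: axis_def)
    finally show ?thesis by simp
  qed
  have prod_eq: "(\<Prod>i\<in>UNIV. g i ((\<Sum>b\<in>Basis. f b *\<^sub>R b) $ i)) = (\<Prod>b\<in>Basis. g (ix b) (f b))" for f
    unfolding comp unfolding B by (simp add: prod.reindex[OF inj])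
  have meas[measurable]: "g i \<in> borel_measurable borel" for i
    using int[of i] by (auto dest: borel_measurable_integrable)
  have meas_f: "(\<lambda>y::real^'n. \<Prod>i\<in>UNIV. g i (y $ i)) \<in> borel_measurable borel"
    by measurable
  have meas_sum: "(\<lambda>f. \<Sum>b\<in>Basis. f b *\<^sub>R b) \<in> (\<Pi>\<^sub>M b\<in>Basis. lborel) \<rightarrow>\<^sub>M (borel :: (real^'n) measure)"
    by measurable
  have I: "integrable (\<Pi>\<^sub>M b\<in>Basis. lborel) (\<lambda>f. \<Prod>b\<in>Basis. g (ix b) (f b))"
    by (rule P.product_integrable_prod) (auto intro: int)
  show "integrable lborel (\<lambda>y::real^'n. \<Prod>i\<in>UNIV. g i (y $ i))"
    by (subst lborel_eq, subst integrable_distr_eq[OF meas_sum meas_f]) (simp add: prod_eq I del: sum_component)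
  have "(\<integral>y. (\<Prod>i\<in>UNIV. g i ((y::real^'n) $ i)) \<partial>lborel)
      = (\<integral>f. (\<Prod>b\<in>Basis. g (ix b) (f b)) \<partial>(\<Pi>\<^sub>M b\<in>(Basis :: (real^'n) set). lborel))"
    by (subst lborel_eq, subst integral_distr[OF meas_sum meas_f]) (simp add: prod_eq del: sum_component)
  also have "\<dots> = (\<Prod>b\<in>(Basis :: (real^'n) set). \<integral>x. g (ix b) x \<partial>lborel)"
    by (rule P.product_integral_prod) (auto intro: int)
  also have "\<dots> = (\<Prod>i\<in>UNIV. \<integral>x. g i x \<partial>lborel)"
    unfolding B by (simp add: prod.reindex[OF inj])
  finally show "(\<integral>y. (\<Prod>i\<in>UNIV. g i ((y::real^'n) $ i)) \<partial>lborel) = (\<Prod>i\<in>UNIV. \<integral>x. g i x \<partial>lborel)" .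
qed

text \<open>The argument \<open>h\<close> is a variance, whereas \<open>normal_density\<close>
  expects a standard deviation, hence the root. For \<open>h > 0\<close> this is the law of an
  increment of \<open>W\<close> over a time span of length \<open>h\<close>.\<close>

definition gauss_density :: "real \<Rightarrow> real^'n \<Rightarrow> real" where
  "gauss_density h y = (\<Prod>i\<in>UNIV. normal_density 0 (sqrt h) (y $ i))"

lemma gauss_density_monomial:
  fixes p :: "'n::finite \<Rightarrow> nat"
  assumes "0 < h"
  shows "integrable lborel (\<lambda>y::real^'n. gauss_density h y * (\<Prod>i\<in>UNIV. (y $ i) ^ p i))"
    and "(\<integral>y. gauss_density h (y::real^'n) * (\<Prod>i\<in>UNIV. (y $ i) ^ p i) \<partial>lborel)
      = (\<Prod>i\<in>UNIV. \<integral>x. normal_density 0 (sqrt h) x * x ^ p i \<partial>lborel)"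
proof -
  have "integrable lborel (\<lambda>x. normal_density 0 (sqrt h) x * x ^ k)" for k
    using integrable_normal_moment[of "sqrt h" 0 k] assms by simp
  note I = integral_lborel_vec_prod[OF this]
  show "integrable lborel (\<lambda>y::real^'n. gauss_density h y * (\<Prod>i\<in>UNIV. (y $ i) ^ p i))"
    using I(1)[of p] by (simp add: gauss_density_def prod.distrib)
  show "(\<integral>y. gauss_density h (y::real^'n) * (\<Prod>i\<in>UNIV. (y $ i) ^ p i) \<partial>lborel)
      = (\<Prod>i\<in>UNIV. \<integral>x. normal_density 0 (sqrt h) x * x ^ p i \<partial>lborel)"
    using I(2)[of p] by (simp add: gauss_density_def prod.distrib)
qed

text \<open>The three moments have different tasks in the expansion of \<open>u\<close>: the first
  removes the gradient, the second turns the Hessian into the second-order part of the generator,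
  and the fourth makes the remainder of order \<open>h\<^sup>2\<close>.\<close>

lemma normal_moments:
  assumes "0 < h"
  shows "(\<integral>x. normal_density 0 (sqrt h) x * x \<partial>lborel) = 0"
    and "(\<integral>x. normal_density 0 (sqrt h) x * x ^ 2 \<partial>lborel) = h"
    and "(\<integral>x. normal_density 0 (sqrt h) x * x ^ 4 \<partial>lborel) = 3 * h\<^sup>2"
  using integral_normal_moment_odd[of "sqrt h" 0 0] integral_normal_moment_even[of "sqrt h" 0 1]
    integral_normal_moment_even[of "sqrt h" 0 2] assms
  by (simp_all add: fact_numeral power_divide divide_simps)

lemma prod_power_single:
  fixes y :: "'n::finite \<Rightarrow> real"
  shows "(\<Prod>i\<in>UNIV. y i ^ (if i = k then m else 0)) = y k ^ m"
proof -
  have "(\<Prod>i\<in>UNIV. y i ^ (if i = k then m else 0)) = (\<Prod>i\<in>UNIV. if i = k then y k ^ m else 1)"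
    by (rule prod.cong) auto
  then show ?thesis by simp
qed

lemma gauss_density_single:
  assumes "0 < h"
  shows "integrable lborel (\<lambda>y::real^'n. gauss_density h y * (y $ k) ^ m)"
    and "(\<integral>y. gauss_density h (y::real^'n) * (y $ k) ^ m \<partial>lborel)
      = (\<integral>x. normal_density 0 (sqrt h) x * x ^ m \<partial>lborel)"
proof -
  note G = gauss_density_monomial[OF assms, of "\<lambda>i. if i = k then m else 0"]
  have *: "(\<integral>x. normal_density 0 (sqrt h) x * x ^ (if i = k then m else 0) \<partial>lborel)
      = (if i = k then \<integral>x. normal_density 0 (sqrt h) x * x ^ m \<partial>lborel else 1)" for i
    using assms by simp
  show "integrable lborel (\<lambda>y::real^'n. gauss_density h y * (y $ k) ^ m)"
    using G(1) by (simp add: prod_power_single)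
  show "(\<integral>y. gauss_density h (y::real^'n) * (y $ k) ^ m \<partial>lborel)
      = (\<integral>x. normal_density 0 (sqrt h) x * x ^ m \<partial>lborel)"
    using G(2) unfolding * by (simp add: prod_power_single)
qed

lemma gauss_density_pair:
  assumes "0 < h"
  shows "integrable lborel (\<lambda>y::real^'n. gauss_density h y * (y $ k * y $ l))"
    and "(\<integral>y. gauss_density h (y::real^'n) * (y $ k * y $ l) \<partial>lborel) = (if k = l then h else 0)"
proof -
  have "integrable lborel (\<lambda>y::real^'n. gauss_density h y * (y $ k * y $ l)) \<and>
    (\<integral>y. gauss_density h (y::real^'n) * (y $ k * y $ l) \<partial>lborel) = (if k = l then h else 0)"
  proof (cases "k = l")
    case True
    then show ?thesis
      using gauss_density_single[OF assms, of k 2] normal_moments(2)[OF assms]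
      by (simp add: power2_eq_square)
  next
    case False
    \<comment> \<open>Exponents of the monomial, written as a sum so that \<open>power_add\<close>
      splits the product. For \<open>k \<noteq> l\<close> the exponent at \<open>k\<close> is 1, and
      this factor is a vanishing first moment.\<close>
    define p where "p i = (if i = k then 1::nat else 0) + (if i = l then 1 else 0)" for i
    have P: "(\<Prod>i\<in>UNIV. (y $ i) ^ p i) = y $ k * y $ l" for y :: "real^'n"
      unfolding p_def power_add prod.distrib prod_power_single[of "\<lambda>i. y $ i"] by simp
    have "p k = 1" using False by (simp add: p_def)
    then have "(\<Prod>i\<in>UNIV. \<integral>x. normal_density 0 (sqrt h) x * x ^ p i \<partial>lborel) = 0"
      using normal_moments(1)[OF assms] by (intro prod_zero) (auto intro!: exI[of _ k])
    then show ?thesis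
      using gauss_density_monomial[OF assms, of p] False by (simp add: P)
  qed
  then show "integrable lborel (\<lambda>y::real^'n. gauss_density h y * (y $ k * y $ l))"
    and "(\<integral>y. gauss_density h (y::real^'n) * (y $ k * y $ l) \<partial>lborel) = (if k = l then h else 0)"
    by auto
qed

text \<open>Cauchy-Schwarz for the squares of the coordinates; it reduces the fourth moment of the
  norm to one-dimensional fourth moments.\<close>

lemma norm_pow4_le:
  fixes y :: "real^'n"
  shows "norm y ^ 4 \<le> real CARD('n) * (\<Sum>i\<in>UNIV. (y $ i) ^ 4)"
proof -
  have "norm y ^ 4 = ((norm y)\<^sup>2)\<^sup>2" by (simp flip: power_mult)
  also have "(norm y)\<^sup>2 = (\<Sum>i\<in>UNIV. (y $ i)\<^sup>2)"
    by (simp add: norm_vec_def L2_set_def sum_nonneg)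
  also have "(\<Sum>i\<in>UNIV. (y $ i)\<^sup>2)\<^sup>2 \<le> real CARD('n) * (\<Sum>i\<in>UNIV. ((y $ i)\<^sup>2)\<^sup>2)"
    using sum_squared_le_sum_of_squares[of "\<lambda>i. (y $ i)\<^sup>2" "UNIV :: 'n set"]
    by (simp add: mult.commute del: sum_squared_le_sum_of_squares)
  also have "\<dots> = real CARD('n) * (\<Sum>i\<in>UNIV. (y $ i) ^ 4)"
    by (simp flip: power_mult)
  finally show ?thesis .
qed

section \<open>Independence of Brownian increments from the past\<close>

locale brownian = prob_space M for M :: "'w measure" +
  fixes F :: "real \<Rightarrow> 'w measure" and W :: "real \<Rightarrow> 'w \<Rightarrow> real^'n"
  assumes filt: "filtered_prob_space M F"
    and bm: "brownian_motion M F W"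
begin

lemma subalgebra_F: "0 \<le> t \<Longrightarrow> subalgebra M (F t)"
  using filt by (auto simp: filtered_prob_space_def)

lemma measurable_F_M: "V \<in> measurable (F t) N \<Longrightarrow> 0 \<le> t \<Longrightarrow> V \<in> measurable M N"
  using measurable_from_subalg[OF subalgebra_F] .

lemma F_mono: "s \<le> t \<Longrightarrow> 0 \<le> s \<Longrightarrow> subalgebra (F t) (F s)"
  using filt subalgebra_F[of s] subalgebra_F[of t]
  by (auto simp: filtered_prob_space_def filtration_def subalgebra_def)

lemma measurable_F_mono: "V \<in> measurable (F s) N \<Longrightarrow> s \<le> t \<Longrightarrow> 0 \<le> s \<Longrightarrow> V \<in> measurable (F t) N"
  using measurable_from_subalg[OF F_mono] by blast

lemma space_F [simp]: "0 \<le> t \<Longrightarrow> space (F t) = space M"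
  using subalgebra_F[of t] by (simp add: subalgebra_def)

lemma W_F: "0 \<le> t \<Longrightarrow> W t \<in> borel_measurable (F t)"
  using bm by (simp add: brownian_motion_def)

lemma W_M: "0 \<le> t \<Longrightarrow> W t \<in> borel_measurable M"
  using measurable_F_M[OF W_F] .

text \<open>Takes the place of conditioning on \<open>F s\<close>: as the increment is independent
  of the past, the expectation of the product factors, and no conditional expectation has to be
  formed.\<close>

lemma expectation_increment:
  assumes st: "0 \<le> s" "s < t"
    and V: "V \<in> borel_measurable (F s)" and bound: "\<And>\<omega>. \<omega> \<in> space M \<Longrightarrow> \<bar>V \<omega>\<bar> \<le> C"
    and g: "g \<in> borel_measurable borel" and int: "integrable lborel (\<lambda>y. gauss_density (t - s) y * g y)"
  shows "integrable M (\<lambda>\<omega>. V \<omega> * g (W t \<omega> - W s \<omega>))"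
    and "(\<integral>\<omega>. V \<omega> * g (W t \<omega> - W s \<omega>) \<partial>M)
      = (\<integral>\<omega>. V \<omega> \<partial>M) * (\<integral>y. gauss_density (t - s) y * g y \<partial>lborel)"
proof -
  define D where "D \<omega> = W t \<omega> - W s \<omega>" for \<omega>
  have dist: "distributed M lborel D (\<lambda>y. ennreal (gauss_density (t - s) y))"
    and ind: "indep_set (sets (F s)) {D -` A \<inter> space M | A. A \<in> sets borel}"
    using bm st unfolding brownian_motion_def gauss_density_def D_def[abs_def] by auto
  have gd: "0 \<le> gauss_density h y" for h and y :: "real^'n"
    by (simp add: gauss_density_def prod_nonneg)
  have VM[measurable]: "V \<in> borel_measurable M"
    using measurable_F_M[OF V st(1)] .
  have DM[measurable]: "D \<in> borel_measurable M"
    using W_M[of s] W_M[of t] st unfolding D_def by auto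
  have Dint: "integrable M (\<lambda>\<omega>. g (D \<omega>))"
    using distributed_integrable[OF dist, of g] int g gd by simp
  have Deq: "(\<integral>\<omega>. g (D \<omega>) \<partial>M) = (\<integral>y. gauss_density (t - s) y * g y \<partial>lborel)"
    using distributed_integral[OF dist, of g] g gd by simp
  have Vint: "integrable M V"
    by (rule integrable_const_bound[of _ C]) (use bound in auto)
  have sF: "sigma_algebra (space M) (sets (F s))"
    using sets.sigma_algebra_axioms[of "F s"] st by simp
  \<comment> \<open>Independence is given for the sets of \<open>F s\<close> and the preimages under
    the increment. The sigma-algebras generated by \<open>V\<close> and by \<open>g\<close> of the
    increment are smaller, so they inherit it.\<close>
  have 1: "sigma_sets (space M) {V -` A \<inter> space M | A. A \<in> sets borel} \<subseteq> sets (F s)"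
  proof (rule sigma_algebra.sigma_sets_subset[OF sF], safe)
    fix A :: "real set" assume "A \<in> sets borel"
    from measurable_sets[OF V this] st show "V -` A \<inter> space M \<in> sets (F s)" by simp
  qed
  have 2: "sigma_sets (space M) {(\<lambda>\<omega>. g (D \<omega>)) -` A \<inter> space M | A. A \<in> sets borel}
     \<subseteq> {D -` A \<inter> space M | A. A \<in> sets borel}"
  proof -
    have "{D -` A \<inter> space M | A. A \<in> sets borel} = sets (vimage_algebra (space M) D borel)"
      by (simp add: sets_vimage_algebra2)
    moreover have "{(\<lambda>\<omega>. g (D \<omega>)) -` A \<inter> space M | A. A \<in> sets borel} \<subseteq> {D -` A \<inter> space M | A. A \<in> sets borel}"
    proof safe
      fix A :: "real set" assume "A \<in> sets borel"
      with g have "g -` A \<in> sets borel"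
        using measurable_sets[of g borel borel A] by simp
      then show "\<exists>B. (\<lambda>\<omega>. g (D \<omega>)) -` A \<inter> space M = D -` B \<inter> space M \<and> B \<in> sets borel"
        by (intro exI[of _ "g -` A"]) auto
    qed
    ultimately show ?thesis
      using sets.sigma_sets_subset[of _ "vimage_algebra (space M) D borel"] by simp
  qed
  have "indep_set (sigma_sets (space M) {V -` A \<inter> space M | A. A \<in> sets borel})
      (sigma_sets (space M) {(\<lambda>\<omega>. g (D \<omega>)) -` A \<inter> space M | A. A \<in> sets borel})"
    using ind unfolding indep_set_def
    by (rule indep_sets_mono_sets) (use 1 2 in \<open>auto split: bool.split\<close>)
  then have iv: "indep_var borel V borel (\<lambda>\<omega>. g (D \<omega>))"
    unfolding indep_var_eq using g by auto
  show "integrable M (\<lambda>\<omega>. V \<omega> * g (W t \<omega> - W s \<omega>))"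
    using indep_var_integrable[OF iv Vint Dint] by (simp add: D_def)
  show "(\<integral>\<omega>. V \<omega> * g (W t \<omega> - W s \<omega>) \<partial>M)
      = (\<integral>\<omega>. V \<omega> \<partial>M) * (\<integral>y. gauss_density (t - s) y * g y \<partial>lborel)"
    using indep_var_lebesgue_integral[OF iv Vint Dint] unfolding Deq by (simp add: D_def)
qed

end

section \<open>Taylor expansion\<close>

text \<open>Partial derivatives are given as derivatives at 0 with a moving base point; the mean
  value theorem wants them at every parameter of one fixed coordinate line.\<close>

lemma partial_deriv_shift:
  fixes f :: "real^'n \<Rightarrow> real"
  assumes "((\<lambda>h. f ((z + c *\<^sub>R axis i 1) + h *\<^sub>R axis i 1)) has_real_derivative d) (at 0)"
  shows "((\<lambda>h. f (z + h *\<^sub>R axis i 1)) has_real_derivative d) (at c)"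
proof -
  have "((\<lambda>h. f (z + (h + c) *\<^sub>R axis i 1)) has_real_derivative d) (at 0)"
    using assms by (simp add: algebra_simps)
  then show ?thesis
    using DERIV_shift[of "\<lambda>h. f (z + h *\<^sub>R axis i 1)" d 0 c] by simp
qed

text \<open>Change one coordinate at a time and apply the mean value theorem to each leg. Shrinking
  a coordinate towards 0 does not increase the norm, so every leg stays in the ball where the
  partials are nearly constant.\<close>

lemma increment_le_partials:
  fixes f :: "real^'n \<Rightarrow> real" and p :: "'n \<Rightarrow> real^'n \<Rightarrow> real"
  assumes d: "\<And>w i. w \<in> ball z r \<Longrightarrow> ((\<lambda>h. f (w + h *\<^sub>R axis i 1)) has_real_derivative p i w) (at 0)"
    and near: "\<And>w i. w \<in> ball z r \<Longrightarrow> \<bar>p i w - p i z\<bar> \<le> e"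
    and "finite A" and "norm h < r" and "\<forall>i. i \<notin> A \<longrightarrow> h $ i = 0"
  shows "\<bar>f (z + h) - f z - (\<Sum>i\<in>A. p i z * h $ i)\<bar> \<le> e * (\<Sum>i\<in>A. \<bar>h $ i\<bar>)"
  using assms(3-5)
proof (induction A arbitrary: h rule: finite_induct)
  case empty
  then have "h = 0" by (simp add: vec_eq_iff)
  then show ?case by simp
next
  case (insert a A)
  have dist_add: "dist z (z + y) = norm y" for y
    by (simp add: dist_norm)
  define g where "g = (\<chi> i. if i = a then 0 else h $ i)"
  have hg: "h = g + (h $ a) *\<^sub>R axis a 1"
    by (auto simp: vec_eq_iff g_def axis_def)
  have le: "norm (g + c *\<^sub>R axis a 1) \<le> norm h" if "\<bar>c\<bar> \<le> \<bar>h $ a\<bar>" for c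
    by (rule norm_le_componentwise_cart) (use that in \<open>auto simp: g_def axis_def\<close>)
  have ng: "norm g < r"
    using le[of 0] insert.prems(1) by simp
  have gz: "g $ i = 0" if "i \<notin> A" for i
    using insert.prems(2) that by (auto simp: g_def)
  have gh: "g $ i = h $ i" if "i \<in> A" for i
    using insert.hyps that by (auto simp: g_def)
  have IH: "\<bar>f (z + g) - f z - (\<Sum>i\<in>A. p i z * h $ i)\<bar> \<le> e * (\<Sum>i\<in>A. \<bar>h $ i\<bar>)"
    using insert.IH[OF ng] gz gh by auto
  have step: "\<bar>f (z + h) - f (z + g) - p a z * h $ a\<bar> \<le> e * \<bar>h $ a\<bar>"
  proof -
    define F where "F c = f ((z + g) + c *\<^sub>R axis a 1)" for c
    have D: "(F has_real_derivative p a (z + g + c *\<^sub>R axis a 1)) (at c)" if "\<bar>c\<bar> \<le> \<bar>h $ a\<bar>" for c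
      unfolding F_def
    proof (rule partial_deriv_shift, rule d)
      show "z + g + c *\<^sub>R axis a 1 \<in> ball z r"
        using le[OF that] insert.prems(1) dist_add[of "g + c *\<^sub>R axis a 1"] by (simp add: add.assoc)
    qed
    have "\<exists>c. \<bar>c\<bar> \<le> \<bar>h $ a\<bar> \<and> F (h $ a) - F 0 = h $ a * p a (z + g + c *\<^sub>R axis a 1)"
    proof (cases "h $ a" "0::real" rule: linorder_cases)
      case less
      from MVT2[OF less, of F "\<lambda>c. p a (z + g + c *\<^sub>R axis a 1)"] D obtain c
        where "h $ a < c" "c < 0" "F 0 - F (h $ a) = (0 - h $ a) * p a (z + g + c *\<^sub>R axis a 1)"
        using less by (auto simp: abs_if)
      then show ?thesis by (intro exI[of _ c]) (auto simp: algebra_simps)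
    next
      case equal then show ?thesis by (intro exI[of _ 0]) auto
    next
      case greater
      from MVT2[OF greater, of F "\<lambda>c. p a (z + g + c *\<^sub>R axis a 1)"] D obtain c
        where "0 < c" "c < h $ a" "F (h $ a) - F 0 = (h $ a - 0) * p a (z + g + c *\<^sub>R axis a 1)"
        using greater by (auto simp: abs_if)
      then show ?thesis by (intro exI[of _ c]) auto
    qed
    then obtain c where c: "\<bar>c\<bar> \<le> \<bar>h $ a\<bar>" "F (h $ a) - F 0 = h $ a * p a (z + g + c *\<^sub>R axis a 1)"
      by blast
    have "dist z (z + g + c *\<^sub>R axis a 1) = norm (g + c *\<^sub>R axis a 1)"
      using dist_add by (simp add: add.assoc)
    then have "z + g + c *\<^sub>R axis a 1 \<in> ball z r"
      using le[OF c(1)] insert.prems(1) by simp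
    from near[OF this, of a] have *: "\<bar>p a (z + g + c *\<^sub>R axis a 1) - p a z\<bar> \<le> e" .
    have "F (h $ a) = f (z + h)" "F 0 = f (z + g)"
      unfolding F_def using hg by (simp_all add: add.assoc)
    then have "f (z + h) - f (z + g) - p a z * h $ a = h $ a * (p a (z + g + c *\<^sub>R axis a 1) - p a z)"
      using c(2) by (simp add: algebra_simps)
    then show ?thesis
      using * by (simp add: abs_mult mult.commute[of e] mult_left_mono)
  qed
  have "f (z + h) - f z - (\<Sum>i\<in>insert a A. p i z * h $ i) =
      (f (z + h) - f (z + g) - p a z * h $ a) + (f (z + g) - f z - (\<Sum>i\<in>A. p i z * h $ i))"
    using insert.hyps by simp
  also have "\<bar>\<dots>\<bar> \<le> e * \<bar>h $ a\<bar> + e * (\<Sum>i\<in>A. \<bar>h $ i\<bar>)"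
    using IH step by linarith
  also have "\<dots> = e * (\<Sum>i\<in>insert a A. \<bar>h $ i\<bar>)"
    using insert.hyps by (simp add: distrib_left)
  finally show ?case .
qed

text \<open>\<open>C12\<close> speaks of derivatives along the axes only. Their continuity upgrades
  them to a total derivative, which gives the chain rule along arbitrary segments.\<close>

lemma has_derivative_continuous_partials:
  fixes f :: "real^'n \<Rightarrow> real" and p :: "'n \<Rightarrow> real^'n \<Rightarrow> real"
  assumes S: "open S" "z \<in> S"
    and d: "\<And>w i. w \<in> S \<Longrightarrow> ((\<lambda>h. f (w + h *\<^sub>R axis i 1)) has_real_derivative p i w) (at 0)"
    and cont: "\<And>i. continuous_on S (p i)"
  shows "(f has_derivative (\<lambda>h. \<Sum>i\<in>UNIV. p i z * h $ i)) (at z)"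
  unfolding has_derivative_at_alt
proof (intro conjI allI impI)
  show "bounded_linear (\<lambda>h. \<Sum>i\<in>UNIV. p i z * h $ i)"
    by (intro bounded_linear_sum bounded_linear_const_mult bounded_linear_vec_nth)
next
  fix e :: real assume "0 < e"
  \<comment> \<open>The absolute values of the coordinates add up to at most \<open>CARD('n)\<close>
    times the norm; the division absorbs this factor.\<close>
  define e' where "e' = e / real CARD('n)"
  have e': "0 < e'" using \<open>0 < e\<close> by (simp add: e'_def)
  have "\<exists>r>0. ball z r \<subseteq> S \<and> (\<forall>w\<in>ball z r. \<bar>p i w - p i z\<bar> \<le> e')" for i
  proof -
    from cont[of i] S have "isCont (p i) z" by (simp add: continuous_on_eq_continuous_at)
    then obtain r1 where r1: "r1 > 0" "\<And>w. dist w z < r1 \<Longrightarrow> dist (p i w) (p i z) < e'"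
      using e' unfolding continuous_at_eps_delta by blast
    from S obtain r2 where "r2 > 0" "ball z r2 \<subseteq> S"
      using open_contains_ball by blast
    with r1 show ?thesis
      by (intro exI[of _ "min r1 r2"]) (force simp: dist_real_def dist_commute)
  qed
  then obtain R where R: "\<And>i. R i > 0" "\<And>i. ball z (R i) \<subseteq> S"
      "\<And>i w. w \<in> ball z (R i) \<Longrightarrow> \<bar>p i w - p i z\<bar> \<le> e'"
    by metis
  define r where "r = Min (range R)"
  have r: "r > 0" "\<And>i. r \<le> R i"
    using R(1) by (auto simp: r_def)
  have rS: "ball z r \<subseteq> S"
    using R(2) r(2) by (meson order_trans subset_ball)
  have rn: "\<bar>p i w - p i z\<bar> \<le> e'" if "w \<in> ball z r" for i w
    using R(3)[of w i] r(2)[of i] that by auto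
  show "\<exists>d>0. \<forall>y. norm (y - z) < d \<longrightarrow>
      norm (f y - f z - (\<Sum>i\<in>UNIV. p i z * (y - z) $ i)) \<le> e * norm (y - z)"
  proof (intro exI conjI allI impI)
    show "r > 0" by fact
    fix y assume y: "norm (y - z) < r"
    have "\<bar>f (z + (y - z)) - f z - (\<Sum>i\<in>UNIV. p i z * (y - z) $ i)\<bar> \<le> e' * (\<Sum>i\<in>UNIV. \<bar>(y - z) $ i\<bar>)"
      by (rule increment_le_partials[where r=r]) (use rS d rn y in auto)
    also have "\<dots> \<le> e' * (\<Sum>i\<in>(UNIV::'n set). norm (y - z))"
      using e' by (intro mult_left_mono sum_mono component_le_norm_cart) auto
    also have "\<dots> = e * norm (y - z)"
      by (simp add: e'_def)
    finally show "norm (f y - f z - (\<Sum>i\<in>UNIV. p i z * (y - z) $ i)) \<le> e * norm (y - z)"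
      by simp
  qed
qed

lemma deriv_along_line:
  fixes f :: "real^'n \<Rightarrow> real" and p :: "'n \<Rightarrow> real^'n \<Rightarrow> real"
  assumes S: "open S" "z + c *\<^sub>R v \<in> S"
    and d: "\<And>w i. w \<in> S \<Longrightarrow> ((\<lambda>h. f (w + h *\<^sub>R axis i 1)) has_real_derivative p i w) (at 0)"
    and cont: "\<And>i. continuous_on S (p i)"
  shows "((\<lambda>c. f (z + c *\<^sub>R v)) has_real_derivative (\<Sum>i\<in>UNIV. p i (z + c *\<^sub>R v) * v $ i)) (at c)"
proof -
  have 1: "((\<lambda>c. z + c *\<^sub>R v) has_derivative (\<lambda>h. h *\<^sub>R v)) (at c)"
    by (auto intro!: derivative_eq_intros)
  have "((\<lambda>c. f (z + c *\<^sub>R v)) has_derivative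
     (\<lambda>h. \<Sum>i\<in>UNIV. p i (z + c *\<^sub>R v) * (h *\<^sub>R v) $ i)) (at c)"
    using has_derivative_compose[OF 1 has_derivative_continuous_partials[OF S d cont]] by simp
  moreover have "(\<lambda>h. \<Sum>i\<in>UNIV. p i (z + c *\<^sub>R v) * (h *\<^sub>R v) $ i)
      = (*) (\<Sum>i\<in>UNIV. p i (z + c *\<^sub>R v) * v $ i)"
    by (auto simp: fun_eq_iff sum_distrib_right sum_distrib_left mult_ac)
  ultimately show ?thesis by (simp add: has_field_derivative_def)
qed

lemma mvt_partials:
  fixes f :: "real^'n \<Rightarrow> real" and p :: "'n \<Rightarrow> real^'n \<Rightarrow> real"
  assumes S: "open S" "\<And>c. 0 \<le> c \<Longrightarrow> c \<le> 1 \<Longrightarrow> z + c *\<^sub>R v \<in> S"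
    and d: "\<And>w i. w \<in> S \<Longrightarrow> ((\<lambda>h. f (w + h *\<^sub>R axis i 1)) has_real_derivative p i w) (at 0)"
    and cont: "\<And>i. continuous_on S (p i)"
  shows "\<exists>c\<in>{0..1}. f (z + v) - f z = (\<Sum>i\<in>UNIV. p i (z + c *\<^sub>R v) * v $ i)"
proof -
  have "\<exists>c>0. c < 1 \<and> f (z + 1 *\<^sub>R v) - f (z + 0 *\<^sub>R v) = (1 - 0) * (\<Sum>i\<in>UNIV. p i (z + c *\<^sub>R v) * v $ i)"
    by (rule MVT2) (auto intro!: deriv_along_line[OF S(1) S(2) d cont])
  then show ?thesis by (auto intro!: bexI)
qed

text \<open>Restricted to the segment, \<open>f\<close> is a function of one variable;
  differentiating each \<open>p i\<close> along the segment once more yields its second derivative,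
  and Maclaurin's formula with Lagrange remainder applies.\<close>

lemma taylor2_partials:
  fixes f :: "real^'n \<Rightarrow> real" and p :: "'n \<Rightarrow> real^'n \<Rightarrow> real" and q :: "'n \<Rightarrow> 'n \<Rightarrow> real^'n \<Rightarrow> real"
  assumes S: "open S" "\<And>c. 0 \<le> c \<Longrightarrow> c \<le> 1 \<Longrightarrow> z + c *\<^sub>R v \<in> S"
    and d: "\<And>w i. w \<in> S \<Longrightarrow> ((\<lambda>h. f (w + h *\<^sub>R axis i 1)) has_real_derivative p i w) (at 0)"
    and cont: "\<And>i. continuous_on S (p i)"
    and d2: "\<And>w i j. w \<in> S \<Longrightarrow> ((\<lambda>h. p i (w + h *\<^sub>R axis j 1)) has_real_derivative q i j w) (at 0)"
    and cont2: "\<And>i j. continuous_on S (q i j)"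
  shows "\<exists>c\<in>{0..1}. f (z + v) - f z = (\<Sum>i\<in>UNIV. p i z * v $ i)
     + 1/2 * (\<Sum>i\<in>UNIV. \<Sum>j\<in>UNIV. q i j (z + c *\<^sub>R v) * v $ i * v $ j)"
proof -
  \<comment> \<open>The derivatives of order 0, 1 and 2 along the segment, in the form of the
    sequence that \<open>Maclaurin\<close> asks for; its values from index 3 on are fillers.\<close>
  define D where "D m = (if m = 0 then (\<lambda>c. f (z + c *\<^sub>R v)) else if m = 1 then
      (\<lambda>c. \<Sum>i\<in>UNIV. p i (z + c *\<^sub>R v) * v $ i) else
      (\<lambda>c. \<Sum>i\<in>UNIV. (\<Sum>j\<in>UNIV. q i j (z + c *\<^sub>R v) * v $ j) * v $ i))" for m :: nat
  have "\<exists>t>0. t < 1 \<and> D 0 1 = (\<Sum>m<2. D m 0 / fact m * (1 - 0) ^ m) + D 2 t / fact 2 * (1 - 0)^2"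
  proof -
    have "\<forall>m t. m < 2 \<and> 0 \<le> t \<and> t \<le> 1 \<longrightarrow> (D m has_real_derivative D (Suc m) t) (at t)"
    proof (intro allI impI)
      fix m :: nat and t :: real assume A: "m < 2 \<and> 0 \<le> t \<and> t \<le> 1"
      then consider "m = 0" | "m = 1" by linarith
      then show "(D m has_real_derivative D (Suc m) t) (at t)"
      proof cases
        case 1 then show ?thesis
          using deriv_along_line[OF S(1) S(2) d cont, of t] A by (simp add: D_def)
      next
        case 2
        have "((\<lambda>c. \<Sum>i\<in>UNIV. p i (z + c *\<^sub>R v) * v $ i) has_real_derivative
          (\<Sum>i\<in>UNIV. (\<Sum>j\<in>UNIV. q i j (z + t *\<^sub>R v) * v $ j) * v $ i)) (at t)"
          by (intro DERIV_sum DERIV_cmult_right deriv_along_line[OF S(1) S(2) d2 cont2]) (use A in auto)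
        with 2 show ?thesis by (simp add: D_def)
      qed
    qed
    then have "\<exists>t>0. t < 1 \<and> D 0 1 = (\<Sum>m<2. D m 0 / fact m * 1 ^ m) + D 2 t / fact 2 * 1^2"
      by (intro Maclaurin[of 1 2 D "D 0"]) auto
    then show ?thesis by simp
  qed
  then obtain t where t: "0 < t" "t < 1"
    and eq: "D 0 1 = (\<Sum>m<2. D m 0 / fact m * (1 - 0) ^ m) + D 2 t / fact 2 * (1 - 0)^2" by blast
  have "D 0 1 = D 0 0 + D 1 0 + 1/2 * D 2 t"
    using eq by (simp add: numeral_2_eq_2)
  then show ?thesis
    using t by (intro bexI[of _ t]) (auto simp: D_def sum_distrib_right sum_distrib_left mult_ac)
qed

section \<open>Functions of class C12 on compact cylinders away from time 0\<close>

context
  fixes \<O> :: "(real^'n) set" and u :: "real \<Rightarrow> real^'n \<Rightarrow> real"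
  assumes u: "C12 \<O> u"
begin

lemma C12_deriv:
  assumes "0 < t" "x \<in> \<O>"
  shows "((\<lambda>s. u s x) has_real_derivative dt u t x) (at t)"
    and "((\<lambda>h. u t (x + h *\<^sub>R axis i 1)) has_real_derivative dx i u t x) (at 0)"
    and "((\<lambda>h. dx i u t (x + h *\<^sub>R axis j 1)) has_real_derivative dx j (dx i u) t x) (at 0)"
  using u assms unfolding C12_def dt_def dx_def by (blast intro: DERIV_deriv_iff_field_differentiable[THEN iffD2])+

lemma C12_continuous:
  shows "continuous_on ({0<..} \<times> \<O>) (\<lambda>(t, x). u t x)"
    and "continuous_on ({0<..} \<times> \<O>) (\<lambda>(t, x). dt u t x)"
    and "continuous_on ({0<..} \<times> \<O>) (\<lambda>(t, x). dx i u t x)"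
    and "continuous_on ({0<..} \<times> \<O>) (\<lambda>(t, x). dx j (dx i u) t x)"
  using u by (simp_all add: C12_def)

lemma continuous_on_slice:
  assumes "continuous_on ({0<..} \<times> \<O>) (\<lambda>(t, x). g t x)" "0 < t"
  shows "continuous_on \<O> (g t)"
  by (rule continuous_on_compose2[OF assms(1), of _ "\<lambda>x. (t, x)", simplified])
    (use assms(2) in \<open>auto intro!: continuous_intros\<close>)

lemmas C12_continuous_slice = C12_continuous[THEN continuous_on_slice]

context
  fixes a b :: real and K :: "(real^'n) set"
  assumes a: "0 < a" and K: "compact K" "K \<subseteq> \<O>"
begin

lemma cylinder_bound:
  assumes "continuous_on ({0<..} \<times> \<O>) (\<lambda>(t, x). (g :: real \<Rightarrow> real^'n \<Rightarrow> real) t x)"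
  shows "\<exists>C\<ge>0. \<forall>s\<in>{a..b}. \<forall>z\<in>K. \<bar>g s z\<bar> \<le> C"
proof -
  have "continuous_on ({a..b} \<times> K) (\<lambda>(t, x). g t x)"
    by (rule continuous_on_subset[OF assms]) (use a K in auto)
  then have "compact ((\<lambda>(t, x). g t x) ` ({a..b} \<times> K))"
    by (intro compact_continuous_image compact_Times K) auto
  then obtain B where "\<And>s z. s \<in> {a..b} \<Longrightarrow> z \<in> K \<Longrightarrow> \<bar>g s z\<bar> \<le> B"
    using compact_imp_bounded bounded_iff[of "(\<lambda>(t, x). g t x) ` ({a..b} \<times> K)"] by fastforce
  then show ?thesis by (intro exI[of _ "max B 0"]) (auto intro: max.coboundedI1)
qed

lemma cylinder_uniform:
  assumes "continuous_on ({0<..} \<times> \<O>) (\<lambda>(t, x). (g :: real \<Rightarrow> real^'n \<Rightarrow> real) t x)" "0 < e"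
  shows "\<exists>d>0. \<forall>s\<in>{a..b}. \<forall>s'\<in>{a..b}. \<forall>z\<in>K. \<forall>z'\<in>K. \<bar>s - s'\<bar> \<le> d \<longrightarrow> norm (z - z') \<le> d \<longrightarrow>
    \<bar>g s z - g s' z'\<bar> \<le> e"
proof -
  have "continuous_on ({a..b} \<times> K) (\<lambda>(t, x). g t x)"
    by (rule continuous_on_subset[OF assms(1)]) (use a K in auto)
  then have "uniformly_continuous_on ({a..b} \<times> K) (\<lambda>(t, x). g t x)"
    by (intro compact_uniformly_continuous compact_Times K) auto
  then obtain d where d: "d > 0" and D: "\<And>p q. p \<in> {a..b} \<times> K \<Longrightarrow> q \<in> {a..b} \<times> K \<Longrightarrow> dist q p < d \<Longrightarrow>
      dist ((\<lambda>(t, x). g t x) q) ((\<lambda>(t, x). g t x) p) < e"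
    unfolding uniformly_continuous_on_def using assms(2) by metis
  show ?thesis
  \<comment> \<open>Two increments of size at most \<open>d/3\<close> keep the distance strictly
    below \<open>d\<close>, so that weak inequalities can be used from here on.\<close>
  proof (intro exI[of _ "d/3"] conjI ballI impI)
    fix s s' z z' assume H: "s \<in> {a..b}" "s' \<in> {a..b}" "z \<in> K" "z' \<in> K" "\<bar>s - s'\<bar> \<le> d/3" "norm (z - z') \<le> d/3"
    have "dist (s, z) (s', z') \<le> \<bar>s - s'\<bar> + norm (z - z')"
      using dist_triangle[of "(s, z)" "(s', z')" "(s', z)"] by (simp add: dist_Pair_Pair dist_norm)
    then have "dist (s, z) (s', z') < d" using H d by linarith
    from D[OF _ _ this] H show "\<bar>g s z - g s' z'\<bar> \<le> e" by (auto simp: dist_real_def)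
  qed (use d in auto)
qed

lemma C12_bounds:
  shows "\<exists>C\<ge>0. \<forall>s\<in>{a..b}. \<forall>z\<in>K. \<bar>u s z\<bar> \<le> C \<and> \<bar>dt u s z\<bar> \<le> C \<and> (\<forall>i. \<bar>dx i u s z\<bar> \<le> C) \<and>
     (\<forall>i j. \<bar>dx j (dx i u) s z\<bar> \<le> C)"
proof -
  obtain C1 where C1: "C1 \<ge> 0" "\<forall>s\<in>{a..b}. \<forall>z\<in>K. \<bar>u s z\<bar> \<le> C1"
    using cylinder_bound[OF C12_continuous(1)] by blast
  obtain C2 where C2: "C2 \<ge> 0" "\<forall>s\<in>{a..b}. \<forall>z\<in>K. \<bar>dt u s z\<bar> \<le> C2"
    using cylinder_bound[OF C12_continuous(2)] by blast
  obtain C3 where C3: "\<And>i. C3 i \<ge> 0" "\<And>i. \<forall>s\<in>{a..b}. \<forall>z\<in>K. \<bar>dx i u s z\<bar> \<le> C3 i"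
    using cylinder_bound[OF C12_continuous(3)] by metis
  have "\<forall>i j. \<exists>C\<ge>0. \<forall>s\<in>{a..b}. \<forall>z\<in>K. \<bar>dx j (dx i u) s z\<bar> \<le> C"
    using cylinder_bound[OF C12_continuous(4)] by blast
  then obtain C4 where C4: "\<And>i j. C4 i j \<ge> 0" "\<And>i j. \<forall>s\<in>{a..b}. \<forall>z\<in>K. \<bar>dx j (dx i u) s z\<bar> \<le> C4 i j"
    unfolding choice_iff by blast
  define C where "C = C1 + C2 + (\<Sum>i\<in>UNIV. C3 i) + (\<Sum>i\<in>UNIV. \<Sum>j\<in>UNIV. C4 i j)"
  have s3: "C3 i \<le> (\<Sum>i\<in>UNIV. C3 i)" for i
    by (rule member_le_sum) (use C3 in auto)
  have "C4 i j \<le> (\<Sum>j\<in>UNIV. C4 i j)" for i j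
    by (rule member_le_sum) (use C4 in auto)
  moreover have "(\<Sum>j\<in>UNIV. C4 i j) \<le> (\<Sum>i\<in>UNIV. \<Sum>j\<in>UNIV. C4 i j)" for i
    by (rule member_le_sum) (use C4 in \<open>auto intro: sum_nonneg\<close>)
  ultimately have s4: "C4 i j \<le> (\<Sum>i\<in>UNIV. \<Sum>j\<in>UNIV. C4 i j)" for i j
    using order_trans by blast
  have nn: "0 \<le> (\<Sum>i\<in>UNIV. C3 i)" "0 \<le> (\<Sum>i\<in>UNIV. \<Sum>j\<in>UNIV. C4 i j)"
    by (auto intro!: sum_nonneg C3 C4)
  have le: "C1 \<le> C" "C2 \<le> C" "C3 i \<le> C" "C4 i j \<le> C" for i j
    unfolding C_def using C1(1) C2(1) nn s3[of i] s4[of i j] by linarith+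
  show ?thesis
  proof (intro exI[of _ C] conjI ballI allI)
    show "0 \<le> C" using C1(1) le(1) by linarith
  qed (use C1(2) C2(2) C3(2) C4(2) le order_trans in blast)+
qed

lemma C12_uniform:
  assumes "0 < e"
  shows "\<exists>d>0. \<forall>s\<in>{a..b}. \<forall>s'\<in>{a..b}. \<forall>z\<in>K. \<forall>z'\<in>K. \<bar>s - s'\<bar> \<le> d \<longrightarrow> norm (z - z') \<le> d \<longrightarrow>
    \<bar>dt u s z - dt u s' z'\<bar> \<le> e \<and> (\<forall>i. \<bar>dx i u s z - dx i u s' z'\<bar> \<le> e) \<and>
    (\<forall>i j. \<bar>dx j (dx i u) s z - dx j (dx i u) s' z'\<bar> \<le> e)"
proof -
  let ?P = "\<lambda>g d. \<forall>s\<in>{a..b}. \<forall>s'\<in>{a..b}. \<forall>z\<in>K. \<forall>z'\<in>K. \<bar>s - s'\<bar> \<le> d \<longrightarrow> norm (z - z') \<le> d \<longrightarrow>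
    \<bar>g s z - g s' z'\<bar> \<le> e"
  have mono: "?P g d" if "?P g d'" "d \<le> d'" for d d' and g :: "real \<Rightarrow> real^'n \<Rightarrow> real"
    using that by force
  obtain d2 where d2: "d2 > 0" "?P (dt u) d2"
    using cylinder_uniform[OF C12_continuous(2) assms] by blast
  obtain d3 where d3: "\<And>i. d3 i > 0" "\<And>i. ?P (dx i u) (d3 i)"
    using cylinder_uniform[OF C12_continuous(3) assms] by metis
  have "\<forall>i j. \<exists>d>0. ?P (dx j (dx i u)) d"
    using cylinder_uniform[OF C12_continuous(4) assms] by blast
  then obtain d4 where d4: "\<And>i j. d4 i j > 0" "\<And>i j. ?P (dx j (dx i u)) (d4 i j)"
    unfolding choice_iff by blast
  define d where "d = Min (insert d2 (range d3 \<union> range (\<lambda>(i, j). d4 i j)))"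
  have d: "d > 0" unfolding d_def using d2 d3 d4 by (subst Min_gr_iff) auto
  have le: "d \<le> d2" "d \<le> d3 i" "d \<le> d4 i j" for i j
    unfolding d_def by (rule Min_le; force)+
  show ?thesis
    using d mono[OF d2(2) le(1)] mono[OF d3(2) le(2)] mono[OF d4(2) le(3)]
    by (intro exI[of _ d]) blast
qed

text \<open>A Gaussian step is unbounded, so the expansion has to hold for every \<open>v\<close>,
  also when \<open>z + v\<close> leaves \<open>K\<close>; there the indicator puts 0 in place of
  \<open>u\<close>. For small \<open>v\<close> uniform continuity of the second derivatives gives
  the error \<open>e\<close> times the squared norm. For large \<open>v\<close> every term has
  degree at most 2 and is swallowed by a fourth power, whose Gaussian expectation is quadratic in
  the time step. \<open>C\<close> depends on \<open>e\<close> through the threshold between the two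
  cases.\<close>

lemma C12_taylor_bound:
  assumes \<O>: "open \<O>" and r: "0 < r" and e: "0 < e"
  shows "\<exists>C\<ge>0. \<forall>s\<in>{a..b}. \<forall>z. cball z r \<subseteq> K \<longrightarrow> (\<forall>v.
     indicator K (z + v) * u s (z + v) - u s z \<le> (\<Sum>i\<in>UNIV. dx i u s z * v $ i)
       + 1/2 * (\<Sum>i\<in>UNIV. \<Sum>j\<in>UNIV. dx j (dx i u) s z * v $ i * v $ j) + e * (norm v)\<^sup>2 + C * norm v ^ 4)"
proof -
  define n where "n = real CARD('n)"
  have n: "n \<ge> 1" by (simp add: n_def Suc_leI)
  obtain B where B: "B \<ge> 0" "\<And>s z. s \<in> {a..b} \<Longrightarrow> z \<in> K \<Longrightarrow> \<bar>u s z\<bar> \<le> B"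
      "\<And>s z i. s \<in> {a..b} \<Longrightarrow> z \<in> K \<Longrightarrow> \<bar>dx i u s z\<bar> \<le> B"
      "\<And>s z i j. s \<in> {a..b} \<Longrightarrow> z \<in> K \<Longrightarrow> \<bar>dx j (dx i u) s z\<bar> \<le> B"
    using C12_bounds by metis
  \<comment> \<open>The tolerance is divided by \<open>n^2\<close> because the Hessian form has that
    many terms.\<close>
  obtain d0 where d0: "d0 > 0" "\<And>s z z' i j. s \<in> {a..b} \<Longrightarrow> z \<in> K \<Longrightarrow> z' \<in> K \<Longrightarrow> norm (z - z') \<le> d0 \<Longrightarrow>
      \<bar>dx j (dx i u) s z - dx j (dx i u) s z'\<bar> \<le> e / n^2"
  proof -
    have "0 < e / n\<^sup>2" using e n by simp
    from C12_uniform[OF this] obtain d where "d > 0"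
      "\<forall>s\<in>{a..b}. \<forall>s'\<in>{a..b}. \<forall>z\<in>K. \<forall>z'\<in>K. \<bar>s - s'\<bar> \<le> d \<longrightarrow> norm (z - z') \<le> d \<longrightarrow>
        (\<forall>i j. \<bar>dx j (dx i u) s z - dx j (dx i u) s' z'\<bar> \<le> e / n\<^sup>2)" by blast
    then show ?thesis by (intro that[of d]) auto
  qed
  define d where "d = min d0 r"
  have d: "0 < d" "d \<le> d0" "d \<le> r" using d0 r by (auto simp: d_def)
  \<comment> \<open>For \<open>norm v \<ge> d\<close> a term of degree \<open>4 - k\<close> is at
    most its multiple by \<open>1 / d ^ k\<close> of degree 4. The three summands treat in this way
    the values of \<open>u\<close>, the gradient term and the Hessian term.\<close>
  define C where "C = 2 * B / d^4 + n * B / d^3 + 1/2 * (n^2 * B) / d^2"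
  have "C \<ge> 0" using B(1) n d(1) by (simp add: C_def)
  have main: "indicator K (z + v) * u s (z + v) - u s z \<le> (\<Sum>i\<in>UNIV. dx i u s z * v $ i)
       + 1/2 * (\<Sum>i\<in>UNIV. \<Sum>j\<in>UNIV. dx j (dx i u) s z * v $ i * v $ j) + e * (norm v)\<^sup>2 + C * norm v ^ 4"
    if s: "s \<in> {a..b}" and z: "cball z r \<subseteq> K" for s z v
  proof (cases "norm v \<le> d")
    case True
    have seg: "z + c *\<^sub>R v \<in> K" "norm (z + c *\<^sub>R v - z) \<le> d0" if "0 \<le> c" "c \<le> 1" for c
    proof -
      have "norm (c *\<^sub>R v) \<le> 1 * norm v" using that by (simp add: mult_left_le_one_le)
      then show "norm (z + c *\<^sub>R v - z) \<le> d0" using True d by simp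
      have "z + c *\<^sub>R v \<in> cball z r" using \<open>norm (c *\<^sub>R v) \<le> 1 * norm v\<close> True d by (simp add: dist_norm)
      then show "z + c *\<^sub>R v \<in> K" using z by blast
    qed
    have s0: "0 < s" using s a by simp
    have segO: "z + c *\<^sub>R v \<in> \<O>" if "0 \<le> c" "c \<le> 1" for c
      using seg(1)[OF that] K by blast
    obtain c where c: "c \<in> {0..1}" and eq: "u s (z + v) - u s z = (\<Sum>i\<in>UNIV. dx i u s z * v $ i)
     + 1/2 * (\<Sum>i\<in>UNIV. \<Sum>j\<in>UNIV. dx j (dx i u) s (z + c *\<^sub>R v) * v $ i * v $ j)"
      using taylor2_partials[OF \<O> segO C12_deriv(2)[OF s0] C12_continuous_slice(3)[OF s0]
          C12_deriv(3)[OF s0] C12_continuous_slice(4)[OF s0]] by auto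
    have vK: "z + v \<in> K" and zK: "z \<in> K" using seg(1)[of 1] seg(1)[of 0] by auto
    have "(\<Sum>i\<in>UNIV. \<Sum>j\<in>UNIV. dx j (dx i u) s (z + c *\<^sub>R v) * v $ i * v $ j)
        - (\<Sum>i\<in>UNIV. \<Sum>j\<in>UNIV. dx j (dx i u) s z * v $ i * v $ j)
      = (\<Sum>i\<in>UNIV. \<Sum>j\<in>UNIV. (dx j (dx i u) s (z + c *\<^sub>R v) - dx j (dx i u) s z) * v $ i * v $ j)"
      by (simp add: algebra_simps sum_subtractf)
    also have "\<dots> \<le> (\<Sum>i\<in>(UNIV::'n set). \<Sum>j\<in>(UNIV::'n set). e / n\<^sup>2 * (norm v * norm v))"
    proof (intro sum_mono)
      fix i j
      have 1: "\<bar>dx j (dx i u) s (z + c *\<^sub>R v) - dx j (dx i u) s z\<bar> \<le> e / n\<^sup>2"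
        using d0(2)[OF s seg(1) zK seg(2)] c by auto
      have "(dx j (dx i u) s (z + c *\<^sub>R v) - dx j (dx i u) s z) * v $ i * v $ j \<le>
         \<bar>dx j (dx i u) s (z + c *\<^sub>R v) - dx j (dx i u) s z\<bar> * (\<bar>v $ i\<bar> * \<bar>v $ j\<bar>)"
        by (rule order_trans[OF abs_ge_self]) (simp add: abs_mult mult.assoc)
      also have "\<dots> \<le> e / n\<^sup>2 * (norm v * norm v)"
        using 1 e n by (intro mult_mono component_le_norm_cart) auto
      finally show "(dx j (dx i u) s (z + c *\<^sub>R v) - dx j (dx i u) s z) * v $ i * v $ j \<le> e / n\<^sup>2 * (norm v * norm v)" .
    qed
    also have "\<dots> = e * (norm v)\<^sup>2"
      using n by (simp add: power2_eq_square flip: n_def)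
    finally have "(\<Sum>i\<in>UNIV. \<Sum>j\<in>UNIV. dx j (dx i u) s (z + c *\<^sub>R v) * v $ i * v $ j)
      \<le> (\<Sum>i\<in>UNIV. \<Sum>j\<in>UNIV. dx j (dx i u) s z * v $ i * v $ j) + e * (norm v)\<^sup>2" by linarith
    moreover have "0 \<le> e * (norm v)\<^sup>2" "0 \<le> C * norm v ^ 4" using e \<open>C \<ge> 0\<close> by auto
    ultimately show ?thesis using eq vK by simp
  next
    case False
    then have dv: "d \<le> norm v" by simp
    have nv: "0 < norm v" using dv d by linarith
    have zK: "z \<in> K" using z r by auto
    have "indicator K (z + v) * u s (z + v) \<le> B"
      using B(1) B(2)[OF s, of "z + v"] by (auto simp: indicator_def)
    then have 1: "indicator K (z + v) * u s (z + v) - u s z \<le> 2 * B"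
      using B(2)[OF s zK] by linarith
    have "\<bar>\<Sum>i\<in>UNIV. dx i u s z * v $ i\<bar> \<le> (\<Sum>i\<in>(UNIV::'n set). B * norm v)"
      by (rule order_trans[OF sum_abs sum_mono])
        (auto simp: abs_mult intro!: mult_mono component_le_norm_cart B(1) B(3)[OF s zK])
    then have 2: "\<bar>\<Sum>i\<in>UNIV. dx i u s z * v $ i\<bar> \<le> n * B * norm v" by (simp add: n_def)
    have "\<bar>\<Sum>i\<in>UNIV. \<Sum>j\<in>UNIV. dx j (dx i u) s z * v $ i * v $ j\<bar>
        \<le> (\<Sum>i\<in>(UNIV::'n set). \<Sum>j\<in>(UNIV::'n set). B * norm v * norm v)"
      by (rule order_trans[OF sum_abs sum_mono], rule order_trans[OF sum_abs sum_mono])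
        (auto simp: abs_mult B(1) intro!: mult_mono component_le_norm_cart B(4)[OF s zK])
    then have 3: "\<bar>\<Sum>i\<in>UNIV. \<Sum>j\<in>UNIV. dx j (dx i u) s z * v $ i * v $ j\<bar> \<le> n^2 * B * (norm v)^2"
      by (simp add: n_def power2_eq_square mult_ac)
    have p: "norm v ^ (4 - k) \<le> norm v ^ 4 / d ^ k" if "k \<le> 4" for k
    proof -
      have "norm v ^ (4 - k) * d ^ k \<le> norm v ^ (4 - k) * norm v ^ k"
        using dv d by (intro mult_left_mono power_mono) auto
      also have "\<dots> = norm v ^ 4" using that by (simp flip: power_add)
      finally show ?thesis using d by (simp add: field_simps)
    qed
    have q1: "2 * B \<le> 2 * B / d^4 * norm v ^ 4"
      using mult_left_mono[OF p[of 4], of "2 * B"] B(1) by simp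
    have q2: "n * B * norm v \<le> n * B / d^3 * norm v ^ 4"
      using mult_left_mono[OF p[of 3], of "n * B"] B(1) n by simp
    have q3: "n^2 * B * (norm v)^2 \<le> n^2 * B / d^2 * norm v ^ 4"
      using mult_left_mono[OF p[of 2], of "n^2 * B"] B(1) n by simp
    have "C * norm v ^ 4 = 2 * B / d^4 * norm v ^ 4 + n * B / d^3 * norm v ^ 4 + 1/2 * (n^2 * B / d^2 * norm v ^ 4)"
      by (simp add: C_def algebra_simps)
    moreover have "0 \<le> e * (norm v)\<^sup>2" using e by auto
    \<comment> \<open>Stated for abstract reals, so that the arithmetic does not descend into the
      sums.\<close>
    moreover have "X \<le> S1 + 1/2 * S2 + E + Q" if "Q = P1 + P2 + 1/2 * P3" "0 \<le> E" "X \<le> A1"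
      "\<bar>S1\<bar> \<le> A2" "\<bar>S2\<bar> \<le> A3" "A1 \<le> P1" "A2 \<le> P2" "A3 \<le> P3"
      for X S1 S2 E Q P1 P2 P3 A1 A2 A3 :: real
      using that by linarith
    ultimately show ?thesis using 1 2 3 q1 q2 q3 by blast
  qed
  then show ?thesis using \<open>C \<ge> 0\<close> by blast
qed

text \<open>The part of a grid step that is left after the martingale increment: time moves from
  \<open>s\<close> to \<open>s'\<close> and the drift moves the point from
  \<open>z - \<Delta>\<close> to \<open>z\<close>. Neither has quadratic variation, so first order
  is enough: the mean value theorem is applied to space at time \<open>s\<close> and then to time at
  the point \<open>z\<close>.\<close>

lemma C12_increment:
  assumes \<O>: "open \<O>" and z: "cball z r \<subseteq> K" "norm \<Delta> \<le> r" and s: "a \<le> s'" "s' \<le> s"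
  shows "\<exists>c\<in>{s'..s}. \<exists>p\<in>K. norm (p - z) \<le> norm \<Delta> \<and>
     u s' z - u s (z - \<Delta>) = - (s - s') * dt u c z + (\<Sum>i\<in>UNIV. dx i u s p * \<Delta> $ i)"
proof -
  have zO: "z \<in> \<O>" using z K norm_ge_zero[of \<Delta>] by (meson centre_in_cball order_trans subsetD)
  have seg: "z - \<Delta> + c *\<^sub>R \<Delta> \<in> K" "norm (z - \<Delta> + c *\<^sub>R \<Delta> - z) \<le> norm \<Delta>" if "0 \<le> c" "c \<le> 1" for c
  proof -
    have eq: "z - \<Delta> + c *\<^sub>R \<Delta> - z = (c - 1) *\<^sub>R \<Delta>" by (simp add: algebra_simps)
    show 1: "norm (z - \<Delta> + c *\<^sub>R \<Delta> - z) \<le> norm \<Delta>" unfolding eq using that by (simp add: mult_left_le_one_le)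
    then have "z - \<Delta> + c *\<^sub>R \<Delta> \<in> cball z r" using z(2) by (simp add: dist_norm norm_minus_commute)
    with z(1) show "z - \<Delta> + c *\<^sub>R \<Delta> \<in> K" by blast
  qed
  have s0: "0 < s" using s a by simp
  have segO: "z - \<Delta> + c *\<^sub>R \<Delta> \<in> \<O>" if "0 \<le> c" "c \<le> 1" for c
    using seg(1)[OF that] K by blast
  obtain c where c: "c \<in> {0..1}" and eq: "u s (z - \<Delta> + \<Delta>) - u s (z - \<Delta>) = (\<Sum>i\<in>UNIV. dx i u s (z - \<Delta> + c *\<^sub>R \<Delta>) * \<Delta> $ i)"
    using mvt_partials[OF \<O> segO C12_deriv(2)[OF s0] C12_continuous_slice(3)[OF s0]] by auto
  have "\<exists>c\<in>{s'..s}. u s z - u s' z = (s - s') * dt u c z"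
  proof (cases "s' = s")
    case False
    then have "s' < s" using s by simp
    from MVT2[OF this, of "\<lambda>s. u s z" "\<lambda>c. dt u c z"] C12_deriv(1)[OF _ zO] s a
    obtain c where "s' < c" "c < s" "u s z - u s' z = (s - s') * dt u c z" by force
    then show ?thesis by (intro bexI[of _ c]) auto
  qed auto
  then obtain c' where "c' \<in> {s'..s}" "u s z - u s' z = (s - s') * dt u c' z" by blast
  then have "c' \<in> {s'..s}" "u s' z - u s z = - (s - s') * dt u c' z" by (auto simp: algebra_simps)
  then show ?thesis using eq seg c
    by (intro bexI[of _ c'] bexI[of _ "z - \<Delta> + c *\<^sub>R \<Delta>"]) auto
qed

end

end

section \<open>The discrete supermartingale inequality\<close>

text \<open>Passing through the sum of absolute values costs the number of matrix entries, a crude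
  but explicit constant that reappears in the powers of \<open>n\<close> in the error terms
  below.\<close>

lemma norm_matrix_combination_le:
  fixes x :: "'n::finite \<Rightarrow> 'n \<Rightarrow> real" and D :: "real^'n"
  assumes "\<And>i k. \<bar>x i k\<bar> \<le> C"
  shows "norm (\<chi> i. \<Sum>k\<in>UNIV. x i k * D $ k) \<le> real CARD('n) ^ 2 * C * norm D"
proof -
  have "norm (\<chi> i. \<Sum>k\<in>UNIV. x i k * D $ k) \<le> (\<Sum>i\<in>UNIV. \<bar>(\<chi> i. \<Sum>k\<in>UNIV. x i k * D $ k) $ i\<bar>)"
    by (rule norm_le_l1_cart)
  also have "\<dots> \<le> (\<Sum>i\<in>(UNIV::'n set). \<Sum>k\<in>(UNIV::'n set). C * norm D)"
  proof (rule sum_mono)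
    fix i
    have "0 \<le> C" using assms abs_ge_zero order_trans by blast
    then show "\<bar>(\<chi> i. \<Sum>k\<in>UNIV. x i k * D $ k) $ i\<bar> \<le> (\<Sum>k\<in>(UNIV::'n set). C * norm D)"
      by (simp only: vec_lambda_beta)
        (rule order_trans[OF sum_abs sum_mono],
          auto simp: abs_mult assms intro!: mult_mono component_le_norm_cart)
  qed
  also have "\<dots> = real CARD('n) ^ 2 * C * norm D" by (simp add: power2_eq_square)
  finally show ?thesis .
qed

context brownian
begin

text \<open>Take expectations in the Taylor bound term by term: the gradient part has mean 0, the
  covariance of the increment keeps only equal column indices in the Hessian part, and the two norm
  terms use second and fourth moments. The constant \<open>n ^ 5\<close> is \<open>(n^2)^2\<close>
  from the matrix bound times \<open>n\<close> coordinates. In \<open>3 * n ^ 10\<close> the matrix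
  bound gives \<open>(n^2)^4\<close>, \<open>norm_pow4_le\<close> one further \<open>n\<close>, the
  coordinates another, and 3 is the fourth normal moment.\<close>

lemma one_step_bound:
  fixes P :: "'n \<Rightarrow> 'w \<Rightarrow> real" and Q :: "'n \<Rightarrow> 'n \<Rightarrow> 'w \<Rightarrow> real" and \<xi> :: "'n \<Rightarrow> 'n \<Rightarrow> 'w \<Rightarrow> real"
    and h s t :: real
  defines "h \<equiv> t - s"
  defines "n \<equiv> real CARD('n)"
  defines "v \<equiv> \<lambda>\<omega>. (\<chi> i. \<Sum>k\<in>UNIV. \<xi> i k \<omega> * (W t \<omega> - W s \<omega>) $ k)"
  assumes st: "0 \<le> s" "s < t"
    and P: "\<And>i. P i \<in> borel_measurable (F s)" "\<And>i \<omega>. \<omega> \<in> space M \<Longrightarrow> \<bar>P i \<omega>\<bar> \<le> B"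
    and Q: "\<And>i j. Q i j \<in> borel_measurable (F s)" "\<And>i j \<omega>. \<omega> \<in> space M \<Longrightarrow> \<bar>Q i j \<omega>\<bar> \<le> B"
    and \<xi>: "\<And>i k. \<xi> i k \<in> borel_measurable (F s)" "\<And>i k \<omega>. \<omega> \<in> space M \<Longrightarrow> \<bar>\<xi> i k \<omega>\<bar> \<le> X"
    and eC: "0 \<le> e" "0 \<le> C"
    and Y: "integrable M Y1" "integrable M Y0"
    and le: "\<And>\<omega>. \<omega> \<in> space M \<Longrightarrow> Y1 \<omega> - Y0 \<omega> \<le> (\<Sum>i\<in>UNIV. P i \<omega> * v \<omega> $ i)
       + 1/2 * (\<Sum>i\<in>UNIV. \<Sum>j\<in>UNIV. Q i j \<omega> * v \<omega> $ i * v \<omega> $ j) + e * (norm (v \<omega>))\<^sup>2 + C * norm (v \<omega>) ^ 4"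
  shows "(\<integral>\<omega>. Y1 \<omega> \<partial>M) \<le> (\<integral>\<omega>. Y0 \<omega> \<partial>M)
      + (\<integral>\<omega>. 1/2 * h * (\<Sum>i\<in>UNIV. \<Sum>j\<in>UNIV. \<Sum>k\<in>UNIV. Q i j \<omega> * \<xi> i k \<omega> * \<xi> j k \<omega>) \<partial>M)
      + (e * (n ^ 5 * X\<^sup>2) * h + C * (3 * n ^ 10 * X ^ 4) * h\<^sup>2)"
proof -
  have h: "0 < h" using st by (simp add: h_def)
  define D where "D \<omega> = W t \<omega> - W s \<omega>" for \<omega>
  obtain \<omega>0 where "\<omega>0 \<in> space M" using not_empty by blast
  then have X: "0 \<le> X" and B: "0 \<le> B"
    using \<xi>(2)[of \<omega>0] P(2)[of \<omega>0] abs_ge_zero order_trans by blast+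
  have n: "0 \<le> n" by (simp add: n_def)
  note [measurable] = P(1) Q(1) \<xi>(1)
  have single: "integrable M (\<lambda>\<omega>. V \<omega> * (D \<omega> $ k) ^ m)"
      "(\<integral>\<omega>. V \<omega> * (D \<omega> $ k) ^ m \<partial>M) = (\<integral>\<omega>. V \<omega> \<partial>M) * (\<integral>x. normal_density 0 (sqrt h) x * x ^ m \<partial>lborel)"
    if "V \<in> borel_measurable (F s)" "\<And>\<omega>. \<omega> \<in> space M \<Longrightarrow> \<bar>V \<omega>\<bar> \<le> A" for V A k m
    using expectation_increment[OF st that, of "\<lambda>y. (y $ k) ^ m"] gauss_density_single[OF h, of k m]
    unfolding D_def h_def by auto
  have pair: "integrable M (\<lambda>\<omega>. V \<omega> * (D \<omega> $ k * D \<omega> $ l))"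
      "(\<integral>\<omega>. V \<omega> * (D \<omega> $ k * D \<omega> $ l) \<partial>M) = (\<integral>\<omega>. V \<omega> \<partial>M) * (if k = l then h else 0)"
    if "V \<in> borel_measurable (F s)" "\<And>\<omega>. \<omega> \<in> space M \<Longrightarrow> \<bar>V \<omega>\<bar> \<le> A" for V A k l
    using expectation_increment[OF st that, of "\<lambda>y. y $ k * y $ l"] gauss_density_pair[OF h, of k l]
    unfolding D_def h_def by auto
  define R1 where "R1 \<omega> = (\<Sum>i\<in>UNIV. \<Sum>k\<in>UNIV. (P i \<omega> * \<xi> i k \<omega>) * D \<omega> $ k)" for \<omega>
  define R2 where "R2 \<omega> = (\<Sum>i\<in>UNIV. \<Sum>j\<in>UNIV. \<Sum>k\<in>UNIV. \<Sum>l\<in>UNIV.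
      (Q i j \<omega> * \<xi> i k \<omega> * \<xi> j l \<omega>) * (D \<omega> $ k * D \<omega> $ l))" for \<omega>
  define R3 where "R3 \<omega> = (\<Sum>k\<in>UNIV. 1 * (D \<omega> $ k) ^ 2)" for \<omega>
  define R4 where "R4 \<omega> = (\<Sum>k\<in>UNIV. 1 * (D \<omega> $ k) ^ 4)" for \<omega>
  have mP: "(\<lambda>\<omega>. P i \<omega> * \<xi> i k \<omega>) \<in> borel_measurable (F s)" "\<omega> \<in> space M \<Longrightarrow> \<bar>P i \<omega> * \<xi> i k \<omega>\<bar> \<le> B * X" for i k \<omega>
    by (simp, auto simp: abs_mult intro!: mult_mono P(2) \<xi>(2) B)
  have mQ: "(\<lambda>\<omega>. Q i j \<omega> * \<xi> i k \<omega> * \<xi> j l \<omega>) \<in> borel_measurable (F s)"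
      "\<omega> \<in> space M \<Longrightarrow> \<bar>Q i j \<omega> * \<xi> i k \<omega> * \<xi> j l \<omega>\<bar> \<le> B * X * X" for i j k l \<omega>
    by (simp, auto simp: abs_mult intro!: mult_mono Q(2) \<xi>(2) B X mult_nonneg_nonneg)
  have I1: "integrable M R1" "(\<integral>\<omega>. R1 \<omega> \<partial>M) = 0"
  proof -
    have "integrable M (\<lambda>\<omega>. P i \<omega> * \<xi> i k \<omega> * D \<omega> $ k)" "(\<integral>\<omega>. P i \<omega> * \<xi> i k \<omega> * D \<omega> $ k \<partial>M) = 0" for i k
      using single[OF mP, of i k k 1] normal_moments(1)[OF h] by auto
    then show "integrable M R1" "(\<integral>\<omega>. R1 \<omega> \<partial>M) = 0"
      unfolding R1_def by (auto simp: Bochner_Integration.integral_sum)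
  qed
  have I2: "integrable M R2"
    unfolding R2_def using pair[OF mQ] by auto
  have "(\<integral>\<omega>. R2 \<omega> \<partial>M) = (\<Sum>i\<in>UNIV. \<Sum>j\<in>UNIV. \<Sum>k\<in>UNIV. \<Sum>l\<in>UNIV.
      (\<integral>\<omega>. Q i j \<omega> * \<xi> i k \<omega> * \<xi> j l \<omega> \<partial>M) * (if k = l then h else 0))"
    unfolding R2_def by (simp add: Bochner_Integration.integral_sum pair[OF mQ])
  also have "\<dots> = (\<Sum>i\<in>UNIV. \<Sum>j\<in>UNIV. \<Sum>k\<in>UNIV. (\<integral>\<omega>. Q i j \<omega> * \<xi> i k \<omega> * \<xi> j k \<omega> \<partial>M) * h)"
    by (simp add: if_distrib cong: if_cong)
  also have "\<dots> = h * (\<integral>\<omega>. (\<Sum>i\<in>UNIV. \<Sum>j\<in>UNIV. \<Sum>k\<in>UNIV. Q i j \<omega> * \<xi> i k \<omega> * \<xi> j k \<omega>) \<partial>M)"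
  proof -
    have "integrable M (\<lambda>\<omega>. Q i j \<omega> * \<xi> i k \<omega> * \<xi> j l \<omega>)" for i j k l
      by (rule integrable_const_bound[of _ "B * X * X"]) (use mQ measurable_F_M[OF mQ(1) st(1)] in auto)
    then show ?thesis by (simp add: Bochner_Integration.integral_sum sum_distrib_left mult.commute)
  qed
  finally have I2': "(\<integral>\<omega>. R2 \<omega> \<partial>M) = h * (\<integral>\<omega>. (\<Sum>i\<in>UNIV. \<Sum>j\<in>UNIV. \<Sum>k\<in>UNIV. Q i j \<omega> * \<xi> i k \<omega> * \<xi> j k \<omega>) \<partial>M)" .
  have one: "(\<lambda>_. 1::real) \<in> borel_measurable (F s)" "\<omega> \<in> space M \<Longrightarrow> \<bar>1::real\<bar> \<le> 1" for \<omega> :: 'w by auto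
  have single1: "integrable M (\<lambda>\<omega>. 1 * (D \<omega> $ k) ^ m)"
      "(\<integral>\<omega>. 1 * (D \<omega> $ k) ^ m \<partial>M) = (\<integral>x. normal_density 0 (sqrt h) x * x ^ m \<partial>lborel)" for k m
    using single(1)[OF one] single(2)[OF one] by (simp_all add: prob_space)
  have I3: "integrable M R3" "(\<integral>\<omega>. R3 \<omega> \<partial>M) = n * h"
    unfolding R3_def using single1 normal_moments(2)[OF h]
    by (auto simp: Bochner_Integration.integral_sum n_def prob_space)
  have I4: "integrable M R4" "(\<integral>\<omega>. R4 \<omega> \<partial>M) = n * (3 * h\<^sup>2)"
    unfolding R4_def using single1 normal_moments(3)[OF h]
    by (auto simp: Bochner_Integration.integral_sum n_def prob_space)
  \<comment> \<open>A dominating function made of polynomials in the increment with coefficients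
    known at time \<open>s\<close>, so its expectation can be computed exactly.\<close>
  define R where "R \<omega> = R1 \<omega> + 1/2 * R2 \<omega> + e * (n^4 * X\<^sup>2) * R3 \<omega> + C * (n ^ 9 * X ^ 4) * R4 \<omega>" for \<omega>
  have pointwise: "Y1 \<omega> - Y0 \<omega> \<le> R \<omega>" if \<omega>: "\<omega> \<in> space M" for \<omega>
  proof -
    have nv: "norm (v \<omega>) \<le> n^2 * X * norm (D \<omega>)"
      unfolding v_def n_def D_def by (rule norm_matrix_combination_le) (use \<xi>(2) \<omega> in auto)
    have "(norm (D \<omega>))\<^sup>2 = R3 \<omega>"
      by (simp add: norm_vec_def L2_set_def sum_nonneg R3_def)
    then have v2: "(norm (v \<omega>))\<^sup>2 \<le> n^4 * X\<^sup>2 * R3 \<omega>"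
      using power_mono[OF nv, of 2] by (simp add: power_mult_distrib flip: power_mult)
    have v4: "norm (v \<omega>) ^ 4 \<le> n ^ 9 * X ^ 4 * R4 \<omega>"
    proof -
      have "norm (v \<omega>) ^ 4 \<le> n ^ 8 * X ^ 4 * norm (D \<omega>) ^ 4"
        using power_mono[OF nv, of 4] by (simp add: power_mult_distrib flip: power_mult)
      also have "\<dots> \<le> n ^ 8 * X ^ 4 * (n * R4 \<omega>)"
        using norm_pow4_le[of "D \<omega>"] n X by (intro mult_left_mono) (auto simp: n_def R4_def)
      finally show ?thesis by (simp add: algebra_simps eval_nat_numeral)
    qed
    have r1: "(\<Sum>i\<in>UNIV. P i \<omega> * v \<omega> $ i) = R1 \<omega>"
      by (simp add: v_def R1_def D_def sum_distrib_left mult.assoc)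
    have r2: "(\<Sum>i\<in>UNIV. \<Sum>j\<in>UNIV. Q i j \<omega> * v \<omega> $ i * v \<omega> $ j) = R2 \<omega>"
      unfolding R2_def
    proof (intro sum.cong refl)
      fix i j
      have "v \<omega> $ i * v \<omega> $ j = (\<Sum>k\<in>UNIV. \<Sum>l\<in>UNIV. (\<xi> i k \<omega> * D \<omega> $ k) * (\<xi> j l \<omega> * D \<omega> $ l))"
        unfolding v_def D_def by (simp add: sum_product)
      then show "Q i j \<omega> * v \<omega> $ i * v \<omega> $ j = (\<Sum>k\<in>UNIV. \<Sum>l\<in>UNIV.
          (Q i j \<omega> * \<xi> i k \<omega> * \<xi> j l \<omega>) * (D \<omega> $ k * D \<omega> $ l))"
        by (simp add: mult.assoc sum_distrib_left) (simp add: mult_ac)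
    qed
    have "e * (norm (v \<omega>))\<^sup>2 \<le> e * (n^4 * X\<^sup>2 * R3 \<omega>)" "C * norm (v \<omega>) ^ 4 \<le> C * (n ^ 9 * X ^ 4 * R4 \<omega>)"
      using v2 v4 eC by (auto intro: mult_left_mono)
    then show ?thesis using le[OF \<omega>] unfolding r1 r2 R_def by (simp add: mult.assoc)
  qed
  have IR: "integrable M R" unfolding R_def using I1(1) I2 I3(1) I4(1) by auto
  have "(\<integral>\<omega>. Y1 \<omega> \<partial>M) - (\<integral>\<omega>. Y0 \<omega> \<partial>M) = (\<integral>\<omega>. Y1 \<omega> - Y0 \<omega> \<partial>M)"
    using Y by simp
  also have "\<dots> \<le> (\<integral>\<omega>. R \<omega> \<partial>M)"
    by (rule integral_mono) (use Y IR pointwise in auto)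
  also have "\<dots> = 1/2 * (\<integral>\<omega>. R2 \<omega> \<partial>M) + e * (n^4 * X\<^sup>2) * (n * h) + C * (n ^ 9 * X ^ 4) * (n * (3 * h\<^sup>2))"
    unfolding R_def using I1 I2 I3 I4 by simp
  also have "\<dots> = (\<integral>\<omega>. 1/2 * h * (\<Sum>i\<in>UNIV. \<Sum>j\<in>UNIV. \<Sum>k\<in>UNIV. Q i j \<omega> * \<xi> i k \<omega> * \<xi> j k \<omega>) \<partial>M)
      + (e * (n ^ 5 * X\<^sup>2) * h + C * (3 * n ^ 10 * X ^ 4) * h\<^sup>2)"
    unfolding I2' by (simp add: algebra_simps eval_nat_numeral)
  finally show ?thesis by linarith
qed

text \<open>\<open>Y k\<close> is meant as the value after the Gaussian part of step
  \<open>k\<close>, and \<open>A k\<close> as the contribution of time and drift in the same step;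
  \<open>one_step_bound\<close> compares \<open>Y k\<close> with \<open>\<Phi> k\<close>. An error
  \<open>h\<^sup>2\<close> is at most \<open>\<delta> * h\<close>, so all errors add up to a
  multiple of \<open>\<tau> N\<close>.\<close>

lemma discrete_supermartingale_bound:
  fixes \<tau> :: "nat \<Rightarrow> real" and \<Phi> A Y :: "nat \<Rightarrow> 'w \<Rightarrow> real"
    and P :: "nat \<Rightarrow> 'n \<Rightarrow> 'w \<Rightarrow> real" and Q :: "nat \<Rightarrow> 'n \<Rightarrow> 'n \<Rightarrow> 'w \<Rightarrow> real" and \<xi> :: "nat \<Rightarrow> 'n \<Rightarrow> 'n \<Rightarrow> 'w \<Rightarrow> real"
  defines "n \<equiv> real CARD('n)"
  defines "v \<equiv> \<lambda>k \<omega>. (\<chi> i. \<Sum>l\<in>UNIV. \<xi> k i l \<omega> * (W (\<tau> (Suc k)) \<omega> - W (\<tau> k) \<omega>) $ l)"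
  assumes \<tau>: "\<tau> 0 = 0" "\<And>k. k < N \<Longrightarrow> \<tau> k < \<tau> (Suc k)" "\<And>k. k < N \<Longrightarrow> \<tau> (Suc k) - \<tau> k \<le> \<delta>"
    and P: "\<And>k i. k < N \<Longrightarrow> P k i \<in> borel_measurable (F (\<tau> k))" "\<And>k i \<omega>. k < N \<Longrightarrow> \<omega> \<in> space M \<Longrightarrow> \<bar>P k i \<omega>\<bar> \<le> B"
    and Q: "\<And>k i j. k < N \<Longrightarrow> Q k i j \<in> borel_measurable (F (\<tau> k))" "\<And>k i j \<omega>. k < N \<Longrightarrow> \<omega> \<in> space M \<Longrightarrow> \<bar>Q k i j \<omega>\<bar> \<le> B"
    and \<xi>: "\<And>k i l. k < N \<Longrightarrow> \<xi> k i l \<in> borel_measurable (F (\<tau> k))" "\<And>k i l \<omega>. k < N \<Longrightarrow> \<omega> \<in> space M \<Longrightarrow> \<bar>\<xi> k i l \<omega>\<bar> \<le> X"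
    and eC: "0 \<le> e" "0 \<le> C"
    and int: "\<And>k. k \<le> N \<Longrightarrow> integrable M (\<Phi> k)" "\<And>k. k < N \<Longrightarrow> integrable M (A k)" "\<And>k. k < N \<Longrightarrow> integrable M (Y k)"
    and le: "\<And>k \<omega>. k < N \<Longrightarrow> \<omega> \<in> space M \<Longrightarrow> Y k \<omega> - \<Phi> k \<omega> \<le> (\<Sum>i\<in>UNIV. P k i \<omega> * v k \<omega> $ i)
       + 1/2 * (\<Sum>i\<in>UNIV. \<Sum>j\<in>UNIV. Q k i j \<omega> * v k \<omega> $ i * v k \<omega> $ j) + e * (norm (v k \<omega>))\<^sup>2 + C * norm (v k \<omega>) ^ 4"
    and step: "\<And>k \<omega>. k < N \<Longrightarrow> \<omega> \<in> space M \<Longrightarrow> \<Phi> (Suc k) \<omega> \<le> A k \<omega> + Y k \<omega>"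
  shows "(\<integral>\<omega>. \<Phi> N \<omega> \<partial>M) \<le> (\<integral>\<omega>. \<Phi> 0 \<omega> \<partial>M)
      + (\<integral>\<omega>. (\<Sum>k<N. A k \<omega> + 1/2 * (\<tau> (Suc k) - \<tau> k) *
            (\<Sum>i\<in>UNIV. \<Sum>j\<in>UNIV. \<Sum>l\<in>UNIV. Q k i j \<omega> * \<xi> k i l \<omega> * \<xi> k j l \<omega>)) \<partial>M)
      + (e * (n ^ 5 * X\<^sup>2) + C * (3 * n ^ 10 * X ^ 4) * \<delta>) * \<tau> N"
proof -
  define G where "G k \<omega> = 1/2 * (\<tau> (Suc k) - \<tau> k) *
      (\<Sum>i\<in>UNIV. \<Sum>j\<in>UNIV. \<Sum>l\<in>UNIV. Q k i j \<omega> * \<xi> k i l \<omega> * \<xi> k j l \<omega>)" for k \<omega>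
  define c where "c = e * (n ^ 5 * X\<^sup>2) + C * (3 * n ^ 10 * X ^ 4) * \<delta>"
  have nonneg: "0 \<le> \<tau> k" if "k \<le> N" for k
    using that
  proof (induction k)
    case (Suc k)
    then show ?case using \<tau>(2)[of k] by simp
  qed (simp add: \<tau>)
  have intG: "integrable M (G k)" if "k < N" for k
  proof -
    obtain \<omega>0 where "\<omega>0 \<in> space M" using not_empty by blast
    then have X: "0 \<le> X" and B: "0 \<le> B"
      using \<xi>(2)[OF that, of \<omega>0] P(2)[OF that, of \<omega>0] abs_ge_zero order_trans by blast+
    have [measurable]: "\<xi> k i l \<in> borel_measurable M" "Q k i j \<in> borel_measurable M" for i j l
      using that nonneg[of k] by (auto intro!: measurable_F_M[OF \<xi>(1)[OF that]] measurable_F_M[OF Q(1)[OF that]])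
    have "integrable M (\<lambda>\<omega>. Q k i j \<omega> * \<xi> k i l \<omega> * \<xi> k j l \<omega>)" for i j l
      by (rule integrable_const_bound[of _ "B * X * X"])
        (auto simp: abs_mult intro!: mult_mono Q(2) \<xi>(2) B X mult_nonneg_nonneg that AE_I2)
    then show ?thesis unfolding G_def by auto
  qed
  have "(\<integral>\<omega>. \<Phi> m \<omega> \<partial>M) \<le> (\<integral>\<omega>. \<Phi> 0 \<omega> \<partial>M) + (\<integral>\<omega>. (\<Sum>k<m. A k \<omega> + G k \<omega>) \<partial>M) + c * \<tau> m" if "m \<le> N" for m
    using that
  proof (induction m)
    case 0
    then show ?case by (simp add: \<tau>)
  next
    case (Suc m)
    then have m: "m < N" by simp
    define h where "h = \<tau> (Suc m) - \<tau> m"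
    have h: "0 < h" "h \<le> \<delta>" using \<tau>(2,3)[OF m] by (auto simp: h_def)
    have "(\<integral>\<omega>. Y m \<omega> \<partial>M) \<le> (\<integral>\<omega>. \<Phi> m \<omega> \<partial>M) + (\<integral>\<omega>. G m \<omega> \<partial>M)
        + (e * (n ^ 5 * X\<^sup>2) * h + C * (3 * n ^ 10 * X ^ 4) * h\<^sup>2)"
      unfolding G_def h_def n_def
      by (rule one_step_bound[where P="P m" and B=B])
        (use m nonneg[of m] \<tau>(2)[OF m] P Q \<xi> eC int le[OF m] in \<open>auto simp: v_def\<close>)
    also have "C * (3 * n ^ 10 * X ^ 4) * h\<^sup>2 \<le> C * (3 * n ^ 10 * X ^ 4) * (\<delta> * h)"
      using h eC by (intro mult_left_mono) (auto simp: power2_eq_square n_def)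
    finally have 1: "(\<integral>\<omega>. Y m \<omega> \<partial>M) \<le> (\<integral>\<omega>. \<Phi> m \<omega> \<partial>M) + (\<integral>\<omega>. G m \<omega> \<partial>M) + c * h"
      by (simp add: c_def algebra_simps)
    have "(\<integral>\<omega>. \<Phi> (Suc m) \<omega> \<partial>M) \<le> (\<integral>\<omega>. A m \<omega> + Y m \<omega> \<partial>M)"
      by (rule integral_mono) (use int Suc.prems m step in auto)
    also have "\<dots> = (\<integral>\<omega>. A m \<omega> \<partial>M) + (\<integral>\<omega>. Y m \<omega> \<partial>M)"
      using int m by simp
    finally have 2: "(\<integral>\<omega>. \<Phi> (Suc m) \<omega> \<partial>M) \<le> (\<integral>\<omega>. A m \<omega> \<partial>M) + (\<integral>\<omega>. Y m \<omega> \<partial>M)" .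
    have "(\<integral>\<omega>. (\<Sum>k<Suc m. A k \<omega> + G k \<omega>) \<partial>M) = (\<integral>\<omega>. (\<Sum>k<m. A k \<omega> + G k \<omega>) \<partial>M) + ((\<integral>\<omega>. A m \<omega> \<partial>M) + (\<integral>\<omega>. G m \<omega> \<partial>M))"
    proof -
      have "integrable M (\<lambda>\<omega>. \<Sum>k<m. A k \<omega> + G k \<omega>)" "integrable M (\<lambda>\<omega>. A m \<omega> + G m \<omega>)"
        using int(2) intG m by auto
      from Bochner_Integration.integral_add[OF this] show ?thesis
        using int(2) intG m by simp
    qed
    moreover have "c * \<tau> (Suc m) = c * \<tau> m + c * h" by (simp add: h_def algebra_simps)
    ultimately show ?case using 1 2 Suc.IH m by linarith
  qed
  from this[of N] show ?thesis unfolding G_def c_def by simp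
qed

end

section \<open>Elementary integrals on a grid\<close>

lemma partition_range:
  fixes \<tau> :: "nat \<Rightarrow> real"
  assumes "\<tau> 0 = 0" "\<tau> N = T" "\<And>k. k < N \<Longrightarrow> \<tau> k < \<tau> (Suc k)" "k \<le> N"
  shows "0 \<le> \<tau> k \<and> \<tau> k \<le> T"
proof
  show "0 \<le> \<tau> k" using assms(4)
  proof (induction k)
    case (Suc k) then show ?case using assms(3)[of k] by simp
  qed (simp add: assms(1))
  have "\<tau> k \<le> \<tau> N" using assms(4)
  proof (induction rule: inc_induct)
    case (step m) then show ?case using assms(3)[of m] by simp
  qed simp
  then show "\<tau> k \<le> T" by (simp add: assms(2))
qed

text \<open>Sort a finite set that contains the points of \<open>P\<close> and the multiples of
  \<open>\<delta>\<close> in the interval. No member lies strictly between neighbours, and both the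
  mesh bound and the separation of \<open>P\<close> are instances of this.\<close>

lemma refining_partition:
  fixes T \<delta> :: real
  assumes "finite P" "0 < T" "0 < \<delta>"
  obtains N and \<tau> :: "nat \<Rightarrow> real" where "\<tau> 0 = 0" "\<tau> N = T"
    "\<And>k. k < N \<Longrightarrow> \<tau> k < \<tau> (Suc k)" "\<And>k. k < N \<Longrightarrow> \<tau> (Suc k) - \<tau> k \<le> \<delta>"
    "\<And>p k. p \<in> P \<Longrightarrow> k < N \<Longrightarrow> p \<le> \<tau> k \<or> \<tau> (Suc k) \<le> p"
proof -
  define S where "S = {0, T} \<union> (P \<inter> {0..T}) \<union> ((\<lambda>j. real j * \<delta>) ` {..nat \<lceil>T / \<delta>\<rceil>} \<inter> {0..T})"
  have S: "finite S" "0 \<in> S" "T \<in> S" "S \<subseteq> {0..T}"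
    using assms by (auto simp: S_def)
  define xs where "xs = sorted_list_of_set S"
  have xs: "set xs = S" "sorted_wrt (<) xs"
    using S by (auto simp: xs_def)
  define N where "N = length xs - 1"
  define \<tau> where "\<tau> k = xs ! k" for k
  have len: "0 < length xs" "length xs = Suc N"
    using xs S by (cases xs; auto simp: N_def)+
  have mem: "\<tau> k \<in> S" if "k \<le> N" for k
    using that len xs(1) nth_mem[of k xs] by (auto simp: \<tau>_def)
  have less: "\<tau> j < \<tau> k" if "j < k" "k \<le> N" for j k
    using that len sorted_wrt_nth_less[OF xs(2), of j k] by (auto simp: \<tau>_def)
  have ex: "\<exists>k\<le>N. p = \<tau> k" if "p \<in> S" for p
  proof -
    from that xs(1) obtain k where "k < length xs" "xs ! k = p" by (metis in_set_conv_nth)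
    then show ?thesis using len by (auto simp: \<tau>_def intro!: exI[of _ k])
  qed
  have gap: "p \<le> \<tau> k \<or> \<tau> (Suc k) \<le> p" if "p \<in> S" "k < N" for p k
  proof -
    obtain j where j: "j \<le> N" "p = \<tau> j" using ex[OF \<open>p \<in> S\<close>] by blast
    show ?thesis
    proof (cases "j \<le> k")
      case True
      then show ?thesis using less[of j k] that j by (cases "j = k") auto
    next
      case False
      then show ?thesis using less[of "Suc k" j] that j by (cases "j = Suc k") auto
    qed
  qed
  show ?thesis
  proof
    show "\<tau> 0 = 0"
    proof -
      obtain k where k: "k \<le> N" "0 = \<tau> k" using ex[OF S(2)] by blast
      have "0 \<le> \<tau> 0" using mem[of 0] S(4) by auto
      then show ?thesis using less[of 0 k] k by (cases "k = 0") auto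
    qed
    show "\<tau> N = T"
    proof -
      obtain k where k: "k \<le> N" "T = \<tau> k" using ex[OF S(3)] by blast
      have "\<tau> N \<le> T" using mem[of N] S(4) by auto
      then show ?thesis using less[of k N] k by (cases "k = N") auto
    qed
    fix k assume k: "k < N"
    show "\<tau> k < \<tau> (Suc k)" using less[of k "Suc k"] k by simp
    show "\<tau> (Suc k) - \<tau> k \<le> \<delta>"
    proof (rule ccontr)
      assume "\<not> \<tau> (Suc k) - \<tau> k \<le> \<delta>"
      then have big: "\<tau> k + \<delta> < \<tau> (Suc k)" by simp
      have range: "0 \<le> \<tau> k" "\<tau> (Suc k) \<le> T" using mem[of k] mem[of "Suc k"] k S(4) by auto
      \<comment> \<open>Index of the first multiple of \<open>\<delta>\<close> strictly beyond
        \<open>\<tau> k\<close>; it would fall strictly inside an oversized gap.\<close>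
      define j where "j = nat \<lfloor>\<tau> k / \<delta>\<rfloor> + 1"
      have jj: "real j = of_int \<lfloor>\<tau> k / \<delta>\<rfloor> + 1"
        using range assms by (simp add: j_def)
      have 1: "\<tau> k < real j * \<delta>"
      proof -
        have "\<tau> k / \<delta> < real j" unfolding jj by linarith
        then show ?thesis using assms by (simp add: field_simps)
      qed
      have 2: "real j * \<delta> \<le> \<tau> k + \<delta>"
      proof -
        have "real j \<le> \<tau> k / \<delta> + 1" unfolding jj by linarith
        then have "real j * \<delta> \<le> (\<tau> k / \<delta> + 1) * \<delta>" using assms by (intro mult_right_mono) auto
        also have "\<dots> = \<tau> k + \<delta>" using assms by (simp add: field_simps)
        finally show ?thesis .
      qed
      have "real j \<le> T / \<delta>" using 2 big range assms by (simp add: field_simps)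
      then have "j \<le> nat \<lceil>T / \<delta>\<rceil>" by linarith
      then have "real j * \<delta> \<in> S"
        unfolding S_def using 1 2 big range by (intro UnI2 IntI imageI) auto
      from gap[OF this k] 1 2 big show False by linarith
    qed
    fix p assume "p \<in> P"
    show "p \<le> \<tau> k \<or> \<tau> (Suc k) \<le> p"
    proof (cases "p \<in> {0..T}")
      case True
      then show ?thesis using gap[of p k] \<open>p \<in> P\<close> k by (auto simp: S_def)
    next
      case False
      then show ?thesis using mem[of k] mem[of "Suc k"] k S(4) by fastforce
    qed
  qed
qed

definition endpoints :: "'w elementary \<Rightarrow> real set" where
  "endpoints L = (\<Union>(r, u, \<xi>)\<in>set L. {r, u})"

lemma finite_endpoints: "finite (endpoints L)"
  by (auto simp: endpoints_def)

lemma elementary_Cons: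
  "elementary M F ((r, u, \<xi>) # L) \<longleftrightarrow> 0 \<le> r \<and> r \<le> u \<and> \<xi> \<in> borel_measurable (F r) \<and>
        (\<exists>C. \<forall>\<omega>\<in>space M. \<bar>\<xi> \<omega>\<bar> \<le> C) \<and> elementary M F L"
  by (auto simp: elementary_def)

lemma elementary_process_Cons:
  "elementary_process ((r, u, \<xi>) # L) t \<omega> = \<xi> \<omega> * indicator {r<..u} t + elementary_process L t \<omega>"
  by (simp add: elementary_process_def)

lemma elementary_integral_Cons:
  "elementary_integral B ((r, u, \<xi>) # L) t \<omega> = \<xi> \<omega> * (B (min u t) \<omega> - B (min r t) \<omega>) + elementary_integral B L t \<omega>"
  by (simp add: elementary_integral_def)

lemma elementary_process_Nil [simp]: "elementary_process [] t \<omega> = 0"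
  and elementary_integral_Nil [simp]: "elementary_integral B [] t \<omega> = 0"
  by (simp_all add: elementary_process_def elementary_integral_def)

lemma elementary_process_Nil_fun [simp]: "elementary_process [] = (\<lambda>t \<omega>. 0)"
  and elementary_integral_Nil_fun [simp]: "elementary_integral B [] = (\<lambda>t \<omega>. 0)"
  by (auto simp: fun_eq_iff)

lemma elementary_integral_0: "elementary M F L \<Longrightarrow> elementary_integral B L 0 \<omega> = 0"
proof (induction L)
  case (Cons a L)
  obtain r u \<xi> where a: "a = (r, u, \<xi>)" by (cases a) auto
  moreover from this Cons.prems have "min u 0 = 0" "min r 0 = 0" by (auto simp: elementary_Cons)
  ultimately show ?case using Cons by (simp add: elementary_integral_Cons elementary_Cons)
qed simp

text \<open>The intervals of the entries and the grid cells are both open on the left and closed on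
  the right. A cell without endpoints in its interior therefore lies entirely inside or outside each
  interval, and its right end can represent it.\<close>

lemma elementary_process_const:
  assumes "elementary M F L" "\<And>p. p \<in> endpoints L \<Longrightarrow> p \<le> a \<or> b \<le> p" "a < s" "s \<le> b"
  shows "elementary_process L s \<omega> = elementary_process L b \<omega>"
  using assms
proof (induction L)
  case (Cons x L)
  obtain r u \<xi> where x: "x = (r, u, \<xi>)" by (cases x) auto
  have "r \<le> a \<or> b \<le> r" "u \<le> a \<or> b \<le> u"
    using Cons.prems(2)[of r] Cons.prems(2)[of u] by (auto simp: x endpoints_def)
  then have "indicator {r<..u} s = (indicator {r<..u} b :: real)"
    using Cons.prems(3,4) by (auto simp: indicator_def)
  moreover have "elementary_process L s \<omega> = elementary_process L b \<omega>"
    using Cons by (auto simp: x endpoints_def elementary_Cons)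
  ultimately show ?case by (simp add: x elementary_process_Cons)
qed simp

lemma elementary_integral_increment:
  assumes "elementary M F L" "\<And>p. p \<in> endpoints L \<Longrightarrow> p \<le> a \<or> b \<le> p" "a < b"
  shows "elementary_integral B L b \<omega> - elementary_integral B L a \<omega> = elementary_process L b \<omega> * (B b \<omega> - B a \<omega>)"
  using assms
proof (induction L)
  case (Cons x L)
  obtain r u \<xi> where x: "x = (r, u, \<xi>)" by (cases x) auto
  have ru: "r \<le> a \<or> b \<le> r" "u \<le> a \<or> b \<le> u"
    using Cons.prems(2)[of r] Cons.prems(2)[of u] by (auto simp: x endpoints_def)
  have "r \<le> u" using Cons.prems(1) by (simp add: x elementary_Cons)
  with ru \<open>a < b\<close> have "(B (min u b) \<omega> - B (min r b) \<omega>) - (B (min u a) \<omega> - B (min r a) \<omega>)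
      = indicator {r<..u} b * (B b \<omega> - B a \<omega>)"
    by (auto simp: indicator_def min_def)
  then have "\<xi> \<omega> * (B (min u b) \<omega> - B (min r b) \<omega>) - \<xi> \<omega> * (B (min u a) \<omega> - B (min r a) \<omega>)
      = \<xi> \<omega> * indicator {r<..u} b * (B b \<omega> - B a \<omega>)"
    by (metis mult.assoc right_diff_distrib)
  moreover have "elementary_integral B L b \<omega> - elementary_integral B L a \<omega> = elementary_process L b \<omega> * (B b \<omega> - B a \<omega>)"
    using Cons by (auto simp: x endpoints_def elementary_Cons)
  ultimately show ?case by (simp add: x elementary_process_Cons elementary_integral_Cons algebra_simps)
qed simp

lemma elementary_process_bounded:
  assumes "elementary M F L"
  shows "\<exists>C. \<forall>\<omega>\<in>space M. \<forall>t. \<bar>elementary_process L t \<omega>\<bar> \<le> C"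
  using assms
proof (induction L)
  case (Cons x L)
  obtain r u \<xi> where x: "x = (r, u, \<xi>)" by (cases x) auto
  obtain C1 where C1: "\<And>\<omega>. \<omega> \<in> space M \<Longrightarrow> \<bar>\<xi> \<omega>\<bar> \<le> C1"
    using Cons.prems by (auto simp: x elementary_Cons)
  obtain C2 where C2: "\<And>\<omega> t. \<omega> \<in> space M \<Longrightarrow> \<bar>elementary_process L t \<omega>\<bar> \<le> C2"
    using Cons by (auto simp: x elementary_Cons)
  show ?case
  proof (intro exI[of _ "C1 + C2"] ballI allI)
    fix \<omega> t assume \<omega>: "\<omega> \<in> space M"
    have "\<bar>\<xi> \<omega> * indicator {r<..u} t\<bar> \<le> C1" using C1[OF \<omega>] by (auto simp: indicator_def)
    then show "\<bar>elementary_process (x # L) t \<omega>\<bar> \<le> C1 + C2"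
      using C2[OF \<omega>, of t] by (simp add: x elementary_process_Cons)
  qed
qed auto

context brownian
begin

text \<open>Predictability: the value on a cell is evaluated at the right end \<open>b\<close> but
  known at the left end \<open>a\<close>. An entry that starts by time \<open>a\<close> has a
  coefficient known at \<open>a\<close>, and one that starts at \<open>b\<close> or later vanishes
  at \<open>b\<close>.\<close>

lemma elementary_process_measurable:
  assumes "elementary M F L" "\<And>p. p \<in> endpoints L \<Longrightarrow> p \<le> a \<or> b \<le> p" "0 \<le> a" "a < b"
  shows "elementary_process L b \<in> borel_measurable (F a)"
  using assms
proof (induction L)
  case (Cons x L)
  obtain r u \<xi> where x: "x = (r, u, \<xi>)" by (cases x) auto
  have ru: "r \<le> a \<or> b \<le> r"
    using Cons.prems(2)[of r] by (auto simp: x endpoints_def)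
  have \<xi>: "\<xi> \<in> borel_measurable (F r)" "0 \<le> r" using Cons.prems(1) by (auto simp: x elementary_Cons)
  have IH: "elementary_process L b \<in> borel_measurable (F a)"
    using Cons by (auto simp: x endpoints_def elementary_Cons)
  have "(\<lambda>\<omega>. \<xi> \<omega> * indicator {r<..u} b) \<in> borel_measurable (F a)"
  proof (cases "r \<le> a")
    case True
    then show ?thesis using measurable_F_mono[OF \<xi>(1) True \<xi>(2)] by simp
  next
    case False
    with ru have "(\<lambda>\<omega>. \<xi> \<omega> * indicator {r<..u} b) = (\<lambda>\<omega>. 0)" by (auto simp: indicator_def)
    then show ?thesis by simp
  qed
  then show ?case using IH unfolding x elementary_process_Cons[abs_def] by simp
qed simp

lemma elementary_integral_measurable:
  assumes "elementary M F L" "\<And>t. 0 \<le> t \<Longrightarrow> B t \<in> borel_measurable (F t)" "0 \<le> t"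
  shows "elementary_integral B L t \<in> borel_measurable (F t)"
  using assms(1)
proof (induction L)
  case (Cons x L)
  obtain r u \<xi> where x: "x = (r, u, \<xi>)" by (cases x) auto
  have \<xi>: "\<xi> \<in> borel_measurable (F r)" "0 \<le> r" "r \<le> u" using Cons.prems(1) by (auto simp: x elementary_Cons)
  have IH: "elementary_integral B L t \<in> borel_measurable (F t)"
    using Cons by (auto simp: x elementary_Cons)
  have "(\<lambda>\<omega>. \<xi> \<omega> * (B (min u t) \<omega> - B (min r t) \<omega>)) \<in> borel_measurable (F t)"
  proof (cases "r \<le> t")
    case True
    have "\<xi> \<in> borel_measurable (F t)" using measurable_F_mono[OF \<xi>(1) True \<xi>(2)] .
    moreover have "B (min u t) \<in> borel_measurable (F t)" "B (min r t) \<in> borel_measurable (F t)"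
      using assms \<xi> by (auto intro!: measurable_F_mono[OF assms(2)])
    ultimately show ?thesis by simp
  next
    case False
    then have "(\<lambda>\<omega>. \<xi> \<omega> * (B (min u t) \<omega> - B (min r t) \<omega>)) = (\<lambda>\<omega>. 0)" using \<xi> by (auto simp: min_def)
    then show ?thesis by simp
  qed
  then show ?case using IH unfolding x elementary_integral_Cons[abs_def] by simp
qed simp

lemma elementary_process_measurable_joint:
  assumes "elementary M F L"
  shows "(\<lambda>(s, \<omega>). elementary_process L s \<omega>) \<in> borel_measurable (borel \<Otimes>\<^sub>M M)"
  using assms
proof (induction L)
  case (Cons x L)
  obtain r u \<xi> where x: "x = (r, u, \<xi>)" by (cases x) auto
  have [measurable]: "\<xi> \<in> borel_measurable M"
    using Cons.prems(1) by (auto simp: x elementary_Cons intro: measurable_F_M)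
  have [measurable]: "(\<lambda>(s, \<omega>). elementary_process L s \<omega>) \<in> borel_measurable (borel \<Otimes>\<^sub>M M)"
    using Cons by (auto simp: x elementary_Cons)
  show ?case unfolding x elementary_process_Cons[abs_def] by measurable
qed simp

lemma elementary_integral_continuous:
  assumes "elementary M F L" "continuous_on {0..} (\<lambda>t. B t \<omega>)"
  shows "continuous_on {0..} (\<lambda>t. elementary_integral B L t \<omega>)"
  using assms(1)
proof (induction L)
  case (Cons x L)
  obtain r u \<xi> where x: "x = (r, u, \<xi>)" by (cases x) auto
  have ru: "0 \<le> r" "r \<le> u" using Cons.prems(1) by (auto simp: x elementary_Cons)
  have c: "continuous_on {0..} (\<lambda>t. B (min p t) \<omega>)" if "0 \<le> p" for p
    by (rule continuous_on_compose2[OF assms(2)]) (use that in \<open>auto intro!: continuous_intros\<close>)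
  have "continuous_on {0..} (\<lambda>t. elementary_integral B L t \<omega>)"
    using Cons by (auto simp: x elementary_Cons)
  then show ?case using ru unfolding x elementary_integral_Cons
    by (intro continuous_intros c) auto
qed simp

end

section \<open>Almost sure approximation of Ito integrals\<close>

text \<open>The tolerance is tied to the index \<open>m\<close> of the approximation and decays
  geometrically, which is the rate that a Borel-Cantelli argument delivers.\<close>

abbreviation ito_close ::
    "real \<Rightarrow> (real \<Rightarrow> 'w \<Rightarrow> real) \<Rightarrow> (real \<Rightarrow> 'w \<Rightarrow> real) \<Rightarrow> (real \<Rightarrow> 'w \<Rightarrow> real) \<Rightarrow> 'w elementary \<Rightarrow> nat \<Rightarrow> 'w \<Rightarrow> bool" where
  "ito_close T B H I L m \<omega> \<equiv>
     (\<integral>\<^sup>+s\<in>{0..T}. ennreal ((elementary_process L s \<omega> - H s \<omega>)\<^sup>2) \<partial>lborel) \<le> ennreal ((1/2)^m) \<and>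
     (\<forall>t\<in>{0..T}. \<bar>elementary_integral B L t \<omega> - I t \<omega>\<bar> \<le> (1/2)^m)"

lemma Icc_subset_closure_rationals:
  fixes T :: real
  assumes "0 < T"
  shows "{0..T} \<subseteq> closure (\<rat> \<inter> {0<..<T})"
proof -
  have "closure (\<rat> \<inter> {0<..<T}) = closure {0<..<T}"
    using closure_open_Int_superset[of "{0<..<T}" \<rat>] Rats_closure_real by (simp add: Int_commute)
  then show ?thesis using assms by simp
qed

text \<open>For continuous processes this turns an uncountable union over times into a countable
  one, so that events about suprema become measurable.\<close>

lemma ex_Icc_iff_ex_rational:
  fixes g :: "real \<Rightarrow> real"
  assumes "0 < T" "continuous_on {0..T} g"
  shows "(\<exists>t\<in>{0..T}. e < g t) \<longleftrightarrow> (\<exists>t\<in>\<rat> \<inter> {0<..<T}. e < g t)"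
proof -
  have cl: "closure (\<rat> \<inter> {0<..<T}) = {0..T}"
    using Icc_subset_closure_rationals[OF assms(1)] closure_mono[of "\<rat> \<inter> {0<..<T}" "{0<..<T}"] assms(1)
    by auto
  have "\<forall>t\<in>{0..T}. g t \<le> e" if "\<forall>t\<in>\<rat> \<inter> {0<..<T}. g t \<le> e"
    using continuous_le_on_closure[of "\<rat> \<inter> {0<..<T}" g _ e] that assms(2) unfolding cl by blast
  then show ?thesis by (force simp: not_le[symmetric])
qed

context brownian
begin

lemma progressive_joint:
  assumes "progressive F H" "0 \<le> T"
  shows "(\<lambda>(s, \<omega>). H s \<omega>) \<in> borel_measurable (restrict_space lborel {0..T} \<Otimes>\<^sub>M M)"
proof -
  have H: "(\<lambda>(s, \<omega>). H s \<omega>) \<in> borel_measurable (restrict_space borel {0..T} \<Otimes>\<^sub>M F T)"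
    using assms by (auto simp: progressive_def)
  have id: "(\<lambda>\<omega>. \<omega>) \<in> M \<rightarrow>\<^sub>M F T"
    using measurable_from_subalg[OF subalgebra_F[OF assms(2)], of "\<lambda>\<omega>. \<omega>" "F T"] by simp
  have "(\<lambda>p. (fst p, snd p)) \<in> restrict_space lborel {0..T} \<Otimes>\<^sub>M M \<rightarrow>\<^sub>M restrict_space borel {0..T} \<Otimes>\<^sub>M F T"
  proof (rule measurable_Pair)
    show "fst \<in> restrict_space lborel {0..T} \<Otimes>\<^sub>M M \<rightarrow>\<^sub>M restrict_space borel {0..T}"
      using measurable_fst[of "restrict_space lborel {0..T}" M]
      by (subst measurable_cong_sets[OF refl sets_restrict_space_cong, of _ lborel]) auto
    show "snd \<in> restrict_space lborel {0..T} \<Otimes>\<^sub>M M \<rightarrow>\<^sub>M F T"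
      by (rule measurable_compose[OF measurable_snd id])
  qed
  from measurable_compose[OF this H] show ?thesis by (simp add: case_prod_unfold)
qed

lemma progressive_section:
  assumes "progressive F H" "0 \<le> T" "\<omega> \<in> space M"
  shows "(\<lambda>s. indicator {0..T} s * H s \<omega>) \<in> borel_measurable lborel"
proof -
  have "(\<lambda>s. H s \<omega>) \<in> borel_measurable (restrict_space lborel {0..T})"
    using measurable_compose[OF measurable_Pair2'[OF assms(3)] progressive_joint[OF assms(1,2)]] by simp
  then show ?thesis
    by (subst (asm) borel_measurable_restrict_space_iff) (auto simp: mult.commute)
qed

text \<open>Progressive measurability makes the integrand jointly measurable on
  \<open>{0..T}\<close> times the sample space, and an integral over sections of such a function is
  measurable.\<close>

lemma ito_L2_measurable:
  assumes "progressive F H" "elementary M F L" "0 \<le> T"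
  shows "(\<lambda>\<omega>. \<integral>\<^sup>+s\<in>{0..T}. ennreal ((elementary_process L s \<omega> - H s \<omega>)\<^sup>2) \<partial>lborel) \<in> borel_measurable M"
proof -
  let ?R = "restrict_space lborel {0..T}"
  interpret R: sigma_finite_measure ?R
    by (rule sigma_finite_measure_restrict_space) (auto intro: sigma_finite_lborel)
  have 1: "(\<lambda>(s, \<omega>). H s \<omega>) \<in> borel_measurable (?R \<Otimes>\<^sub>M M)"
    by (rule progressive_joint) fact+
  have "(\<lambda>(s, \<omega>). elementary_process L s \<omega>) \<in> borel_measurable (?R \<Otimes>\<^sub>M M)"
  proof -
    have "(\<lambda>p. (fst p, snd p)) \<in> ?R \<Otimes>\<^sub>M M \<rightarrow>\<^sub>M borel \<Otimes>\<^sub>M M"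
    proof (rule measurable_Pair)
      have "(\<lambda>s. s) \<in> ?R \<rightarrow>\<^sub>M borel" by (rule measurable_restrict_space1) simp
      from measurable_compose[OF measurable_fst this]
      show "fst \<in> ?R \<Otimes>\<^sub>M M \<rightarrow>\<^sub>M borel" .
    qed simp
    from measurable_compose[OF this elementary_process_measurable_joint[OF assms(2)]]
    show ?thesis by (simp add: case_prod_unfold)
  qed
  with 1 have "(\<lambda>p. ennreal ((elementary_process L (fst p) (snd p) - H (fst p) (snd p))\<^sup>2)) \<in> borel_measurable (?R \<Otimes>\<^sub>M M)"
    by (simp add: case_prod_unfold)
  then have "(\<lambda>(\<omega>, s). ennreal ((elementary_process L s \<omega> - H s \<omega>)\<^sup>2)) \<in> borel_measurable (M \<Otimes>\<^sub>M ?R)"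
    by (subst measurable_pair_swap_iff) (simp add: case_prod_unfold)
  from R.borel_measurable_nn_integral[OF this] show ?thesis
    by (simp add: nn_integral_restrict_space)
qed

lemma ito_sup_measurable:
  assumes L: "elementary M F L" and B: "\<And>t. 0 \<le> t \<Longrightarrow> B t \<in> borel_measurable (F t)"
    "\<And>\<omega>. \<omega> \<in> space M \<Longrightarrow> continuous_on {0..} (\<lambda>t. B t \<omega>)"
    and I: "\<And>t. 0 \<le> t \<Longrightarrow> I t \<in> borel_measurable M"
    "\<And>\<omega>. \<omega> \<in> space M \<Longrightarrow> continuous_on {0..} (\<lambda>t. I t \<omega>)" and T: "0 < T"
  shows "{\<omega>\<in>space M. \<exists>t\<in>{0..T}. e < \<bar>elementary_integral B L t \<omega> - I t \<omega>\<bar>} \<in> sets M"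
proof -
  have [measurable]: "elementary_integral B L t \<in> borel_measurable M" "I t \<in> borel_measurable M" if "0 \<le> t" for t
    using measurable_F_M[OF elementary_integral_measurable[OF L B(1) that] that] I(1)[OF that] by auto
  have "{\<omega>\<in>space M. \<exists>t\<in>{0..T}. e < \<bar>elementary_integral B L t \<omega> - I t \<omega>\<bar>}
      = {\<omega>\<in>space M. \<exists>t\<in>\<rat> \<inter> {0<..<T}. e < \<bar>elementary_integral B L t \<omega> - I t \<omega>\<bar>}"
  proof (rule Collect_cong, rule conj_cong[OF refl])
    fix \<omega> assume \<omega>: "\<omega> \<in> space M"
    show "(\<exists>t\<in>{0..T}. e < \<bar>elementary_integral B L t \<omega> - I t \<omega>\<bar>)
      = (\<exists>t\<in>\<rat> \<inter> {0<..<T}. e < \<bar>elementary_integral B L t \<omega> - I t \<omega>\<bar>)"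
      by (rule ex_Icc_iff_ex_rational[OF T])
        (auto intro!: continuous_intros continuous_on_subset[OF elementary_integral_continuous[where B=B and \<omega>=\<omega>, OF L B(2)[OF \<omega>]]]
          continuous_on_subset[OF I(2)[OF \<omega>]])
  qed
  also have "\<dots> = (\<Union>t\<in>\<rat> \<inter> {0<..<T}. {\<omega>\<in>space M. e < \<bar>elementary_integral B L t \<omega> - I t \<omega>\<bar>})"
    by auto
  also have "\<dots> \<in> sets M"
    by (rule sets.countable_UN') (auto simp: countable_rat countable_Int1)
  finally show ?thesis .
qed

text \<open>For each \<open>j\<close> pick a member of the sequence whose two exceptional sets have
  measure below \<open>(1/2)^j\<close>; the measures are then summable and Borel-Cantelli applies.
  Measurability of these sets has to come first: \<open>measure\<close> is 0 on nonmeasurable sets,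
  so smallness alone would say nothing.\<close>

lemma ito_integral_ae_approximation:
  assumes ito: "is_ito_integral M F B H I" and B: "\<And>t. 0 \<le> t \<Longrightarrow> B t \<in> borel_measurable (F t)"
    "\<And>\<omega>. \<omega> \<in> space M \<Longrightarrow> continuous_on {0..} (\<lambda>t. B t \<omega>)" and T: "0 < T"
  shows "\<exists>L. (\<forall>m. elementary M F (L m)) \<and> (AE \<omega> in M. \<forall>\<^sub>F m in sequentially.
      ito_close T B H I (L m) m \<omega>)"
proof -
  from ito obtain L where prog: "progressive F H" and I: "\<And>t. 0 \<le> t \<Longrightarrow> I t \<in> borel_measurable M"
    "\<And>\<omega>. \<omega> \<in> space M \<Longrightarrow> continuous_on {0..} (\<lambda>t. I t \<omega>)"
    and L: "\<And>m. elementary M F (L m)"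
    and conv: "\<And>T \<epsilon>. 0 \<le> T \<Longrightarrow> 0 < \<epsilon> \<Longrightarrow> (\<lambda>m. measure M {\<omega>\<in>space M.
              ennreal \<epsilon> < (\<integral>\<^sup>+s\<in>{0..T}. ennreal ((elementary_process (L m) s \<omega> - H s \<omega>)\<^sup>2) \<partial>lborel)})
             \<longlonglongrightarrow> 0"
     "\<And>T \<epsilon>. 0 \<le> T \<Longrightarrow> 0 < \<epsilon> \<Longrightarrow> (\<lambda>m. measure M {\<omega>\<in>space M.
              \<exists>t\<in>{0..T}. \<epsilon> < \<bar>elementary_integral B (L m) t \<omega> - I t \<omega>\<bar>})
             \<longlonglongrightarrow> 0"
    unfolding is_ito_integral_def by blast
  define A1 where "A1 m j = {\<omega>\<in>space M. ennreal ((1/2)^j) < (\<integral>\<^sup>+s\<in>{0..T}. ennreal ((elementary_process (L m) s \<omega> - H s \<omega>)\<^sup>2) \<partial>lborel)}" for m j :: nat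
  define A2 where "A2 m j = {\<omega>\<in>space M. \<exists>t\<in>{0..T}. (1/2)^j < \<bar>elementary_integral B (L m) t \<omega> - I t \<omega>\<bar>}" for m j :: nat
  have A1: "A1 m j \<in> sets M" for m j
    using ito_L2_measurable[OF prog L[of m], of T] T unfolding A1_def by simp
  have A2: "A2 m j \<in> sets M" for m j
    unfolding A2_def by (rule ito_sup_measurable[OF L B I T])
  have "\<exists>m. measure M (A1 m j) < (1/2)^j \<and> measure M (A2 m j) < (1/2)^j" for j
  proof -
    have "\<forall>\<^sub>F m in sequentially. measure M (A1 m j) < (1/2)^j" "\<forall>\<^sub>F m in sequentially. measure M (A2 m j) < (1/2)^j"
      using order_tendstoD(2)[OF conv(1)[of T "(1/2)^j"], of "(1/2)^j"]
        order_tendstoD(2)[OF conv(2)[of T "(1/2)^j"], of "(1/2)^j"] T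
      unfolding A1_def A2_def by auto
    then have "\<forall>\<^sub>F m in sequentially. measure M (A1 m j) < (1/2)^j \<and> measure M (A2 m j) < (1/2)^j"
      by eventually_elim auto
    then show ?thesis by (rule eventually_happens'[OF sequentially_bot])
  qed
  then obtain f where f: "\<And>j. measure M (A1 (f j) j) < (1/2)^j" "\<And>j. measure M (A2 (f j) j) < (1/2)^j"
    using choice[of "\<lambda>j m. measure M (A1 m j) < (1/2)^j \<and> measure M (A2 m j) < (1/2)^j"] by blast
  have geo: "summable (\<lambda>j. (1/2::real)^j)" by (rule summable_geometric) simp
  have "summable (\<lambda>j. measure M (A1 (f j) j))" "summable (\<lambda>j. measure M (A2 (f j) j))"
    by (rule summable_comparison_test'[OF geo, of 0], simp add: f less_imp_le)+
  from borel_cantelli_AE1[OF A1 _ this(1)] borel_cantelli_AE1[OF A2 _ this(2)]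
  have "AE \<omega> in M. \<forall>\<^sub>F j in sequentially. \<omega> \<in> space M - A1 (f j) j" "AE \<omega> in M. \<forall>\<^sub>F j in sequentially. \<omega> \<in> space M - A2 (f j) j"
    by (auto simp: emeasure_eq_measure)
  then have "AE \<omega> in M. \<forall>\<^sub>F m in sequentially.
      (\<integral>\<^sup>+s\<in>{0..T}. ennreal ((elementary_process (L (f m)) s \<omega> - H s \<omega>)\<^sup>2) \<partial>lborel) \<le> ennreal ((1/2)^m) \<and>
      (\<forall>t\<in>{0..T}. \<bar>elementary_integral B (L (f m)) t \<omega> - I t \<omega>\<bar> \<le> (1/2)^m)"
  proof eventually_elim
    case (elim \<omega>)
    then show ?case
      by eventually_elim (auto simp: A1_def A2_def not_less)
  qed
  then show ?thesis using L by (intro exI[of _ "\<lambda>m. L (f m)"]) auto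
qed

end

section \<open>The limit along a single path\<close>

lemma sum_set_integral_partition:
  fixes R :: "real \<Rightarrow> real" and \<tau> :: "nat \<Rightarrow> real"
  assumes "\<And>k. k < N \<Longrightarrow> \<tau> k < \<tau> (Suc k)" "set_integrable lborel {\<tau> 0..\<tau> N} R"
  shows "(\<Sum>k<N. LINT s:{\<tau> k<..\<tau> (Suc k)}|lborel. R s) = (LINT s:{\<tau> 0<..\<tau> N}|lborel. R s)"
  using assms
proof (induction N)
  case (Suc N)
  have mono: "\<tau> 0 \<le> \<tau> m" if "m \<le> Suc N" for m
    using that
  proof (induction m)
    case (Suc m)
    then show ?case using Suc.prems Suc.IH \<open>\<And>k. k < Suc N \<Longrightarrow> \<tau> k < \<tau> (Suc k)\<close>[of m] by simp
  qed simp
  have le: "\<tau> 0 \<le> \<tau> N" "\<tau> N < \<tau> (Suc N)" using mono[of N] Suc.prems(1)[of N] by auto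
  have "set_integrable lborel {\<tau> 0..\<tau> N} R"
    by (rule set_integrable_subset[OF Suc.prems(2)]) (use le in auto)
  then have IH: "(\<Sum>k<N. LINT s:{\<tau> k<..\<tau> (Suc k)}|lborel. R s) = (LINT s:{\<tau> 0<..\<tau> N}|lborel. R s)"
    using Suc by simp
  have "{\<tau> 0<..\<tau> (Suc N)} = {\<tau> 0<..\<tau> N} \<union> {\<tau> N<..\<tau> (Suc N)}" using le by auto
  moreover have "(LINT s:{\<tau> 0<..\<tau> N} \<union> {\<tau> N<..\<tau> (Suc N)}|lborel. R s) =
     (LINT s:{\<tau> 0<..\<tau> N}|lborel. R s) + (LINT s:{\<tau> N<..\<tau> (Suc N)}|lborel. R s)"
    by (rule set_integral_Un) (use le in \<open>auto intro!: set_integrable_subset[OF Suc.prems(2)]\<close>)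
  ultimately show ?case using IH by simp
qed (simp add: set_lebesgue_integral_def)

text \<open>Young's inequality with parameter \<open>e\<close>, applied to the expansion of the
  product around \<open>(c, d)\<close>. The limit is charged with the small factor \<open>e\<close>
  and only the squared errors carry \<open>1/e\<close>, so convergence of the factors in mean square
  passes to their products.\<close>

lemma abs_mult_diff_le:
  fixes a b c d e :: real
  assumes "0 < e"
  shows "\<bar>a * b - c * d\<bar> \<le> e * (c\<^sup>2 + d\<^sup>2) + (1 + 1/e) * ((a - c)\<^sup>2 + (b - d)\<^sup>2)"
proof -
  have young: "\<bar>x * y\<bar> \<le> e * x\<^sup>2 + (1/e) * y\<^sup>2" for x y :: real
  proof -
    have "0 \<le> (e * \<bar>x\<bar> - \<bar>y\<bar>)\<^sup>2 / e + \<bar>x * y\<bar>" using assms by simp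
    also have "\<dots> = e * x\<^sup>2 + (1/e) * y\<^sup>2 - \<bar>x * y\<bar>"
      using assms by (simp add: power2_eq_square field_simps abs_mult)
    finally show ?thesis by simp
  qed
  have "\<bar>(a - c) * (b - d)\<bar> \<le> (a - c)\<^sup>2 + (b - d)\<^sup>2"
  proof -
    have "0 \<le> (\<bar>a - c\<bar> - \<bar>b - d\<bar>)\<^sup>2 + \<bar>(a - c) * (b - d)\<bar>" by simp
    also have "\<dots> = (a - c)\<^sup>2 + (b - d)\<^sup>2 - \<bar>(a - c) * (b - d)\<bar>"
      by (simp add: power2_diff abs_mult)
    finally show ?thesis by simp
  qed
  moreover have "a * b - c * d = c * (b - d) + d * (a - c) + (a - c) * (b - d)"
    by (simp add: algebra_simps)
  moreover note young[of c "b - d"] young[of d "a - c"]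
  ultimately have "\<bar>a * b - c * d\<bar> \<le> (e * c\<^sup>2 + (1/e) * (b - d)\<^sup>2) + (e * d\<^sup>2 + (1/e) * (a - c)\<^sup>2) + ((a - c)\<^sup>2 + (b - d)\<^sup>2)"
    by linarith
  then show ?thesis by (simp add: algebra_simps)
qed

text \<open>The square of the Frobenius norm; without the root it is a plain sum of squares, and its
  integral splits over the entries.\<close>

definition frob :: "('n::finite \<Rightarrow> 'n \<Rightarrow> real) \<Rightarrow> real" where
  "frob x = (\<Sum>i\<in>UNIV. \<Sum>l\<in>UNIV. (x i l)\<^sup>2)"

lemma frob_nonneg: "0 \<le> frob x"
  by (simp add: frob_def sum_nonneg)

lemma sum_square_pairs:
  fixes x :: "'n::finite \<Rightarrow> 'n \<Rightarrow> real"
  shows "(\<Sum>i\<in>UNIV. \<Sum>j\<in>UNIV. \<Sum>l\<in>UNIV. (x i l)\<^sup>2 + (x j l)\<^sup>2) = 2 * real CARD('n) * frob x"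
  by (simp add: sum.distrib frob_def sum_distrib_left mult.assoc)

lemma sum_abs_products_le:
  fixes x :: "'n::finite \<Rightarrow> 'n \<Rightarrow> real"
  shows "(\<Sum>i\<in>UNIV. \<Sum>j\<in>UNIV. \<Sum>l\<in>UNIV. \<bar>x i l * x j l\<bar>) \<le> 2 * real CARD('n) * frob x"
proof -
  have *: "\<bar>a * b\<bar> \<le> a\<^sup>2 + b\<^sup>2" for a b :: real
  proof -
    have "0 \<le> (\<bar>a\<bar> - \<bar>b\<bar>)\<^sup>2 + \<bar>a * b\<bar>" by simp
    also have "\<dots> = a\<^sup>2 + b\<^sup>2 - \<bar>a * b\<bar>" by (simp add: power2_diff abs_mult)
    finally show ?thesis by simp
  qed
  show ?thesis unfolding sum_square_pairs[symmetric] by (intro sum_mono *)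
qed

lemma frob_le: "frob x \<le> 2 * (frob y + frob (\<lambda>i l. x i l - y i l))"
proof -
  have *: "a\<^sup>2 \<le> 2 * (b\<^sup>2 + (a - b)\<^sup>2)" for a b :: real
  proof -
    have "0 \<le> (a - 2 * b)\<^sup>2" by simp
    then show ?thesis by (simp add: power2_eq_square algebra_simps)
  qed
  have "frob x \<le> (\<Sum>i\<in>UNIV. \<Sum>l\<in>UNIV. 2 * ((y i l)\<^sup>2 + (x i l - y i l)\<^sup>2))"
    unfolding frob_def by (intro sum_mono *)
  then show ?thesis by (simp add: frob_def sum.distrib sum_distrib_left distrib_left)
qed

text \<open>Primed data are the values at the true path, where the generator expression is
  nonpositive; unprimed data are those met on the grid. The drift \<open>\<beta>\<close> is common
  to both. Two kinds of error arise: \<open>e\<close> times quantities that are integrable in time,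
  and a factor of order \<open>1/e\<close> times the squared distance of the integrands.\<close>

lemma generator_perturbation:
  fixes g g' :: "'n::finite \<Rightarrow> real" and q q' x x' :: "'n \<Rightarrow> 'n \<Rightarrow> real" and \<beta> :: "'n \<Rightarrow> real"
  assumes e: "0 < e" and C: "0 \<le> C"
    and "\<bar>a - a'\<bar> \<le> e" "\<And>i. \<bar>g i - g' i\<bar> \<le> e" "\<And>i j. \<bar>q i j - q' i j\<bar> \<le> e" "\<And>i j. \<bar>q i j\<bar> \<le> C"
    and gen: "a' + (\<Sum>i\<in>UNIV. g' i * \<beta> i) + 1/2 * (\<Sum>i\<in>UNIV. \<Sum>j\<in>UNIV. \<Sum>l\<in>UNIV. q' i j * x' i l * x' j l) \<le> 0"
  defines "n \<equiv> real CARD('n)"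
  shows "a + (\<Sum>i\<in>UNIV. g i * \<beta> i) + 1/2 * (\<Sum>i\<in>UNIV. \<Sum>j\<in>UNIV. \<Sum>l\<in>UNIV. q i j * x i l * x j l)
    \<le> e * (1 + (\<Sum>i\<in>UNIV. \<bar>\<beta> i\<bar>) + n * (1 + C) * frob x') + C * n * (1 + 1/e) * frob (\<lambda>i l. x i l - x' i l)"
proof -
  have 1: "(\<Sum>i\<in>UNIV. g i * \<beta> i) \<le> (\<Sum>i\<in>UNIV. g' i * \<beta> i) + e * (\<Sum>i\<in>UNIV. \<bar>\<beta> i\<bar>)"
  proof -
    have "(\<Sum>i\<in>UNIV. g i * \<beta> i) \<le> (\<Sum>i\<in>UNIV. g' i * \<beta> i + e * \<bar>\<beta> i\<bar>)"
    proof (rule sum_mono)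
      fix i
      have "(g i - g' i) * \<beta> i \<le> \<bar>g i - g' i\<bar> * \<bar>\<beta> i\<bar>"
        by (rule order_trans[OF abs_ge_self]) (simp add: abs_mult)
      also have "\<dots> \<le> e * \<bar>\<beta> i\<bar>" using assms by (intro mult_right_mono) auto
      finally show "g i * \<beta> i \<le> g' i * \<beta> i + e * \<bar>\<beta> i\<bar>" by (simp add: algebra_simps)
    qed
    then show ?thesis by (simp add: sum.distrib sum_distrib_left)
  qed
  have "(\<Sum>i\<in>UNIV. \<Sum>j\<in>UNIV. \<Sum>l\<in>UNIV. q i j * x i l * x j l)
      \<le> (\<Sum>i\<in>UNIV. \<Sum>j\<in>UNIV. \<Sum>l\<in>UNIV. q' i j * x' i l * x' j l + e * \<bar>x' i l * x' j l\<bar>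
         + C * (e * ((x' i l)\<^sup>2 + (x' j l)\<^sup>2) + (1 + 1/e) * ((x i l - x' i l)\<^sup>2 + (x j l - x' j l)\<^sup>2)))"
  proof (intro sum_mono)
    fix i j l
    have "q i j * (x i l * x j l - x' i l * x' j l) \<le> \<bar>q i j\<bar> * \<bar>x i l * x j l - x' i l * x' j l\<bar>"
      by (rule order_trans[OF abs_ge_self]) (simp add: abs_mult)
    also have "\<dots> \<le> C * (e * ((x' i l)\<^sup>2 + (x' j l)\<^sup>2) + (1 + 1/e) * ((x i l - x' i l)\<^sup>2 + (x j l - x' j l)\<^sup>2))"
      using assms(6) C by (intro mult_mono abs_mult_diff_le e) auto
    finally have a: "q i j * (x i l * x j l - x' i l * x' j l) \<le> C * (e * ((x' i l)\<^sup>2 + (x' j l)\<^sup>2) + (1 + 1/e) * ((x i l - x' i l)\<^sup>2 + (x j l - x' j l)\<^sup>2))" .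
    have "(q i j - q' i j) * (x' i l * x' j l) \<le> \<bar>q i j - q' i j\<bar> * \<bar>x' i l * x' j l\<bar>"
      by (rule order_trans[OF abs_ge_self]) (simp add: abs_mult)
    also have "\<dots> \<le> e * \<bar>x' i l * x' j l\<bar>" using assms by (intro mult_right_mono) auto
    finally have b: "(q i j - q' i j) * (x' i l * x' j l) \<le> e * \<bar>x' i l * x' j l\<bar>" .
    have "q i j * x i l * x j l = q' i j * x' i l * x' j l + (q i j - q' i j) * (x' i l * x' j l)
      + q i j * (x i l * x j l - x' i l * x' j l)" by (simp add: algebra_simps)
    with a b show "q i j * x i l * x j l \<le> q' i j * x' i l * x' j l + e * \<bar>x' i l * x' j l\<bar>
         + C * (e * ((x' i l)\<^sup>2 + (x' j l)\<^sup>2) + (1 + 1/e) * ((x i l - x' i l)\<^sup>2 + (x j l - x' j l)\<^sup>2))" by linarith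
  qed
  also have "\<dots> = (\<Sum>i\<in>UNIV. \<Sum>j\<in>UNIV. \<Sum>l\<in>UNIV. q' i j * x' i l * x' j l)
     + e * (\<Sum>i\<in>UNIV. \<Sum>j\<in>UNIV. \<Sum>l\<in>UNIV. \<bar>x' i l * x' j l\<bar>)
     + C * (e * (\<Sum>i\<in>UNIV. \<Sum>j\<in>UNIV. \<Sum>l\<in>UNIV. (x' i l)\<^sup>2 + (x' j l)\<^sup>2)
        + (1 + 1/e) * (\<Sum>i\<in>UNIV. \<Sum>j\<in>UNIV. \<Sum>l\<in>UNIV. (x i l - x' i l)\<^sup>2 + (x j l - x' j l)\<^sup>2))"
    by (simp only: sum.distrib sum_distrib_left[symmetric])
  also have "\<dots> \<le> (\<Sum>i\<in>UNIV. \<Sum>j\<in>UNIV. \<Sum>l\<in>UNIV. q' i j * x' i l * x' j l)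
     + e * (2 * n * frob x') + C * (e * (2 * n * frob x') + (1 + 1/e) * (2 * n * frob (\<lambda>i l. x i l - x' i l)))"
    unfolding sum_square_pairs n_def
    using sum_abs_products_le[of x'] e by (intro add_mono mult_left_mono order_refl) auto
  finally have "1/2 * (\<Sum>i\<in>UNIV. \<Sum>j\<in>UNIV. \<Sum>l\<in>UNIV. q i j * x i l * x j l) \<le>
     1/2 * (\<Sum>i\<in>UNIV. \<Sum>j\<in>UNIV. \<Sum>l\<in>UNIV. q' i j * x' i l * x' j l)
     + (e * (n * frob x') + C * (e * (n * frob x') + (1 + 1/e) * (n * frob (\<lambda>i l. x i l - x' i l))))"
    by (simp add: algebra_simps)
  then have "a + (\<Sum>i\<in>UNIV. g i * \<beta> i) + 1/2 * (\<Sum>i\<in>UNIV. \<Sum>j\<in>UNIV. \<Sum>l\<in>UNIV. q i j * x i l * x j l)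
    \<le> e + e * (\<Sum>i\<in>UNIV. \<bar>\<beta> i\<bar>) + (e * (n * frob x') + C * (e * (n * frob x') + (1 + 1/e) * (n * frob (\<lambda>i l. x i l - x' i l))))"
    using 1 gen assms(3) by linarith
  then show ?thesis by (simp add: algebra_simps)
qed

lemma set_integral_const_Ioc:
  fixes c :: real
  assumes "a \<le> b"
  shows "set_integrable lborel {a<..b} (\<lambda>_::real. c)" "(LINT s:{a<..b}|lborel. c) = (b - a) * c"
proof -
  show "set_integrable lborel {a<..b} (\<lambda>_::real. c)"
    unfolding set_integrable_def using assms by (intro integrable_scaleR_left integrable_real_indicator) auto
  show "(LINT s:{a<..b}|lborel. c) = (b - a) * c"
    using assms unfolding set_lebesgue_integral_def by simp
qed

lemma set_integrable_sum_fun: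
  fixes f :: "'i \<Rightarrow> 'a \<Rightarrow> real"
  assumes "\<And>i. i \<in> I \<Longrightarrow> set_integrable M A (f i)"
  shows "set_integrable M A (\<lambda>x. \<Sum>i\<in>I. f i x)"
  using assms unfolding set_integrable_def scaleR_sum_right by (rule Bochner_Integration.integrable_sum)

lemma set_integral_sum_fun:
  fixes f :: "'i \<Rightarrow> 'a \<Rightarrow> real"
  assumes "\<And>i. i \<in> I \<Longrightarrow> set_integrable M A (f i)"
  shows "(LINT x:A|M. (\<Sum>i\<in>I. f i x)) = (\<Sum>i\<in>I. LINT x:A|M. f i x)"
  using assms unfolding set_integrable_def set_lebesgue_integral_def scaleR_sum_right
  by (rule Bochner_Integration.integral_sum)

text \<open>On a cell with full weight the summand is the integral of an expression that differs
  from the generator expression at \<open>y s\<close> in two ways: the derivatives of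
  \<open>u\<close> are taken at nearby points, and \<open>H\<close> is replaced by
  \<open>Hm\<close>. The first error is uniformly small, the second small in mean square, and the
  drift enters exactly, as its integral over the cell. This is how coefficients without any
  continuity can be handled.\<close>

lemma path_sum_bound:
  fixes \<O> :: "(real^'n) set" and u :: "real \<Rightarrow> real^'n \<Rightarrow> real" and \<tau> :: "nat \<Rightarrow> real" and w :: "nat \<Rightarrow> bool"
    and Z \<Delta> :: "nat \<Rightarrow> real^'n" and \<xi> :: "nat \<Rightarrow> 'n \<Rightarrow> 'n \<Rightarrow> real" and H Hm :: "real \<Rightarrow> 'n \<Rightarrow> 'n \<Rightarrow> real"
    and \<beta> :: "real \<Rightarrow> 'n \<Rightarrow> real"
  defines "n \<equiv> real CARD('n)"
  assumes \<O>: "open \<O>" and u: "C12 \<O> u" and K: "compact K" "K \<subseteq> \<O>"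
    and a: "0 < a" "a \<le> T - T1" and e: "0 < e" and C: "0 \<le> C"
    and bound: "\<And>s z i j. s \<in> {a..T} \<Longrightarrow> z \<in> K \<Longrightarrow> \<bar>dx j (dx i u) s z\<bar> \<le> C"
    and unif: "\<And>s s' z z'. s \<in> {a..T} \<Longrightarrow> s' \<in> {a..T} \<Longrightarrow> z \<in> K \<Longrightarrow> z' \<in> K \<Longrightarrow> \<bar>s - s'\<bar> \<le> d \<Longrightarrow> norm (z - z') \<le> d \<Longrightarrow>
      \<bar>dt u s z - dt u s' z'\<bar> \<le> e \<and> (\<forall>i. \<bar>dx i u s z - dx i u s' z'\<bar> \<le> e) \<and>
      (\<forall>i j. \<bar>dx j (dx i u) s z - dx j (dx i u) s' z'\<bar> \<le> e)"
    and \<tau>: "\<tau> 0 = 0" "\<tau> N = T1" "\<And>k. k < N \<Longrightarrow> \<tau> k < \<tau> (Suc k)" "\<And>k. k < N \<Longrightarrow> \<tau> (Suc k) - \<tau> k \<le> d"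
    and PDE: "\<And>s. 0 \<le> s \<Longrightarrow> s \<le> \<rho> \<Longrightarrow> y s \<in> K \<and> - dt u (T - s) (y s) + (\<Sum>i\<in>UNIV. dx i u (T - s) (y s) * \<beta> s i)
        + 1/2 * (\<Sum>i\<in>UNIV. \<Sum>j\<in>UNIV. \<Sum>l\<in>UNIV. dx j (dx i u) (T - s) (y s) * H s i l * H s j l) \<le> 0"
    and w: "\<And>k. k < N \<Longrightarrow> w (Suc k) \<Longrightarrow> w k"
    and w1: "\<And>k. k < N \<Longrightarrow> w k \<Longrightarrow> \<tau> (Suc k) \<le> \<rho> \<and> Z k \<in> K \<and> (\<forall>s\<in>{\<tau> k..\<tau> (Suc k)}. norm (Z k - y s) \<le> d)"
    and w2: "\<And>k. k < N \<Longrightarrow> w (Suc k) \<Longrightarrow> cball (Z (Suc k)) r \<subseteq> K \<and> norm (\<Delta> k) \<le> r \<and>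
        (\<forall>s\<in>{\<tau> k..\<tau> (Suc k)}. norm (Z (Suc k) - y s) + norm (\<Delta> k) \<le> d)"
    and \<Delta>: "\<And>k i. k < N \<Longrightarrow> w (Suc k) \<Longrightarrow> \<Delta> k $ i = (LINT s:{\<tau> k<..\<tau> (Suc k)}|lborel. \<beta> s i)"
    and int: "\<And>i. set_integrable lborel {0..T1} (\<lambda>s. \<beta> s i)" "set_integrable lborel {0..T1} (\<lambda>s. frob (H s))"
      "set_integrable lborel {0..T1} (\<lambda>s. frob (\<lambda>i l. Hm s i l - H s i l))"
    and Hm: "\<And>k s. k < N \<Longrightarrow> s \<in> {\<tau> k<..\<tau> (Suc k)} \<Longrightarrow> Hm s = \<xi> k"
    and small: "\<And>k. k < N \<Longrightarrow> (LINT s:{\<tau> k<..\<tau> (Suc k)}|lborel. frob (H s)) \<le> e"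
  shows "(\<Sum>k<N. of_bool (w (Suc k)) * (u (T - \<tau> (Suc k)) (Z (Suc k)) - u (T - \<tau> k) (Z (Suc k) - \<Delta> k))
      + 1/2 * (\<tau> (Suc k) - \<tau> k) * (of_bool (w k) *
          (\<Sum>i\<in>UNIV. \<Sum>j\<in>UNIV. \<Sum>l\<in>UNIV. dx j (dx i u) (T - \<tau> k) (Z k) * \<xi> k i l * \<xi> k j l)))
    \<le> (LINT s:{0<..T1}|lborel. e * (1 + (\<Sum>i\<in>UNIV. \<bar>\<beta> s i\<bar>) + n * (1 + C) * frob (H s))
          + C * n * (3 + 1/e) * frob (\<lambda>i l. Hm s i l - H s i l)) + 2 * C * n * e"
proof -
  \<comment> \<open>The factor \<open>3 + 1/e\<close> has to dominate both the
    \<open>1 + 1/e\<close> of \<open>generator_perturbation\<close> and the 2 of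
    \<open>frob_le\<close>, which is used on the cell where the weight drops.\<close>
  define R where "R s = e * (1 + (\<Sum>i\<in>UNIV. \<bar>\<beta> s i\<bar>) + n * (1 + C) * frob (H s))
          + C * n * (3 + 1/e) * frob (\<lambda>i l. Hm s i l - H s i l)" for s
  have n: "0 \<le> n" by (simp add: n_def)
  have R0: "0 \<le> R s" for s
    unfolding R_def using e C n frob_nonneg
    by (intro add_nonneg_nonneg mult_nonneg_nonneg sum_nonneg) auto
  have Rint: "set_integrable lborel {0..T1} R"
  proof -
    have 1: "set_integrable lborel {0..T1} (\<lambda>s. 1 :: real)"
      using borel_integrable_atLeastAtMost'[of 0 T1 "\<lambda>_. 1 :: real"] by simp
    show ?thesis unfolding R_def
      using 1 int by (intro set_integral_add set_integrable_mult_right set_integrable_abs set_integrable_sum_fun) auto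
  qed
  have range: "0 \<le> \<tau> k \<and> \<tau> k \<le> T1" if "k \<le> N" for k
    by (rule partition_range) (use \<tau> that in auto)
  define A where "A k = of_bool (w (Suc k)) * (u (T - \<tau> (Suc k)) (Z (Suc k)) - u (T - \<tau> k) (Z (Suc k) - \<Delta> k))
      + 1/2 * (\<tau> (Suc k) - \<tau> k) * (of_bool (w k) *
          (\<Sum>i\<in>UNIV. \<Sum>j\<in>UNIV. \<Sum>l\<in>UNIV. dx j (dx i u) (T - \<tau> k) (Z k) * \<xi> k i l * \<xi> k j l))" for k
  \<comment> \<open>The second term accounts for the only step at which the weight drops; it telescopes.\<close>
  have step: "A k \<le> (LINT s:{\<tau> k<..\<tau> (Suc k)}|lborel. R s) + 2 * C * n * e * (of_bool (w k) - of_bool (w (Suc k)))"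
    if k: "k < N" for k
  proof -
    let ?I = "{\<tau> k<..\<tau> (Suc k)}"
    define h where "h = \<tau> (Suc k) - \<tau> k"
    have h: "0 < h" "h \<le> d" using \<tau>(3,4)[OF k] by (auto simp: h_def)
    have rk: "0 \<le> \<tau> k" "\<tau> (Suc k) \<le> T1" using range[of k] range[of "Suc k"] k by auto
    have sub: "?I \<subseteq> {0..T1}" using rk by auto
    note int' = set_integrable_subset[OF int(1) _ sub] set_integrable_subset[OF int(2) _ sub]
      set_integrable_subset[OF int(3) _ sub] set_integrable_subset[OF Rint _ sub]
    have RI: "0 \<le> (LINT s:?I|lborel. R s)"
      unfolding set_lebesgue_integral_def by (rule integral_nonneg_AE) (auto simp: R0)
    have times: "T - s \<in> {a..T}" if "s \<in> {\<tau> k..\<tau> (Suc k)}" for s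
      using that rk a by auto
    have less: "\<tau> k < \<tau> (Suc k)" using \<tau>(3)[OF k] .
    consider "\<not> w k" | "w k" "\<not> w (Suc k)" | "w (Suc k)" by blast
    then show ?thesis
    proof cases
      case 1
      then have "\<not> w (Suc k)" using w[OF k] by blast
      then show ?thesis using 1 RI by (simp add: A_def)
    next
      \<comment> \<open>Only the second-order term survives here, and the equation cannot compensate
        it. It is estimated in absolute value: on a single cell the integral of
        \<open>frob (H s)\<close> is at most \<open>e\<close> by \<open>small\<close>.\<close>
      case 2
      have Zk: "Z k \<in> K" using w1[OF k 2(1)] by blast
      have "(\<Sum>i\<in>UNIV. \<Sum>j\<in>UNIV. \<Sum>l\<in>UNIV. dx j (dx i u) (T - \<tau> k) (Z k) * \<xi> k i l * \<xi> k j l)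
        \<le> (\<Sum>i\<in>UNIV. \<Sum>j\<in>UNIV. \<Sum>l\<in>UNIV. C * \<bar>\<xi> k i l * \<xi> k j l\<bar>)"
      proof (intro sum_mono)
        fix i j l
        have "dx j (dx i u) (T - \<tau> k) (Z k) * \<xi> k i l * \<xi> k j l \<le> \<bar>dx j (dx i u) (T - \<tau> k) (Z k)\<bar> * \<bar>\<xi> k i l * \<xi> k j l\<bar>"
          by (rule order_trans[OF abs_ge_self]) (simp add: abs_mult)
        also have "\<dots> \<le> C * \<bar>\<xi> k i l * \<xi> k j l\<bar>"
          using bound[OF times Zk] less by (intro mult_right_mono) auto
        finally show "dx j (dx i u) (T - \<tau> k) (Z k) * \<xi> k i l * \<xi> k j l \<le> C * \<bar>\<xi> k i l * \<xi> k j l\<bar>" .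
      qed
      also have "\<dots> = C * (\<Sum>i\<in>UNIV. \<Sum>j\<in>UNIV. \<Sum>l\<in>UNIV. \<bar>\<xi> k i l * \<xi> k j l\<bar>)"
        by (simp only: sum_distrib_left)
      also have "\<dots> \<le> C * (2 * n * frob (\<xi> k))"
        unfolding n_def using sum_abs_products_le C by (intro mult_left_mono) auto
      finally have le: "(\<Sum>i\<in>UNIV. \<Sum>j\<in>UNIV. \<Sum>l\<in>UNIV. dx j (dx i u) (T - \<tau> k) (Z k) * \<xi> k i l * \<xi> k j l) \<le> C * (2 * n * frob (\<xi> k))" .
      have "A k = 1/2 * h * (\<Sum>i\<in>UNIV. \<Sum>j\<in>UNIV. \<Sum>l\<in>UNIV. dx j (dx i u) (T - \<tau> k) (Z k) * \<xi> k i l * \<xi> k j l)"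
        using 2 by (simp add: A_def h_def)
      also have "\<dots> \<le> 1/2 * h * (C * (2 * n * frob (\<xi> k)))"
        using le h by (intro mult_left_mono) auto
      also have "\<dots> = (LINT s:?I|lborel. C * n * frob (\<xi> k))"
        using less by (simp add: set_integral_const_Ioc h_def algebra_simps)
      also have "\<dots> \<le> (LINT s:?I|lborel. R s + 2 * C * n * frob (H s))"
      proof (rule set_integral_mono)
        show "set_integrable lborel ?I (\<lambda>s. C * n * frob (\<xi> k))"
          using less by (intro set_integral_const_Ioc) auto
        show "set_integrable lborel ?I (\<lambda>s. R s + 2 * C * n * frob (H s))"
          using int' by (intro set_integral_add set_integrable_mult_right) auto
        fix s assume s: "s \<in> ?I"
        have "C * n * frob (\<xi> k) \<le> C * n * (2 * (frob (H s) + frob (\<lambda>i l. Hm s i l - H s i l)))"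
          using frob_le[of "\<xi> k" "H s"] C n unfolding Hm[OF k s] by (intro mult_left_mono) auto
        moreover have "C * n * 2 * frob (\<lambda>i l. Hm s i l - H s i l) \<le> C * n * (3 + 1/e) * frob (\<lambda>i l. Hm s i l - H s i l)"
        proof -
          have "2 \<le> 3 + 1/e" using e by (simp add: add_increasing2)
          then show ?thesis using C n frob_nonneg by (intro mult_right_mono mult_left_mono) auto
        qed
        moreover have "0 \<le> e * (1 + (\<Sum>i\<in>UNIV. \<bar>\<beta> s i\<bar>) + n * (1 + C) * frob (H s))"
          using e C n frob_nonneg by (intro mult_nonneg_nonneg add_nonneg_nonneg sum_nonneg) auto
        ultimately show "C * n * frob (\<xi> k) \<le> R s + 2 * C * n * frob (H s)"
          unfolding R_def by (simp add: algebra_simps)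
      qed
      also have "\<dots> = (LINT s:?I|lborel. R s) + 2 * C * n * (LINT s:?I|lborel. frob (H s))"
        using int' by (subst set_integral_add) auto
      also have "2 * C * n * (LINT s:?I|lborel. frob (H s)) \<le> 2 * C * n * e"
        using small[OF k] C n by (intro mult_left_mono) auto
      finally show ?thesis using 2 by simp
    next
      case 3
      then have wk: "w k" using w[OF k] by blast
      note W1 = w1[OF k wk] and W2 = w2[OF k 3]
      have "a \<le> T - \<tau> (Suc k)" "T - \<tau> (Suc k) \<le> T - \<tau> k" using rk a less by auto
      from C12_increment[OF u a(1) K \<O> _ _ this, of "Z (Suc k)" r "\<Delta> k"] W2
      obtain c p where c: "c \<in> {T - \<tau> (Suc k)..T - \<tau> k}" and p: "p \<in> K" "norm (p - Z (Suc k)) \<le> norm (\<Delta> k)"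
        and incr: "u (T - \<tau> (Suc k)) (Z (Suc k)) - u (T - \<tau> k) (Z (Suc k) - \<Delta> k) =
          - (T - \<tau> k - (T - \<tau> (Suc k))) * dt u c (Z (Suc k)) + (\<Sum>i\<in>UNIV. dx i u (T - \<tau> k) p * \<Delta> k $ i)"
        by blast
      define S where "S = (\<Sum>i\<in>UNIV. \<Sum>j\<in>UNIV. \<Sum>l\<in>UNIV. dx j (dx i u) (T - \<tau> k) (Z k) * \<xi> k i l * \<xi> k j l)"
      have ZS: "Z (Suc k) \<in> K" using W2 norm_ge_zero[of "\<Delta> k"]
        by (metis centre_in_cball order_trans subsetD)
      have cT: "c \<in> {a..T}" using c rk a by auto
      have "A k = h * (- dt u c (Z (Suc k)) + 1/2 * S) + (\<Sum>i\<in>UNIV. dx i u (T - \<tau> k) p * \<Delta> k $ i)"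
      proof -
        have hh: "T - \<tau> k - (T - \<tau> (Suc k)) = h" by (simp add: h_def)
        show ?thesis
          unfolding A_def incr S_def[symmetric] hh h_def[symmetric] using wk 3 by (simp add: distrib_left right_diff_distrib)
      qed
      also have "\<dots> = (LINT s:?I|lborel. (- dt u c (Z (Suc k)) + 1/2 * S) + (\<Sum>i\<in>UNIV. dx i u (T - \<tau> k) p * \<beta> s i))"
      proof (subst set_integral_add)
        show "set_integrable lborel ?I (\<lambda>s. \<Sum>i\<in>UNIV. dx i u (T - \<tau> k) p * \<beta> s i)"
          using int' by (intro set_integrable_sum_fun set_integrable_mult_right) auto
        have "(LINT s:?I|lborel. (\<Sum>i\<in>UNIV. dx i u (T - \<tau> k) p * \<beta> s i)) = (\<Sum>i\<in>UNIV. dx i u (T - \<tau> k) p * \<Delta> k $ i)"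
          using int' by (subst set_integral_sum_fun) (auto simp: \<Delta>[OF k 3])
        then show "h * (- dt u c (Z (Suc k)) + 1/2 * S) + (\<Sum>i\<in>UNIV. dx i u (T - \<tau> k) p * \<Delta> k $ i) =
           (LINT s:?I|lborel. - dt u c (Z (Suc k)) + 1/2 * S) + (LINT s:?I|lborel. (\<Sum>i\<in>UNIV. dx i u (T - \<tau> k) p * \<beta> s i))"
          using less by (subst set_integral_const_Ioc(2)) (auto simp: h_def)
      qed (use less in \<open>auto intro!: set_integral_const_Ioc\<close>)
      also have "\<dots> \<le> (LINT s:?I|lborel. R s)"
      proof (rule set_integral_mono)
        show "set_integrable lborel ?I (\<lambda>s. (- dt u c (Z (Suc k)) + 1/2 * S) + (\<Sum>i\<in>UNIV. dx i u (T - \<tau> k) p * \<beta> s i))"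
          using int' less by (intro set_integral_add set_integrable_sum_fun set_integrable_mult_right set_integral_const_Ioc) auto
        show "set_integrable lborel ?I R" using int' by auto
        fix s assume s: "s \<in> ?I"
        have s0: "0 \<le> s" "s \<le> \<rho>" "s \<in> {\<tau> k..\<tau> (Suc k)}" using s rk W1 by auto
        note P = PDE[OF s0(1,2)]
        have yK: "y s \<in> K" using P by (rule conjunct1)
        have dZ: "norm (Z (Suc k) - y s) \<le> d" "norm (p - y s) \<le> d" "norm (Z k - y s) \<le> d"
        proof -
          show Z1: "norm (Z k - y s) \<le> d" using W1 s0(3) by simp
          have Z2: "norm (Z (Suc k) - y s) + norm (\<Delta> k) \<le> d"
            using W2[THEN conjunct2, THEN conjunct2, rule_format, OF s0(3)] .
          then show "norm (Z (Suc k) - y s) \<le> d" using norm_ge_zero[of "\<Delta> k"] by linarith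
          have "norm (p - y s) \<le> norm (p - Z (Suc k)) + norm (Z (Suc k) - y s)"
            using norm_triangle_ineq[of "p - Z (Suc k)" "Z (Suc k) - y s"] by simp
          then show "norm (p - y s) \<le> d" using p(2) Z2 by linarith
        qed
        have tk: "T - \<tau> k \<in> {a..T}" "T - s \<in> {a..T}" using times less s0 by auto
        have dist: "\<bar>c - (T - s)\<bar> \<le> d" "\<bar>T - \<tau> k - (T - s)\<bar> \<le> d" using c s0 h by (auto simp: h_def abs_if)
        \<comment> \<open>The time derivative, the gradient and the Hessian sit at three different
          points, \<open>Z (Suc k)\<close>, \<open>p\<close> and \<open>Z k\<close>; all of them,
          with their times, are within \<open>d\<close> of the true position at time
          \<open>s\<close>.\<close>
        have "- dt u c (Z (Suc k)) + (\<Sum>i\<in>UNIV. dx i u (T - \<tau> k) p * \<beta> s i) + 1/2 * S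
          \<le> e * (1 + (\<Sum>i\<in>UNIV. \<bar>\<beta> s i\<bar>) + n * (1 + C) * frob (H s)) + C * n * (1 + 1/e) * frob (\<lambda>i l. \<xi> k i l - H s i l)"
          unfolding S_def n_def
        proof (rule generator_perturbation[OF e C])
          show "\<bar>- dt u c (Z (Suc k)) - - dt u (T - s) (y s)\<bar> \<le> e"
            using unif[OF cT tk(2) ZS yK dist(1) dZ(1)] by (simp add: abs_minus_commute)
          show "\<bar>dx i u (T - \<tau> k) p - dx i u (T - s) (y s)\<bar> \<le> e" for i
            using unif[OF tk p(1) yK dist(2) dZ(2)] by blast
          show "\<bar>dx j (dx i u) (T - \<tau> k) (Z k) - dx j (dx i u) (T - s) (y s)\<bar> \<le> e" for i j
            using unif[OF tk W1[THEN conjunct2, THEN conjunct1] yK dist(2) dZ(3)] by blast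
          show "\<bar>dx j (dx i u) (T - \<tau> k) (Z k)\<bar> \<le> C" for i j
            using bound[OF tk(1) W1[THEN conjunct2, THEN conjunct1]] .
          show "- dt u (T - s) (y s) + (\<Sum>i\<in>UNIV. dx i u (T - s) (y s) * \<beta> s i) + 1/2 *
            (\<Sum>i\<in>UNIV. \<Sum>j\<in>UNIV. \<Sum>l\<in>UNIV. dx j (dx i u) (T - s) (y s) * H s i l * H s j l) \<le> 0"
            using P by (rule conjunct2)
        qed
        moreover have "C * n * (1 + 1/e) * frob (\<lambda>i l. \<xi> k i l - H s i l) \<le> C * n * (3 + 1/e) * frob (\<lambda>i l. \<xi> k i l - H s i l)"
          using C n frob_nonneg by (intro mult_right_mono mult_left_mono) auto
        ultimately show "(- dt u c (Z (Suc k)) + 1/2 * S) + (\<Sum>i\<in>UNIV. dx i u (T - \<tau> k) p * \<beta> s i) \<le> R s"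
          unfolding R_def Hm[OF k s] by linarith
      qed
      finally show ?thesis using wk 3 by simp
    qed
  qed
  have "(\<Sum>k<N. A k) \<le> (\<Sum>k<N. (LINT s:{\<tau> k<..\<tau> (Suc k)}|lborel. R s) + 2 * C * n * e * (of_bool (w k) - of_bool (w (Suc k))))"
    using step by (intro sum_mono) auto
  also have "\<dots> = (LINT s:{0<..T1}|lborel. R s) + 2 * C * n * e * (of_bool (w 0) - of_bool (w N))"
  proof -
    have "(\<Sum>k<N. LINT s:{\<tau> k<..\<tau> (Suc k)}|lborel. R s) = (LINT s:{0<..T1}|lborel. R s)"
      using sum_set_integral_partition[of N \<tau> R] \<tau> Rint by simp
    moreover have "(\<Sum>k<N. of_bool (w k) - of_bool (w (Suc k))) = (of_bool (w 0) - of_bool (w N) :: real)"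
      by (rule sum_lessThan_telescope')
    ultimately show ?thesis by (simp only: sum.distrib sum_distrib_left[symmetric])
  qed
  also have "\<dots> \<le> (LINT s:{0<..T1}|lborel. R s) + 2 * C * n * e"
    using C n e by (auto simp: of_bool_def)
  finally show ?thesis unfolding A_def R_def by simp
qed

section \<open>A single path together with its approximations\<close>

lemma set_integral_split_Icc:
  fixes f :: "real \<Rightarrow> real"
  assumes "0 \<le> a" "a \<le> b" "set_integrable lborel {0..b} f"
  shows "(LINT s:{0..b}|lborel. f s) = (LINT s:{0..a}|lborel. f s) + (LINT s:{a<..b}|lborel. f s)"
proof -
  have "{0..b} = {0..a} \<union> {a<..b}" using assms by auto
  moreover have "(LINT s:{0..a} \<union> {a<..b}|lborel. f s) = (LINT s:{0..a}|lborel. f s) + (LINT s:{a<..b}|lborel. f s)"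
    by (rule set_integral_Un) (use assms in \<open>auto intro: set_integrable_subset[OF assms(3)]\<close>)
  ultimately show ?thesis by simp
qed

lemma set_integral_Ioc_le_Icc:
  fixes f :: "real \<Rightarrow> real"
  assumes "set_integrable lborel {a..b} f" "\<And>s. 0 \<le> f s"
  shows "(LINT s:{a<..b}|lborel. f s) \<le> (LINT s:{a..b}|lborel. f s)"
proof -
  have "set_integrable lborel {a<..b} f"
    by (rule set_integrable_subset[OF assms(1)]) auto
  then show ?thesis
    unfolding set_lebesgue_integral_def using assms
    by (intro integral_mono) (auto simp: set_integrable_def indicator_def)
qed

lemma continuous_on_set_integral:
  fixes f :: "real \<Rightarrow> real"
  assumes f: "set_integrable lborel {0..b} f"
  shows "continuous_on {0..b} (\<lambda>t. LINT s:{0..t}|lborel. f s)"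
proof -
  have "f integrable_on {0..b}" using set_borel_integral_eq_integral(1)[OF f] .
  from indefinite_integral_continuous_1[OF this]
  have "continuous_on {0..b} (\<lambda>t. integral {0..t} f)" .
  moreover have "(LINT s:{0..t}|lborel. f s) = integral {0..t} f" if "t \<in> {0..b}" for t
    by (rule set_borel_integral_eq_integral(2), rule set_integrable_subset[OF f]) (use that in auto)
  ultimately show ?thesis by (subst continuous_on_cong) auto
qed

lemma uniformly_continuous_Icc:
  fixes f :: "real \<Rightarrow> 'a::metric_space"
  assumes "continuous_on {a..b} f" "0 < e"
  obtains d where "0 < d" "\<And>s t. s \<in> {a..b} \<Longrightarrow> t \<in> {a..b} \<Longrightarrow> \<bar>s - t\<bar> \<le> d \<Longrightarrow> dist (f s) (f t) < e"
proof -
  have "uniformly_continuous_on {a..b} f"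
    by (rule compact_uniformly_continuous) (use assms in auto)
  then obtain d where d: "d > 0" "\<And>s t. s \<in> {a..b} \<Longrightarrow> t \<in> {a..b} \<Longrightarrow> dist t s < d \<Longrightarrow> dist (f t) (f s) < e"
    unfolding uniformly_continuous_on_def using assms(2) by meson
  show ?thesis
    by (rule that[of "d/2"]) (use d in \<open>auto simp: dist_real_def\<close>)
qed

text \<open>The value 0 at the cemetery only makes the arithmetic total. It may belong to the
  domain, so the vector alone does not reveal an explosion; conditions on the position are therefore
  tested on the option value itself.\<close>

definition state_vector :: "(real^'n) option \<Rightarrow> real^'n" where
  "state_vector z = (case z of None \<Rightarrow> 0 | Some y \<Rightarrow> y)"

lemma state_vector_Some [simp]: "state_vector (Some y) = y"
  by (simp add: state_vector_def)

text \<open>\<open>\<rho>\<close> is the exit time, capped at \<open>T1\<close>, from an open set containing the \<open>r\<close>-balls around the points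
  of \<open>K0\<close>. By the assumption \<open>exit\<close> a path that leaves this set does so far away from \<open>K0\<close>, so that a
  sufficiently fine grid sees it outside \<open>K0\<close> in time.\<close>

locale approximated_path =
  fixes XP :: "real \<Rightarrow> (real^'n) option" and y Iv :: "real \<Rightarrow> real^'n" and x0 :: "real^'n"
    and \<beta> :: "real \<Rightarrow> 'n \<Rightarrow> real" and H :: "real \<Rightarrow> 'n \<Rightarrow> 'n \<Rightarrow> real" and \<rho> T1 r :: real
    and K0 :: "(real^'n) set" and N :: "nat \<Rightarrow> nat" and \<tau> :: "nat \<Rightarrow> nat \<Rightarrow> real"
    and \<xi> :: "nat \<Rightarrow> nat \<Rightarrow> 'n \<Rightarrow> 'n \<Rightarrow> real" and Hm :: "nat \<Rightarrow> real \<Rightarrow> 'n \<Rightarrow> 'n \<Rightarrow> real"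
    and Mm :: "nat \<Rightarrow> real \<Rightarrow> real^'n"
  assumes T1: "0 < T1" and \<rho>: "0 \<le> \<rho>" "\<rho> \<le> T1" and r: "0 < r"
    and XP: "\<And>s. s \<in> {0..\<rho>} \<Longrightarrow> XP s = Some (y s)"
    and y_eq: "\<And>s. s \<in> {0..\<rho>} \<Longrightarrow> y s = x0 + Iv s + (\<chi> i. LINT t:{0..s}|lborel. \<beta> t i)"
    and Iv_cont: "continuous_on {0..T1} Iv"
    and int_\<beta>: "\<And>i. set_integrable lborel {0..T1} (\<lambda>s. \<beta> s i)"
    and int_H: "set_integrable lborel {0..T1} (\<lambda>s. frob (H s))"
    and exit: "\<And>z. \<rho> < T1 \<Longrightarrow> z \<in> K0 \<Longrightarrow> r \<le> norm (y \<rho> - z)"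
    and grid: "\<And>m. \<tau> m 0 = 0" "\<And>m. \<tau> m (N m) = T1" "\<And>m k. k < N m \<Longrightarrow> \<tau> m k < \<tau> m (Suc k)"
      "\<And>m k. k < N m \<Longrightarrow> \<tau> m (Suc k) - \<tau> m k \<le> (1/2)^m"
    and Hm: "\<And>m k s. k < N m \<Longrightarrow> s \<in> {\<tau> m k<..\<tau> m (Suc k)} \<Longrightarrow> Hm m s = \<xi> m k"
    and Mm_lim: "\<And>e. 0 < e \<Longrightarrow> \<forall>\<^sub>F m in sequentially. \<forall>t\<in>{0..T1}. norm (Mm m t - Iv t) \<le> e"
    and Hm_lim: "\<And>e. 0 < e \<Longrightarrow> \<forall>\<^sub>F m in sequentially.
        set_integrable lborel {0..T1} (\<lambda>s. frob (\<lambda>i l. Hm m s i l - H s i l)) \<and>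
        (LINT s:{0..T1}|lborel. frob (\<lambda>i l. Hm m s i l - H s i l)) \<le> e"
begin

text \<open>Up to \<open>\<rho>\<close> this is the starting point plus the integrated drift. The
  definition as a difference gives it a meaning at every grid time, also after the exit.\<close>

definition Bv :: "real \<Rightarrow> real^'n" where
  "Bv t = state_vector (XP t) - Iv t"

definition Zm :: "nat \<Rightarrow> nat \<Rightarrow> real^'n" where
  "Zm m k = state_vector (XP (\<tau> m k)) + Mm m (\<tau> m k) - Iv (\<tau> m k)"

definition \<Delta>m :: "nat \<Rightarrow> nat \<Rightarrow> real^'n" where
  "\<Delta>m m k = Bv (\<tau> m (Suc k)) - Bv (\<tau> m k)"

lemma grid_range: "k \<le> N m \<Longrightarrow> 0 \<le> \<tau> m k \<and> \<tau> m k \<le> T1"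
  by (rule partition_range[OF grid(1,2,3)])

lemma y_cont: "continuous_on {0..\<rho>} y"
proof -
  have "continuous_on {0..\<rho>} (\<lambda>s. x0 + Iv s + (\<chi> i. LINT t:{0..s}|lborel. \<beta> t i))"
    using \<rho> by (intro continuous_intros continuous_on_subset[OF Iv_cont]
        continuous_on_subset[OF continuous_on_set_integral[OF int_\<beta>]]) auto
  then show ?thesis by (subst continuous_on_cong[OF refl y_eq]) auto
qed

lemma mesh_eventually: "0 < d \<Longrightarrow> \<forall>\<^sub>F m in sequentially. \<forall>k<N m. \<tau> m (Suc k) - \<tau> m k \<le> d"
proof -
  assume "0 < d"
  have "(\<lambda>m. (1/2::real)^m) \<longlonglongrightarrow> 0" by (rule LIMSEQ_power_zero) simp
  from order_tendstoD(2)[OF this \<open>0 < d\<close>] show ?thesis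
    by eventually_elim (use grid(4) in force)
qed

text \<open>Uniform continuity on compact intervals. The cell that contains \<open>\<rho>\<close> is
  truncated there, because the equation controls \<open>y\<close> only up to
  \<open>\<rho>\<close>.\<close>

lemma oscillation_eventually:
  assumes "0 < d"
  shows "\<forall>\<^sub>F m in sequentially. \<forall>k<N m. (\<tau> m k \<le> \<rho> \<longrightarrow> (\<forall>s\<in>{\<tau> m k..min \<rho> (\<tau> m (Suc k))}. \<forall>t\<in>{\<tau> m k..min \<rho> (\<tau> m (Suc k))}.
      norm (y s - y t) \<le> d)) \<and> norm (Iv (\<tau> m (Suc k)) - Iv (\<tau> m k)) \<le> d"
proof -
  obtain d1 where d1: "0 < d1" "\<And>s t. s \<in> {0..\<rho>} \<Longrightarrow> t \<in> {0..\<rho>} \<Longrightarrow> \<bar>s - t\<bar> \<le> d1 \<Longrightarrow> dist (y s) (y t) < d"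
    using uniformly_continuous_Icc[OF y_cont assms] by blast
  obtain d2 where d2: "0 < d2" "\<And>s t. s \<in> {0..T1} \<Longrightarrow> t \<in> {0..T1} \<Longrightarrow> \<bar>s - t\<bar> \<le> d2 \<Longrightarrow> dist (Iv s) (Iv t) < d"
    using uniformly_continuous_Icc[OF Iv_cont assms] by blast
  have "0 < min d1 d2" using d1 d2 by simp
  from mesh_eventually[OF this] show ?thesis
  proof eventually_elim
    case (elim m)
    show ?case
    proof (intro allI impI conjI ballI)
      fix k assume k: "k < N m"
      note R = grid_range[of k m] grid_range[of "Suc k" m] grid(3)[OF k]
      show "norm (Iv (\<tau> m (Suc k)) - Iv (\<tau> m k)) \<le> d"
        using d2(2)[of "\<tau> m (Suc k)" "\<tau> m k"] elim k R by (force simp: dist_norm)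
      fix s t assume st: "s \<in> {\<tau> m k..min \<rho> (\<tau> m (Suc k))}" "t \<in> {\<tau> m k..min \<rho> (\<tau> m (Suc k))}"
      have "\<tau> m (Suc k) - \<tau> m k \<le> d1" using elim k by auto
      then have "\<bar>s - t\<bar> \<le> d1" using st by auto
      then show "norm (y s - y t) \<le> d"
        using d1(2)[of s t] st k R by (auto simp: dist_norm)
    qed
  qed
qed

lemma \<Delta>m_eq:
  assumes k: "k < N m" and le: "\<tau> m (Suc k) \<le> \<rho>"
  shows "\<Delta>m m k $ i = (LINT s:{\<tau> m k<..\<tau> m (Suc k)}|lborel. \<beta> s i)"
proof -
  note R = grid_range[of k m] grid_range[of "Suc k" m] grid(3)[OF k]
  have "\<tau> m k \<in> {0..\<rho>}" "\<tau> m (Suc k) \<in> {0..\<rho>}" using R k le by auto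
  then have "\<Delta>m m k $ i = (LINT t:{0..\<tau> m (Suc k)}|lborel. \<beta> t i) - (LINT t:{0..\<tau> m k}|lborel. \<beta> t i)"
    by (simp add: \<Delta>m_def Bv_def XP y_eq)
  also have "\<dots> = (LINT s:{\<tau> m k<..\<tau> m (Suc k)}|lborel. \<beta> s i)"
    using set_integral_split_Icc[of "\<tau> m k" "\<tau> m (Suc k)" "\<lambda>s. \<beta> s i"] R k
      set_integrable_subset[OF int_\<beta>, of "{0..\<tau> m (Suc k)}" i] by auto
  finally show ?thesis .
qed

text \<open>The choices are nested: \<open>e'\<close> determines \<open>e\<close>, uniform
  continuity of the derivatives then gives \<open>d\<close>, and only afterwards is \<open>m\<close>
  taken large. The factor \<open>1/e\<close> in front of the mean-square error does no harm, since
  \<open>e\<close> is already fixed while that error tends to 0.\<close>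

lemma limsup_path_sum_nonpos:
  fixes \<O> :: "(real^'n) set" and u :: "real \<Rightarrow> real^'n \<Rightarrow> real" and w :: "nat \<Rightarrow> nat \<Rightarrow> bool"
  assumes \<O>: "open \<O>" and u: "C12 \<O> u" and K: "compact K" "K \<subseteq> \<O>" "\<And>z. z \<in> K0 \<Longrightarrow> cball z (2 * r) \<subseteq> K"
    and T: "T1 < T"
    and PDE: "\<And>s. 0 \<le> s \<Longrightarrow> s \<le> \<rho> \<Longrightarrow> y s \<in> K \<and> - dt u (T - s) (y s) + (\<Sum>i\<in>UNIV. dx i u (T - s) (y s) * \<beta> s i)
        + 1/2 * (\<Sum>i\<in>UNIV. \<Sum>j\<in>UNIV. \<Sum>l\<in>UNIV. dx j (dx i u) (T - s) (y s) * H s i l * H s j l) \<le> 0"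
    and w: "\<And>m k. k < N m \<Longrightarrow> w m (Suc k) \<Longrightarrow> w m k \<and> norm (\<Delta>m m k) \<le> r"
    and w1: "\<And>m k. k \<le> N m \<Longrightarrow> w m k \<Longrightarrow> XP (\<tau> m k) \<in> Some ` K0 \<and> norm (Mm m (\<tau> m k) - Iv (\<tau> m k)) \<le> r"
    and e': "0 < e'"
  shows "\<forall>\<^sub>F m in sequentially. (\<Sum>k<N m. of_bool (w m (Suc k)) * (u (T - \<tau> m (Suc k)) (Zm m (Suc k)) - u (T - \<tau> m k) (Zm m (Suc k) - \<Delta>m m k))
      + 1/2 * (\<tau> m (Suc k) - \<tau> m k) * (of_bool (w m k) *
          (\<Sum>i\<in>UNIV. \<Sum>j\<in>UNIV. \<Sum>l\<in>UNIV. dx j (dx i u) (T - \<tau> m k) (Zm m k) * \<xi> m k i l * \<xi> m k j l))) \<le> e'"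
proof -
  define n where "n = real CARD('n)"
  have n: "0 \<le> n" by (simp add: n_def)
  define a where "a = T - T1"
  have a: "0 < a" "a \<le> T - T1" using T by (auto simp: a_def)
  obtain C where C: "0 \<le> C" and bound: "\<And>s z i j. s \<in> {a..T} \<Longrightarrow> z \<in> K \<Longrightarrow> \<bar>dx j (dx i u) s z\<bar> \<le> C"
    using C12_bounds[OF u a(1) K(1,2), of T] by blast
  \<comment> \<open>The total coefficient of \<open>e\<close> in \<open>path_sum_bound\<close> after
    integration over \<open>{0..T1}\<close>, including the contribution \<open>2 * C * n\<close> of
    the cell where the weight drops.\<close>
  define J where "J = T1 + (\<Sum>i\<in>UNIV. LINT s:{0..T1}|lborel. \<bar>\<beta> s i\<bar>) + n * (1 + C) * (LINT s:{0..T1}|lborel. frob (H s)) + 2 * C * n"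
  have nn: "0 \<le> (LINT s:{0..T1}|lborel. \<bar>\<beta> s i\<bar>)" "0 \<le> (LINT s:{0..T1}|lborel. frob (H s))" for i
    unfolding set_lebesgue_integral_def by (rule integral_nonneg_AE; simp add: frob_nonneg)+
  have J: "0 < J"
    unfolding J_def using T1 nn n C by (intro add_pos_nonneg mult_nonneg_nonneg sum_nonneg add_nonneg_nonneg) auto
  define e where "e = e' / (2 * J)"
  have e: "0 < e" "e * J = e' / 2" using e' J by (auto simp: e_def)
  obtain d where d: "0 < d" and unif: "\<And>s s' z z'. s \<in> {a..T} \<Longrightarrow> s' \<in> {a..T} \<Longrightarrow> z \<in> K \<Longrightarrow> z' \<in> K \<Longrightarrow> \<bar>s - s'\<bar> \<le> d \<Longrightarrow> norm (z - z') \<le> d \<Longrightarrow>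
      \<bar>dt u s z - dt u s' z'\<bar> \<le> e \<and> (\<forall>i. \<bar>dx i u s z - dx i u s' z'\<bar> \<le> e) \<and>
      (\<forall>i j. \<bar>dx j (dx i u) s z - dx j (dx i u) s' z'\<bar> \<le> e)"
  proof -
    from C12_uniform[OF u a(1) K(1,2) e(1), of T] obtain d where "0 < d"
      and "\<forall>s\<in>{a..T}. \<forall>s'\<in>{a..T}. \<forall>z\<in>K. \<forall>z'\<in>K. \<bar>s - s'\<bar> \<le> d \<longrightarrow> norm (z - z') \<le> d \<longrightarrow>
    \<bar>dt u s z - dt u s' z'\<bar> \<le> e \<and> (\<forall>i. \<bar>dx i u s z - dx i u s' z'\<bar> \<le> e) \<and>
    (\<forall>i j. \<bar>dx j (dx i u) s z - dx j (dx i u) s' z'\<bar> \<le> e)" by blast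
    then show ?thesis by (intro that[of d]) simp_all
  qed
  \<comment> \<open>\<open>close\<close> and \<open>\<Delta>small\<close> each add two errors of
    size \<open>d'\<close>, hence at most \<open>d/2\<close> apiece and \<open>d\<close> together;
    the bound \<open>r/2\<close> makes the oscillation on a cell too small for an exit.\<close>
  define d' where "d' = min (d/4) (r/2)"
  have d': "0 < d'" "d' \<le> d/4" "d' < r" using d r by (auto simp: d'_def)
  define c where "c = C * n * (3 + 1/e) + 1"
  have c: "0 < c" using C n e by (simp add: c_def add_nonneg_pos)
  obtain d3 where d3: "0 < d3" "\<And>s t. s \<in> {0..T1} \<Longrightarrow> t \<in> {0..T1} \<Longrightarrow> \<bar>s - t\<bar> \<le> d3 \<Longrightarrow>
      dist (LINT s:{0..s}|lborel. frob (H s)) (LINT s:{0..t}|lborel. frob (H s)) < e"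
    using uniformly_continuous_Icc[OF continuous_on_set_integral[OF int_H] e(1)] by blast
  have "0 < e' / (2 * c)" using e' c by simp
  note ev = oscillation_eventually[OF d'(1)] mesh_eventually[OF d] mesh_eventually[OF d3(1)] Mm_lim[OF d'(1)] Hm_lim[OF this]
  from ev show ?thesis
  proof eventually_elim
    case (elim m)
    have osc: "norm (y s - y t) \<le> d'" if "k < N m" "\<tau> m k \<le> \<rho>" "s \<in> {\<tau> m k..min \<rho> (\<tau> m (Suc k))}" "t \<in> {\<tau> m k..min \<rho> (\<tau> m (Suc k))}" for k s t
      using elim(1) that by blast
    have oscI: "norm (Iv (\<tau> m (Suc k)) - Iv (\<tau> m k)) \<le> d'" if "k < N m" for k
      using elim(1) that by blast
    \<comment> \<open>If \<open>\<rho>\<close> fell into a cell whose left end still carries weight,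
      the path would be in \<open>K0\<close> at that end and at distance at least \<open>r\<close>
      from it at time \<open>\<rho>\<close>, by \<open>exit\<close>. This contradicts the small
      oscillation on one cell, so grid times alone detect the exit early enough.\<close>
    have inside: "\<tau> m (Suc k) \<le> \<rho>" if "k < N m" "w m k" for k
      using that
    proof (induction k)
      case 0
      show ?case
      proof (rule ccontr)
        assume "\<not> \<tau> m (Suc 0) \<le> \<rho>"
        then have A: "\<rho> < \<tau> m (Suc 0)" by simp
        obtain z where z: "z \<in> K0" "XP (\<tau> m 0) = Some z" using w1[of 0 m] 0 by auto
        have z': "z = y 0" using z XP[of 0] \<rho> by (simp add: grid)
        have "\<rho> < T1" using A grid_range[of "Suc 0" m] 0 by simp
        from exit[OF this z(1)] have "r \<le> norm (y \<rho> - y 0)" by (simp add: z')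
        moreover have "norm (y \<rho> - y 0) \<le> d'" using osc[OF 0(1), of \<rho> 0] \<rho> A by (simp add: grid)
        ultimately show False using d' by simp
      qed
    next
      case (Suc k)
      have le: "\<tau> m (Suc k) \<le> \<rho>" using Suc w[of k m] by simp
      show ?case
      proof (rule ccontr)
        assume "\<not> \<tau> m (Suc (Suc k)) \<le> \<rho>"
        then have A: "\<rho> < \<tau> m (Suc (Suc k))" by simp
        obtain z where z: "z \<in> K0" "XP (\<tau> m (Suc k)) = Some z" using w1[of "Suc k" m] Suc by auto
        have r0: "0 \<le> \<tau> m (Suc k)" using grid_range[of "Suc k" m] Suc by simp
        have z': "z = y (\<tau> m (Suc k))" using z XP[of "\<tau> m (Suc k)"] le r0 by simp
        have "\<rho> < T1" using A grid_range[of "Suc (Suc k)" m] Suc by simp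
        from exit[OF this z(1)] have "r \<le> norm (y \<rho> - y (\<tau> m (Suc k)))" by (simp add: z')
        moreover have "norm (y \<rho> - y (\<tau> m (Suc k))) \<le> d'" using osc[OF Suc(2), of \<rho> "\<tau> m (Suc k)"] le A by simp
        ultimately show False using d' by simp
      qed
    qed
    have Zbound: "cball (Zm m k) r \<subseteq> K" if kw: "k \<le> N m" "w m k" for k
    proof -
      obtain z where z: "z \<in> K0" "XP (\<tau> m k) = Some z" "norm (Mm m (\<tau> m k) - Iv (\<tau> m k)) \<le> r"
        using w1[OF kw] by auto
      have "cball (Zm m k) r \<subseteq> cball z (2 * r)"
      proof
        fix p assume "p \<in> cball (Zm m k) r"
        moreover have "dist z (Zm m k) \<le> r"
          using z by (simp add: Zm_def dist_norm norm_minus_commute add_diff_eq[symmetric])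
        ultimately show "p \<in> cball z (2 * r)"
          using dist_triangle[of z p "Zm m k"] by simp
      qed
      then show ?thesis using K(3)[OF z(1)] by blast
    qed
    have close: "norm (Zm m j - y s) \<le> d / 2"
      if k: "k < N m" "w m k" "j = k \<or> j = Suc k" "s \<in> {\<tau> m k..\<tau> m (Suc k)}" for k j s
    proof -
      note R = grid_range[of k m] grid_range[of "Suc k" m] grid(3)[OF k(1)] inside[OF k(1,2)]
      have j: "\<tau> m j \<in> {\<tau> m k..\<tau> m (Suc k)}" using k(3) R by auto
      have "XP (\<tau> m j) = Some (y (\<tau> m j))" using R k(1) j by (intro XP) auto
      then have "Zm m j - y s = (Mm m (\<tau> m j) - Iv (\<tau> m j)) + (y (\<tau> m j) - y s)"
        by (simp add: Zm_def)
      also have "norm \<dots> \<le> norm (Mm m (\<tau> m j) - Iv (\<tau> m j)) + norm (y (\<tau> m j) - y s)"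
        by (rule norm_triangle_ineq)
      also have "norm (Mm m (\<tau> m j) - Iv (\<tau> m j)) \<le> d'" using elim(4) R k(1) j by auto
      also have "norm (y (\<tau> m j) - y s) \<le> d'" using osc[OF k(1), of "\<tau> m j" s] R k j by auto
      finally show ?thesis using d' by simp
    qed
    have \<Delta>small: "norm (\<Delta>m m k) \<le> d / 2" if k: "k < N m" "w m k" for k
    proof -
      note R = grid_range[of k m] grid_range[of "Suc k" m] grid(3)[OF k(1)] inside[OF k]
      have "XP (\<tau> m k) = Some (y (\<tau> m k))" "XP (\<tau> m (Suc k)) = Some (y (\<tau> m (Suc k)))"
        using R k(1) by (auto intro!: XP)
      then have "\<Delta>m m k = (y (\<tau> m (Suc k)) - y (\<tau> m k)) - (Iv (\<tau> m (Suc k)) - Iv (\<tau> m k))"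
        by (simp add: \<Delta>m_def Bv_def)
      also have "norm \<dots> \<le> norm (y (\<tau> m (Suc k)) - y (\<tau> m k)) + norm (Iv (\<tau> m (Suc k)) - Iv (\<tau> m k))"
        by (rule norm_triangle_ineq4)
      also have "norm (y (\<tau> m (Suc k)) - y (\<tau> m k)) \<le> d'" using osc[OF k(1), of "\<tau> m (Suc k)" "\<tau> m k"] R by simp
      also note oscI[OF k(1)]
      finally show ?thesis using d' by simp
    qed
    have fH: "(LINT s:{\<tau> m k<..\<tau> m (Suc k)}|lborel. frob (H s)) \<le> e" if k: "k < N m" for k
    proof -
      note R = grid_range[of k m] grid_range[of "Suc k" m] grid(3)[OF k(1)]
      have "set_integrable lborel {0..\<tau> m (Suc k)} (\<lambda>s. frob (H s))"
        by (rule set_integrable_subset[OF int_H]) (use R k in auto)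
      from set_integral_split_Icc[OF _ _ this, of "\<tau> m k"] d3(2)[of "\<tau> m (Suc k)" "\<tau> m k"] elim(3) k R
      show ?thesis by (auto simp: dist_real_def)
    qed
    have "(\<Sum>k<N m. of_bool (w m (Suc k)) * (u (T - \<tau> m (Suc k)) (Zm m (Suc k)) - u (T - \<tau> m k) (Zm m (Suc k) - \<Delta>m m k))
      + 1/2 * (\<tau> m (Suc k) - \<tau> m k) * (of_bool (w m k) *
          (\<Sum>i\<in>UNIV. \<Sum>j\<in>UNIV. \<Sum>l\<in>UNIV. dx j (dx i u) (T - \<tau> m k) (Zm m k) * \<xi> m k i l * \<xi> m k j l)))
      \<le> (LINT s:{0<..T1}|lborel. e * (1 + (\<Sum>i\<in>UNIV. \<bar>\<beta> s i\<bar>) + n * (1 + C) * frob (H s))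
          + C * n * (3 + 1/e) * frob (\<lambda>i l. Hm m s i l - H s i l)) + 2 * C * n * e"
      unfolding n_def
    proof (rule path_sum_bound[OF \<O> u K(1,2) a e(1) C bound unif grid(1,2,3) _ PDE _ _ _ _ int_\<beta> int_H conjunct1[OF elim(5)] Hm fH])
      show "\<tau> m (Suc k) - \<tau> m k \<le> d" if "k < N m" for k using elim(2) that by blast
      show "w m k" if "k < N m" "w m (Suc k)" for k using w[OF that] by blast
      show "\<tau> m (Suc k) \<le> \<rho> \<and> Zm m k \<in> K \<and> (\<forall>s\<in>{\<tau> m k..\<tau> m (Suc k)}. norm (Zm m k - y s) \<le> d)" if "k < N m" "w m k" for k
      proof (intro conjI ballI)
        show "Zm m k \<in> K" using Zbound[of k] that r by (auto simp: subset_iff)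
        show "norm (Zm m k - y s) \<le> d" if "s \<in> {\<tau> m k..\<tau> m (Suc k)}" for s
          using close[OF \<open>k < N m\<close> \<open>w m k\<close> _ that, of k] d by simp
      qed (rule inside[OF that])
      show "cball (Zm m (Suc k)) r \<subseteq> K \<and> norm (\<Delta>m m k) \<le> r \<and>
        (\<forall>s\<in>{\<tau> m k..\<tau> m (Suc k)}. norm (Zm m (Suc k) - y s) + norm (\<Delta>m m k) \<le> d)" if "k < N m" "w m (Suc k)" for k
      proof (intro conjI ballI)
        have wk: "w m k" using w[OF that] by blast
        show "cball (Zm m (Suc k)) r \<subseteq> K" using Zbound[of "Suc k"] that by simp
        show "norm (\<Delta>m m k) \<le> r" using w[OF that] by blast
        show "norm (Zm m (Suc k) - y s) + norm (\<Delta>m m k) \<le> d" if "s \<in> {\<tau> m k..\<tau> m (Suc k)}" for s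
          using close[OF \<open>k < N m\<close> wk _ that, of "Suc k"] \<Delta>small[OF \<open>k < N m\<close> wk] by simp
      qed
      show "\<Delta>m m k $ i = (LINT s:{\<tau> m k<..\<tau> m (Suc k)}|lborel. \<beta> s i)" if "k < N m" "w m (Suc k)" for k i
        using \<Delta>m_eq[OF that(1) inside[OF that(1)]] w[OF that] by blast
    qed
    also have "\<dots> \<le> (LINT s:{0..T1}|lborel. e * (1 + (\<Sum>i\<in>UNIV. \<bar>\<beta> s i\<bar>) + n * (1 + C) * frob (H s))
          + C * n * (3 + 1/e) * frob (\<lambda>i l. Hm m s i l - H s i l)) + 2 * C * n * e"
    proof -
      have i1: "set_integrable lborel {0..T1} (\<lambda>s. 1 :: real)"
        using borel_integrable_atLeastAtMost'[of 0 T1 "\<lambda>_. 1 :: real"] by simp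
      have "set_integrable lborel {0..T1} (\<lambda>s. e * (1 + (\<Sum>i\<in>UNIV. \<bar>\<beta> s i\<bar>) + n * (1 + C) * frob (H s))
          + C * n * (3 + 1/e) * frob (\<lambda>i l. Hm m s i l - H s i l))"
        using i1 int_\<beta> int_H elim(5)
        by (intro set_integral_add set_integrable_mult_right set_integrable_abs set_integrable_sum_fun) auto
      moreover have "0 \<le> e * (1 + (\<Sum>i\<in>UNIV. \<bar>\<beta> s i\<bar>) + n * (1 + C) * frob (H s))
          + C * n * (3 + 1/e) * frob (\<lambda>i l. Hm m s i l - H s i l)" for s
        using e C n frob_nonneg
        by (intro add_nonneg_nonneg mult_nonneg_nonneg sum_nonneg) auto
      ultimately show ?thesis by (intro add_right_mono set_integral_Ioc_le_Icc)
    qed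
    also have "\<dots> = e * J + C * n * (3 + 1/e) * (LINT s:{0..T1}|lborel. frob (\<lambda>i l. Hm m s i l - H s i l))"
    proof -
      have i1: "set_integrable lborel {0..T1} (\<lambda>s. 1 :: real)"
        using borel_integrable_atLeastAtMost'[of 0 T1 "\<lambda>_. 1 :: real"] by simp
      have i1': "(LINT s:{0..T1}|lborel. (1::real)) = T1"
        using T1 by (simp add: set_lebesgue_integral_def)
      have ib: "set_integrable lborel {0..T1} (\<lambda>s. \<Sum>i\<in>UNIV. \<bar>\<beta> s i\<bar>)"
        using int_\<beta> by (intro set_integrable_sum_fun set_integrable_abs)
      have ib': "(LINT s:{0..T1}|lborel. (\<Sum>i\<in>UNIV. \<bar>\<beta> s i\<bar>)) = (\<Sum>i\<in>UNIV. LINT s:{0..T1}|lborel. \<bar>\<beta> s i\<bar>)"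
        using int_\<beta> by (intro set_integral_sum_fun set_integrable_abs)
      have i2: "set_integrable lborel {0..T1} (\<lambda>s. 1 + (\<Sum>i\<in>UNIV. \<bar>\<beta> s i\<bar>))"
        by (intro set_integral_add i1 ib)
      have i3: "set_integrable lborel {0..T1} (\<lambda>s. n * (1 + C) * frob (H s))"
        by (intro set_integrable_mult_right int_H)
      have i4: "set_integrable lborel {0..T1} (\<lambda>s. C * n * (3 + 1/e) * frob (\<lambda>i l. Hm m s i l - H s i l))"
        by (intro set_integrable_mult_right conjunct1[OF elim(5)])
      have i5: "set_integrable lborel {0..T1} (\<lambda>s. e * (1 + (\<Sum>i\<in>UNIV. \<bar>\<beta> s i\<bar>) + n * (1 + C) * frob (H s)))"
        by (intro set_integrable_mult_right set_integral_add i2 i3)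
      show ?thesis
        unfolding set_integral_add(2)[OF i5 i4] set_integral_mult_right set_integral_add(2)[OF i2 i3]
          set_integral_add(2)[OF i1 ib] i1' ib' J_def by (simp add: algebra_simps)
    qed
    also have "\<dots> \<le> e'"
    proof -
      have "C * n * (3 + 1/e) * (LINT s:{0..T1}|lborel. frob (\<lambda>i l. Hm m s i l - H s i l)) \<le> c * (e' / (2 * c))"
        using elim(5) C n e c e' by (intro mult_mono') (auto simp: c_def frob_nonneg set_lebesgue_integral_def intro!: integral_nonneg_AE mult_nonneg_nonneg)
      also have "\<dots> = e' / 2" using c by simp
      finally show ?thesis using e(2) by linarith
    qed
    finally show ?case .
  qed
qed

text \<open>For a path that stays in \<open>K0\<close> these two localisation conditions are
  inactive once the approximation is good enough.\<close>

lemma weights_eventually: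
  assumes "\<rho> = T1" and in_K0: "\<And>s. s \<in> {0..T1} \<Longrightarrow> XP s \<in> Some ` K0"
  shows "\<forall>\<^sub>F m in sequentially. (\<forall>k\<le>N m. norm (Mm m (\<tau> m k) - Iv (\<tau> m k)) \<le> r) \<and> (\<forall>k<N m. norm (\<Delta>m m k) \<le> r)"
proof -
  have r2: "0 < r / 2" using r by simp
  from oscillation_eventually[OF r2] Mm_lim[OF r] show ?thesis
  proof eventually_elim
    case (elim m)
    have "norm (\<Delta>m m k) \<le> r" if k: "k < N m" for k
    proof -
      note R = grid_range[of k m] grid_range[of "Suc k" m] grid(3)[OF k]
      have "XP (\<tau> m k) = Some (y (\<tau> m k))" "XP (\<tau> m (Suc k)) = Some (y (\<tau> m (Suc k)))"
        using R k assms(1) by (auto intro!: XP)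
      then have "\<Delta>m m k = (y (\<tau> m (Suc k)) - y (\<tau> m k)) - (Iv (\<tau> m (Suc k)) - Iv (\<tau> m k))"
        by (simp add: \<Delta>m_def Bv_def)
      also have "norm \<dots> \<le> norm (y (\<tau> m (Suc k)) - y (\<tau> m k)) + norm (Iv (\<tau> m (Suc k)) - Iv (\<tau> m k))"
        by (rule norm_triangle_ineq4)
      also have "\<dots> \<le> r / 2 + r / 2"
      proof (rule add_mono)
        show "norm (y (\<tau> m (Suc k)) - y (\<tau> m k)) \<le> r / 2" "norm (Iv (\<tau> m (Suc k)) - Iv (\<tau> m k)) \<le> r / 2"
          using elim(1)[rule_format, OF k] R k assms(1) by auto
      qed
      finally show ?thesis by simp
    qed
    moreover have "norm (Mm m (\<tau> m k) - Iv (\<tau> m k)) \<le> r" if "k \<le> N m" for k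
      using elim(2) grid_range[OF that] by auto
    ultimately show ?case by blast
  qed
qed

text \<open>The increments of \<open>B\<close> are integrals of the drift over disjoint cells, and
  the second sum is an integral of the squared approximating integrand, bounded because these
  converge in mean square. Each path thus has its own finite cut-off, valid for all approximations
  at once.\<close>

lemma variation_bounded:
  assumes "\<rho> = T1"
  shows "\<exists>c::nat. \<forall>m. (\<Sum>k<N m. norm (\<Delta>m m k)) \<le> c \<and> (\<Sum>k<N m. (\<tau> m (Suc k) - \<tau> m k) * frob (\<xi> m k)) \<le> c"
proof -
  define V where "V = (\<Sum>i\<in>UNIV. LINT s:{0..T1}|lborel. \<bar>\<beta> s i\<bar>)"
  have part: "(\<Sum>k<N m. LINT s:{\<tau> m k<..\<tau> m (Suc k)}|lborel. f s) \<le> (LINT s:{0..T1}|lborel. f s)"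
    if f: "set_integrable lborel {0..T1} f" "\<And>s. 0 \<le> f s" for f :: "real \<Rightarrow> real" and m
  proof -
    have "(\<Sum>k<N m. LINT s:{\<tau> m k<..\<tau> m (Suc k)}|lborel. f s) = (LINT s:{0<..T1}|lborel. f s)"
      using sum_set_integral_partition[of "N m" "\<tau> m" f] grid f by simp
    also have "\<dots> \<le> (LINT s:{0..T1}|lborel. f s)"
      by (rule set_integral_Ioc_le_Icc[OF f])
    finally show ?thesis .
  qed
  have sub: "{\<tau> m k<..\<tau> m (Suc k)} \<subseteq> {0..T1}" if "k < N m" for m k
    using grid_range[of k m] grid_range[of "Suc k" m] that by auto
  have 1: "(\<Sum>k<N m. norm (\<Delta>m m k)) \<le> V" for m
  proof -
    have "(\<Sum>k<N m. norm (\<Delta>m m k)) \<le> (\<Sum>k<N m. \<Sum>i\<in>UNIV. LINT s:{\<tau> m k<..\<tau> m (Suc k)}|lborel. \<bar>\<beta> s i\<bar>)"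
    proof (rule sum_mono)
      fix k assume "k \<in> {..<N m}"
      then have k: "k < N m" by simp
      have "norm (\<Delta>m m k) \<le> (\<Sum>i\<in>UNIV. \<bar>\<Delta>m m k $ i\<bar>)" by (rule norm_le_l1_cart)
      also have "\<dots> \<le> (\<Sum>i\<in>UNIV. LINT s:{\<tau> m k<..\<tau> m (Suc k)}|lborel. \<bar>\<beta> s i\<bar>)"
      proof (rule sum_mono)
        fix i
        have "\<Delta>m m k $ i = (LINT s:{\<tau> m k<..\<tau> m (Suc k)}|lborel. \<beta> s i)"
          using \<Delta>m_eq[OF k] grid_range[of "Suc k" m] k assms by simp
        then show "\<bar>\<Delta>m m k $ i\<bar> \<le> (LINT s:{\<tau> m k<..\<tau> m (Suc k)}|lborel. \<bar>\<beta> s i\<bar>)"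
          using set_integral_norm_bound[OF set_integrable_subset[OF int_\<beta>[of i] _ sub[OF k]]] by simp
      qed
      finally show "norm (\<Delta>m m k) \<le> (\<Sum>i\<in>UNIV. LINT s:{\<tau> m k<..\<tau> m (Suc k)}|lborel. \<bar>\<beta> s i\<bar>)" .
    qed
    also have "\<dots> = (\<Sum>i\<in>UNIV. \<Sum>k<N m. LINT s:{\<tau> m k<..\<tau> m (Suc k)}|lborel. \<bar>\<beta> s i\<bar>)"
      by (rule sum.swap)
    also have "\<dots> \<le> V"
      unfolding V_def by (intro sum_mono part set_integrable_abs int_\<beta>) auto
    finally show ?thesis .
  qed
  define Q where "Q m = (\<Sum>k<N m. (\<tau> m (Suc k) - \<tau> m k) * frob (\<xi> m k))" for m
  have "\<forall>\<^sub>F m in sequentially. Q m \<le> 2 * ((LINT s:{0..T1}|lborel. frob (H s)) + 1)"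
    using Hm_lim[of 1, simplified]
  proof eventually_elim
    case (elim m)
    let ?f = "\<lambda>s. 2 * (frob (H s) + frob (\<lambda>i l. Hm m s i l - H s i l))"
    have f: "set_integrable lborel {0..T1} ?f"
      using elim int_H by (intro set_integrable_mult_right set_integral_add) auto
    have "Q m \<le> (\<Sum>k<N m. LINT s:{\<tau> m k<..\<tau> m (Suc k)}|lborel. ?f s)"
      unfolding Q_def
    proof (rule sum_mono)
      fix k assume "k \<in> {..<N m}"
      then have k: "k < N m" by simp
      have "(\<tau> m (Suc k) - \<tau> m k) * frob (\<xi> m k) = (LINT s:{\<tau> m k<..\<tau> m (Suc k)}|lborel. frob (\<xi> m k))"
        using grid(3)[OF k] by (simp add: set_integral_const_Ioc)
      also have "\<dots> \<le> (LINT s:{\<tau> m k<..\<tau> m (Suc k)}|lborel. ?f s)"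
      proof (rule set_integral_mono)
        show "set_integrable lborel {\<tau> m k<..\<tau> m (Suc k)} (\<lambda>s. frob (\<xi> m k))"
          using grid(3)[OF k] by (intro set_integral_const_Ioc) auto
        show "set_integrable lborel {\<tau> m k<..\<tau> m (Suc k)} ?f"
          by (rule set_integrable_subset[OF f _ sub[OF k]]) simp
        show "frob (\<xi> m k) \<le> ?f s" if "s \<in> {\<tau> m k<..\<tau> m (Suc k)}" for s
          using frob_le[of "\<xi> m k" "H s"] by (simp add: Hm[OF k that])
      qed
      finally show "(\<tau> m (Suc k) - \<tau> m k) * frob (\<xi> m k) \<le> (LINT s:{\<tau> m k<..\<tau> m (Suc k)}|lborel. ?f s)" .
    qed
    also have "\<dots> \<le> (LINT s:{0..T1}|lborel. ?f s)"
      by (rule part[OF f]) (simp add: frob_nonneg)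
    also have "\<dots> \<le> 2 * ((LINT s:{0..T1}|lborel. frob (H s)) + 1)"
      using elim int_H by (subst set_integral_mult_right, subst set_integral_add) auto
    finally show ?case .
  qed
  then obtain m0 where m0: "\<And>m. m0 \<le> m \<Longrightarrow> Q m \<le> 2 * ((LINT s:{0..T1}|lborel. frob (H s)) + 1)"
    unfolding eventually_sequentially by blast
  \<comment> \<open>Convergence bounds \<open>Q m\<close> for all but finitely many
    \<open>m\<close>; the maximum covers the exceptions.\<close>
  obtain c :: nat where c: "max V (Max (insert (2 * ((LINT s:{0..T1}|lborel. frob (H s)) + 1)) (Q ` {..<m0}))) \<le> c"
    using real_arch_simple by blast
  have "Q m \<le> c" for m
  proof -
    have "Q m \<le> Max (insert (2 * ((LINT s:{0..T1}|lborel. frob (H s)) + 1)) (Q ` {..<m0}))"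
    proof (cases "m < m0")
      case True then show ?thesis by (intro Max_ge) auto
    next
      case False
      then have "Q m \<le> 2 * ((LINT s:{0..T1}|lborel. frob (H s)) + 1)" using m0 by simp
      also have "\<dots> \<le> Max (insert (2 * ((LINT s:{0..T1}|lborel. frob (H s)) + 1)) (Q ` {..<m0}))"
        by (intro Max_ge) auto
      finally show ?thesis .
    qed
    then show ?thesis using c by linarith
  qed
  moreover have "(\<Sum>k<N m. norm (\<Delta>m m k)) \<le> c" for m
    using 1[of m] c by simp
  ultimately show ?thesis unfolding Q_def by blast
qed

end

section \<open>Localisation by weights\<close>

text \<open>As \<open>v\<close> is decreasing, the weighted sum is the partial sum up to the last
  index where \<open>v\<close> holds, and at that index the bound is assumed.\<close>

lemma stopped_sum_le:
  fixes a :: "nat \<Rightarrow> real"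
  assumes "\<And>k. k < N \<Longrightarrow> 0 \<le> a k" "\<And>k. Suc k < N \<Longrightarrow> v (Suc k) \<Longrightarrow> v k"
    and "\<And>k. k < N \<Longrightarrow> v k \<Longrightarrow> (\<Sum>j\<le>k. a j) \<le> c" "0 \<le> c"
  shows "(\<Sum>k<N. of_bool (v k) * a k) \<le> c"
  using assms(1-3)
proof (induction N)
  case (Suc N)
  show ?case
  proof (cases "v N")
    case True
    have "(\<Sum>k<Suc N. of_bool (v k) * a k) \<le> (\<Sum>k<Suc N. a k)"
      using Suc.prems(1) by (intro sum_mono) (auto simp: of_bool_def)
    also have "\<dots> = (\<Sum>k\<le>N. a k)" by (simp add: lessThan_Suc_atMost)
    also have "\<dots> \<le> c" using Suc.prems(3)[of N] True by simp
    finally show ?thesis .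
  next
    case False
    then show ?thesis using Suc by simp
  qed
qed (use assms(4) in simp)

section \<open>Weighted expectations along one grid\<close>

lemma measurable_indicator_continuous:
  fixes f :: "real^'n \<Rightarrow> real"
  assumes "compact K" "continuous_on K f"
  shows "(\<lambda>z. indicator K z * f z) \<in> borel_measurable borel"
  using borel_measurable_continuous_on_indicator[OF _ assms(2)] assms(1)
  by (simp add: borel_compact)

lemma borel_measurable_vec_lambda:
  fixes f :: "'n::finite \<Rightarrow> 'a \<Rightarrow> real"
  assumes "\<And>i. f i \<in> borel_measurable M"
  shows "(\<lambda>x. \<chi> i. f i x) \<in> borel_measurable M"
  by (subst borel_measurable_euclidean_space) (auto simp: Basis_vec_def inner_axis assms)

context brownian
begin

text \<open>Instance of \<open>discrete_supermartingale_bound\<close>. The bound on \<open>S\<close>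
  contains no bound of the elementary integrands and no mesh size, which makes it usable for
  dominated convergence: \<open>B * T1\<close> comes from the time derivative, one
  \<open>n * B * N0\<close> from the drift and one from the second-order term. The two cut-offs in
  \<open>w k\<close> differ by one index. The integrand on cell \<open>k\<close> is known at the
  left end of the cell, so its term is included before it is used. The drift increment
  \<open>\<Delta> k\<close> is known only at the right end, so it is controlled by
  \<open>w (Suc k)\<close>, the weight that multiplies it in \<open>S\<close>.\<close>

lemma weighted_bound:
  fixes \<O> K K0 :: "(real^'n) set" and u :: "real \<Rightarrow> real^'n \<Rightarrow> real"
    and V I' :: "real \<Rightarrow> 'w \<Rightarrow> real^'n" and P :: "real \<Rightarrow> 'w \<Rightarrow> bool" and L :: "'n \<Rightarrow> 'n \<Rightarrow> 'w elementary"
    and \<tau> :: "nat \<Rightarrow> real" and N0 r T :: real and N :: nat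
  defines "n \<equiv> real CARD('n)"
  defines "Mm \<equiv> \<lambda>t \<omega>. \<chi> i. \<Sum>l\<in>UNIV. elementary_integral (\<lambda>t \<omega>. W t \<omega> $ l) (L i l) t \<omega>"
  defines "\<xi> \<equiv> \<lambda>k i l \<omega>. elementary_process (L i l) (\<tau> (Suc k)) \<omega>"
  defines "Z \<equiv> \<lambda>k \<omega>. V (\<tau> k) \<omega> + Mm (\<tau> k) \<omega> - I' (\<tau> k) \<omega>"
  defines "\<Delta> \<equiv> \<lambda>k \<omega>. (V (\<tau> (Suc k)) \<omega> - I' (\<tau> (Suc k)) \<omega>) - (V (\<tau> k) \<omega> - I' (\<tau> k) \<omega>)"
  defines "w \<equiv> \<lambda>k \<omega>. (\<forall>j\<le>k. P (\<tau> j) \<omega> \<and> norm (Mm (\<tau> j) \<omega> - I' (\<tau> j) \<omega>) \<le> r) \<and> (\<forall>j<k. norm (\<Delta> j \<omega>) \<le> r) \<and>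
      (\<Sum>j<k. norm (\<Delta> j \<omega>)) \<le> N0 \<and>
      (\<Sum>j\<in>{..k} \<inter> {..<N}. (\<tau> (Suc j) - \<tau> j) * frob (\<lambda>i l. \<xi> j i l \<omega>)) \<le> N0"
  defines "S \<equiv> \<lambda>\<omega>. (\<Sum>k<N. of_bool (w (Suc k) \<omega>) * (u (T - \<tau> (Suc k)) (Z (Suc k) \<omega>) - u (T - \<tau> k) (Z (Suc k) \<omega> - \<Delta> k \<omega>))
      + 1/2 * (\<tau> (Suc k) - \<tau> k) * (of_bool (w k \<omega>) *
          (\<Sum>i\<in>UNIV. \<Sum>j\<in>UNIV. \<Sum>l\<in>UNIV. dx j (dx i u) (T - \<tau> k) (Z k \<omega>) * \<xi> k i l \<omega> * \<xi> k j l \<omega>)))"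
  assumes \<O>: "open \<O>" and u: "C12 \<O> u" and K: "compact K" "K \<subseteq> \<O>" "\<And>z. z \<in> K0 \<Longrightarrow> cball z (2 * r) \<subseteq> K"
    and T: "T1 < T" and N0: "0 \<le> N0" and r: "0 < r" and B0: "0 \<le> B"
    and u0: "\<And>t z. 0 < t \<Longrightarrow> z \<in> \<O> \<Longrightarrow> 0 \<le> u t z"
    and bound: "\<And>s z. s \<in> {T-T1..T} \<Longrightarrow> z \<in> K \<Longrightarrow> \<bar>u s z\<bar> \<le> B \<and> \<bar>dt u s z\<bar> \<le> B \<and> (\<forall>i. \<bar>dx i u s z\<bar> \<le> B) \<and>
       (\<forall>i j. \<bar>dx j (dx i u) s z\<bar> \<le> B)"
    and taylor: "\<And>s z v. s \<in> {T-T1..T} \<Longrightarrow> cball z r \<subseteq> K \<Longrightarrow>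
       indicator K (z + v) * u s (z + v) - u s z \<le> (\<Sum>i\<in>UNIV. dx i u s z * v $ i)
       + 1/2 * (\<Sum>i\<in>UNIV. \<Sum>j\<in>UNIV. dx j (dx i u) s z * v $ i * v $ j) + e * (norm v)\<^sup>2 + C * norm v ^ 4"
    and eC: "0 \<le> e" "0 \<le> C"
    and V: "\<And>t. 0 \<le> t \<Longrightarrow> V t \<in> borel_measurable (F t)" and I': "\<And>t. 0 \<le> t \<Longrightarrow> I' t \<in> borel_measurable (F t)"
    and P: "\<And>t. 0 \<le> t \<Longrightarrow> {\<omega>\<in>space M. P t \<omega>} \<in> sets (F t)" "\<And>t \<omega>. P t \<omega> \<Longrightarrow> V t \<omega> \<in> K0"
    and L: "\<And>i l. elementary M F (L i l)" "\<And>i l t \<omega>. \<omega> \<in> space M \<Longrightarrow> \<bar>elementary_process (L i l) t \<omega>\<bar> \<le> X"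
    and \<tau>: "\<tau> 0 = 0" "\<tau> N = T1" "\<And>k. k < N \<Longrightarrow> \<tau> k < \<tau> (Suc k)" "\<And>k. k < N \<Longrightarrow> \<tau> (Suc k) - \<tau> k \<le> \<delta>"
      "\<And>p k i l. p \<in> endpoints (L i l) \<Longrightarrow> k < N \<Longrightarrow> p \<le> \<tau> k \<or> \<tau> (Suc k) \<le> p"
  shows "S \<in> borel_measurable M" and "\<And>\<omega>. \<omega> \<in> space M \<Longrightarrow> \<bar>S \<omega>\<bar> \<le> B * T1 + n * B * N0 + n * B * N0"
    and "(\<lambda>\<omega>. of_bool (w N \<omega>) * (indicator K (Z N \<omega>) * u (T - T1) (Z N \<omega>))) \<in> borel_measurable M"
    and "(\<integral>\<omega>. of_bool (w N \<omega>) * (indicator K (Z N \<omega>) * u (T - T1) (Z N \<omega>)) \<partial>M)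
      \<le> (\<integral>\<omega>. of_bool (w 0 \<omega>) * (indicator K (Z 0 \<omega>) * u T (Z 0 \<omega>)) \<partial>M) + (\<integral>\<omega>. S \<omega> \<partial>M)
        + (e * (n ^ 5 * X\<^sup>2) + C * (3 * n ^ 10 * X ^ 4) * \<delta>) * T1"
    and "\<And>k \<omega>. w k \<omega> \<Longrightarrow> cball (Z k \<omega>) r \<subseteq> K"
    and "\<And>k \<omega>. w (Suc k) \<omega> \<Longrightarrow> k < N \<Longrightarrow> w k \<omega>"
proof -
  have n: "0 \<le> n" by (simp add: n_def)
  obtain \<omega>0 where \<omega>0: "\<omega>0 \<in> space M" using not_empty by blast
  have range: "0 \<le> \<tau> k \<and> \<tau> k \<le> T1" if "k \<le> N" for k
    by (rule partition_range) (use \<tau> that in auto)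
  have times: "T - \<tau> k \<in> {T-T1..T}" "0 < T - \<tau> k" if "k \<le> N" for k
    using range[OF that] T by auto
  have mono: "\<tau> j \<le> \<tau> k" if "j \<le> k" "k \<le> N" for j k
    using that
  proof (induction rule: inc_induct)
    case (step m) then show ?case using \<tau>(3)[of m] by simp
  qed simp
  have up: "f \<in> measurable (F (\<tau> k)) A" if "f \<in> measurable (F (\<tau> j)) A" "j \<le> k" "k \<le> N" for f j k and A :: "'z measure"
    using measurable_F_mono[OF that(1) mono[OF that(2,3)]] range[of j] that by auto
  have toM: "f \<in> measurable M A" if "f \<in> measurable (F (\<tau> k)) A" "k \<le> N" for f k and A :: "'z measure"
    using measurable_F_M[OF that(1)] range[OF that(2)] by auto
  have mV: "V (\<tau> k) \<in> borel_measurable (F (\<tau> k))" "I' (\<tau> k) \<in> borel_measurable (F (\<tau> k))" if "k \<le> N" for k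
    using V I' range[OF that] by auto
  have mWl: "(\<lambda>\<omega>. W t \<omega> $ l) \<in> borel_measurable (F t)" if "0 \<le> t" for t l
    using measurable_compose[OF W_F[OF that], of "\<lambda>x. x $ l" borel] by simp
  have mMm: "Mm (\<tau> k) \<in> borel_measurable (F (\<tau> k))" if "k \<le> N" for k
    unfolding Mm_def using range[OF that]
    by (intro borel_measurable_vec_lambda borel_measurable_sum elementary_integral_measurable L mWl) auto
  have m\<xi>: "\<xi> k i l \<in> borel_measurable (F (\<tau> k))" if "k < N" for k i l
    unfolding \<xi>_def using \<tau>(5)[OF _ that] \<tau>(3)[OF that] range[of k] that
    by (intro elementary_process_measurable L) auto
  have mZ: "Z k \<in> borel_measurable (F (\<tau> k))" if "k \<le> N" for k
    unfolding Z_def using mV[OF that] mMm[OF that] by (intro borel_measurable_diff borel_measurable_add)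
  have m\<Delta>: "\<Delta> k \<in> borel_measurable (F (\<tau> (Suc k)))" if "k < N" for k
    unfolding \<Delta>_def using mV[of "Suc k"] up[OF mV(1)[of k], of "Suc k"] up[OF mV(2)[of k], of "Suc k"] that
    by (intro borel_measurable_diff) auto
  have mw: "{\<omega>\<in>space (F (\<tau> k)). w k \<omega>} \<in> sets (F (\<tau> k))" if k: "k \<le> N" for k
  proof -
    have sp: "space (F (\<tau> k)) = space M" using range[OF k] by simp
    have [measurable]: "Measurable.pred (F (\<tau> k)) (P (\<tau> j))" if "j \<le> k" for j
    proof -
      have j: "j \<le> N" using that k by simp
      then have "Measurable.pred (F (\<tau> j)) (P (\<tau> j))" using P(1)[of "\<tau> j"] range[OF j] by (simp add: pred_def)
      then show ?thesis using up that k by blast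
    qed
    have [measurable]: "Mm (\<tau> j) \<in> borel_measurable (F (\<tau> k))" "I' (\<tau> j) \<in> borel_measurable (F (\<tau> k))" if "j \<le> k" for j
      using up[OF mMm[of j]] up[OF mV(2)[of j]] that k by auto
    have [measurable]: "\<Delta> j \<in> borel_measurable (F (\<tau> k))" if "j < k" for j
      using up[OF m\<Delta>[of j]] that k by auto
    have [measurable]: "\<xi> j i l \<in> borel_measurable (F (\<tau> k))" if "j \<in> {..k} \<inter> {..<N}" for j i l
      using up[OF m\<xi>[of j]] that k by auto
    show ?thesis unfolding w_def frob_def by measurable
  qed
  have mwb: "(\<lambda>\<omega>. of_bool (w k \<omega>) :: real) \<in> borel_measurable (F (\<tau> k))" if "k \<le> N" for k
  proof -
    have "(\<lambda>\<omega>. indicator {\<omega>\<in>space (F (\<tau> k)). w k \<omega>} \<omega> :: real) \<in> borel_measurable (F (\<tau> k))"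
      using mw[OF that] by (rule borel_measurable_indicator)
    then show ?thesis by (rule measurable_cong[THEN iffD1, rotated]) (auto simp: indicator_def)
  qed
  have w_prev: "w k \<omega>" if "w (Suc k) \<omega>" "k < N" for k \<omega>
  proof -
    have nn: "0 \<le> (\<tau> (Suc j) - \<tau> j) * frob (\<lambda>i l. \<xi> j i l \<omega>)" if "j < N" for j
      using \<tau>(3)[OF that] frob_nonneg by (intro mult_nonneg_nonneg) auto
    have "(\<Sum>j\<in>{..k} \<inter> {..<N}. (\<tau> (Suc j) - \<tau> j) * frob (\<lambda>i l. \<xi> j i l \<omega>)) \<le>
      (\<Sum>j\<in>{..Suc k} \<inter> {..<N}. (\<tau> (Suc j) - \<tau> j) * frob (\<lambda>i l. \<xi> j i l \<omega>))"
      by (rule sum_mono2) (use nn in auto)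
    moreover have "(\<Sum>j<k. norm (\<Delta> j \<omega>)) \<le> (\<Sum>j<Suc k. norm (\<Delta> j \<omega>))" by simp
    ultimately show ?thesis using that unfolding w_def by (meson le_SucI less_SucI order_trans)
  qed
  then show "\<And>k \<omega>. w (Suc k) \<omega> \<Longrightarrow> k < N \<Longrightarrow> w k \<omega>" .
  have Zb: "cball (Z k \<omega>) r \<subseteq> K" if "w k \<omega>" for k \<omega>
  proof -
    have z: "V (\<tau> k) \<omega> \<in> K0" "norm (Mm (\<tau> k) \<omega> - I' (\<tau> k) \<omega>) \<le> r"
      using that P(2) unfolding w_def by auto
    have "cball (Z k \<omega>) r \<subseteq> cball (V (\<tau> k) \<omega>) (2 * r)"
    proof
      fix p assume "p \<in> cball (Z k \<omega>) r"
      moreover have "dist (V (\<tau> k) \<omega>) (Z k \<omega>) \<le> r"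
        using z by (simp add: Z_def dist_norm norm_minus_commute add_diff_eq[symmetric])
      ultimately show "p \<in> cball (V (\<tau> k) \<omega>) (2 * r)"
        using dist_triangle[of "V (\<tau> k) \<omega>" p "Z k \<omega>"] by simp
    qed
    then show ?thesis using K(3)[OF z(1)] by blast
  qed
  then show "\<And>k \<omega>. w k \<omega> \<Longrightarrow> cball (Z k \<omega>) r \<subseteq> K" .
  have ZK: "Z k \<omega> \<in> K" if "w k \<omega>" for k \<omega>
    using Zb[OF that] r by (auto simp: subset_iff)
  have \<Delta>r: "norm (\<Delta> k \<omega>) \<le> r" if "w (Suc k) \<omega>" for k \<omega>
    using that unfolding w_def by auto
  have Z\<Delta>K: "Z (Suc k) \<omega> - \<Delta> k \<omega> \<in> K" if "w (Suc k) \<omega>" for k \<omega>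
    using Zb[OF that] \<Delta>r[OF that] by (auto simp: subset_iff dist_norm)
  \<comment> \<open>Cutting off at \<open>K\<close> yields bounded Borel functions on the whole
    space. A positive weight forces \<open>Z k\<close> into \<open>K\<close>, so the cut-off is
    invisible wherever it is multiplied by a weight at its own point.\<close>
  define \<phi> where "\<phi> s z = indicator K z * u s z" for s z
  define p where "p i s z = indicator K z * dx i u s z" for i s z
  define q where "q i j s z = indicator K z * dx j (dx i u) s z" for i j s z
  have m\<phi>: "\<phi> s \<in> borel_measurable borel" "p i s \<in> borel_measurable borel" "q i j s \<in> borel_measurable borel" if "0 < s" for s i j
    unfolding \<phi>_def p_def q_def
    using C12_continuous_slice[OF u that] K(2) by (auto intro!: measurable_indicator_continuous K(1) intro: continuous_on_subset)
  have b\<phi>: "0 \<le> \<phi> s z" "\<bar>\<phi> s z\<bar> \<le> B" "\<bar>p i s z\<bar> \<le> B" "\<bar>q i j s z\<bar> \<le> B" if "s \<in> {T-T1..T}" for s z i j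
    unfolding \<phi>_def p_def q_def using bound[OF that, of z] B0 u0[of s z] that T K(2) by (auto simp: indicator_def)
  define v where "v k \<omega> = (\<chi> i. \<Sum>l\<in>UNIV. \<xi> k i l \<omega> * (W (\<tau> (Suc k)) \<omega> - W (\<tau> k) \<omega>) $ l)" for k \<omega>
  \<comment> \<open>The step is split at this intermediate point: from \<open>Z k\<close> it is
    reached by the Gaussian increment alone, and from there \<open>Z (Suc k)\<close> by the drift
    alone.\<close>
  have Zv: "Z (Suc k) \<omega> - \<Delta> k \<omega> = Z k \<omega> + v k \<omega>" if "k < N" for k \<omega>
  proof -
    have "Mm (\<tau> (Suc k)) \<omega> - Mm (\<tau> k) \<omega> = v k \<omega>"
      unfolding Mm_def v_def \<xi>_def vec_eq_iff
      using elementary_integral_increment[OF L(1), of _ _ "\<tau> k" "\<tau> (Suc k)"] \<tau>(5)[OF _ that] \<tau>(3)[OF that]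
      by (simp flip: sum_subtractf)
    then show ?thesis by (simp add: Z_def \<Delta>_def algebra_simps)
  qed
  define \<Phi> where "\<Phi> k \<omega> = of_bool (w k \<omega>) * \<phi> (T - \<tau> k) (Z k \<omega>)" for k \<omega>
  define Y where "Y k \<omega> = of_bool (w k \<omega>) * \<phi> (T - \<tau> k) (Z k \<omega> + v k \<omega>)" for k \<omega>
  define A where "A k \<omega> = of_bool (w (Suc k) \<omega>) * (\<phi> (T - \<tau> (Suc k)) (Z (Suc k) \<omega>) - \<phi> (T - \<tau> k) (Z (Suc k) \<omega> - \<Delta> k \<omega>))" for k \<omega>
  define Q where "Q k i j \<omega> = of_bool (w k \<omega>) * q i j (T - \<tau> k) (Z k \<omega>)" for k i j \<omega>
  define R where "R k i \<omega> = of_bool (w k \<omega>) * p i (T - \<tau> k) (Z k \<omega>)" for k i \<omega>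
  have m\<Phi>: "\<Phi> k \<in> borel_measurable (F (\<tau> k))" if "k \<le> N" for k
    unfolding \<Phi>_def using mwb[OF that] measurable_compose[OF mZ[OF that] m\<phi>(1)[OF times(2)[OF that]]] by simp
  have mQ: "Q k i j \<in> borel_measurable (F (\<tau> k))" if "k \<le> N" for k i j
    unfolding Q_def using mwb[OF that] measurable_compose[OF mZ[OF that] m\<phi>(3)[OF times(2)[OF that]]] by simp
  have mR: "R k i \<in> borel_measurable (F (\<tau> k))" if "k \<le> N" for k i
    unfolding R_def using mwb[OF that] measurable_compose[OF mZ[OF that] m\<phi>(2)[OF times(2)[OF that]]] by simp
  have mA: "A k \<in> borel_measurable M" if k: "k < N" for k
  proof -
    have "(\<lambda>\<omega>. Z (Suc k) \<omega> - \<Delta> k \<omega>) \<in> borel_measurable (F (\<tau> (Suc k)))"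
      using mZ[of "Suc k"] m\<Delta>[OF k] k by (intro borel_measurable_diff) auto
    from measurable_compose[OF this m\<phi>(1)[OF times(2)[of k]]]
    have "(\<lambda>\<omega>. \<phi> (T - \<tau> k) (Z (Suc k) \<omega> - \<Delta> k \<omega>)) \<in> borel_measurable (F (\<tau> (Suc k)))" using k by simp
    then have "A k \<in> borel_measurable (F (\<tau> (Suc k)))"
      unfolding A_def using mwb[of "Suc k"] measurable_compose[OF mZ[of "Suc k"] m\<phi>(1)[OF times(2)[of "Suc k"]]] k
      by (intro borel_measurable_times borel_measurable_diff) auto
    from toM[OF this] show ?thesis using k by simp
  qed
  have mY: "Y k \<in> borel_measurable M" if k: "k < N" for k
  proof -
    have "(\<lambda>\<omega>. Z (Suc k) \<omega> - \<Delta> k \<omega>) \<in> borel_measurable M"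
      using toM[OF mZ[of "Suc k"]] toM[OF m\<Delta>[OF k]] k by (intro borel_measurable_diff) auto
    then have "(\<lambda>\<omega>. Z k \<omega> + v k \<omega>) \<in> borel_measurable M" by (simp add: Zv[OF k])
    from measurable_compose[OF this m\<phi>(1)[OF times(2)[of k]]]
    have "(\<lambda>\<omega>. \<phi> (T - \<tau> k) (Z k \<omega> + v k \<omega>)) \<in> borel_measurable M" using k by simp
    then show ?thesis
      unfolding Y_def using toM[OF mwb[of k]] k by (intro borel_measurable_times) auto
  qed
  have bA: "\<bar>A k \<omega>\<bar> \<le> 2 * B" if "k < N" for k \<omega>
  proof -
    have "\<bar>\<phi> (T - \<tau> (Suc k)) (Z (Suc k) \<omega>) - \<phi> (T - \<tau> k) (Z (Suc k) \<omega> - \<Delta> k \<omega>)\<bar> \<le> B + B"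
      using b\<phi>(2)[OF times(1)[of "Suc k"]] b\<phi>(2)[OF times(1)[of k]] that
      by (intro order_trans[OF abs_triangle_ineq4 add_mono]) auto
    then show ?thesis unfolding A_def using B0 by (auto simp: of_bool_def)
  qed
  have intA: "integrable M (A k)" if "k < N" for k
    by (rule integrable_const_bound[of _ "2 * B"]) (use bA[OF that] mA[OF that] in auto)
  have int\<Phi>: "integrable M (\<Phi> k)" if "k \<le> N" for k
    by (rule integrable_const_bound[of _ B])
      (use toM[OF m\<Phi>[OF that] that] b\<phi>(2)[OF times(1)[OF that]] B0 in \<open>auto simp: \<Phi>_def of_bool_def\<close>)
  have intY: "integrable M (Y k)" if "k < N" for k
    by (rule integrable_const_bound[of _ B])
      (use mY[OF that] b\<phi>(2)[OF times(1)[of k]] that B0 in \<open>auto simp: Y_def of_bool_def\<close>)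
  have S_eq: "S \<omega> = (\<Sum>k<N. A k \<omega> + 1/2 * (\<tau> (Suc k) - \<tau> k) *
            (\<Sum>i\<in>UNIV. \<Sum>j\<in>UNIV. \<Sum>l\<in>UNIV. Q k i j \<omega> * \<xi> k i l \<omega> * \<xi> k j l \<omega>))" for \<omega>
    unfolding S_def
  proof (rule sum.cong[OF refl])
    fix k assume "k \<in> {..<N}"
    have "A k \<omega> = of_bool (w (Suc k) \<omega>) * (u (T - \<tau> (Suc k)) (Z (Suc k) \<omega>) - u (T - \<tau> k) (Z (Suc k) \<omega> - \<Delta> k \<omega>))"
      unfolding A_def \<phi>_def using ZK[of "Suc k" \<omega>] Z\<Delta>K[of k \<omega>] by (auto simp: of_bool_def)
    moreover have "Q k i j \<omega> = of_bool (w k \<omega>) * dx j (dx i u) (T - \<tau> k) (Z k \<omega>)" for i j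
      unfolding Q_def q_def using ZK[of k \<omega>] by (auto simp: of_bool_def)
    ultimately show "of_bool (w (Suc k) \<omega>) * (u (T - \<tau> (Suc k)) (Z (Suc k) \<omega>) - u (T - \<tau> k) (Z (Suc k) \<omega> - \<Delta> k \<omega>))
      + 1/2 * (\<tau> (Suc k) - \<tau> k) * (of_bool (w k \<omega>) *
          (\<Sum>i\<in>UNIV. \<Sum>j\<in>UNIV. \<Sum>l\<in>UNIV. dx j (dx i u) (T - \<tau> k) (Z k \<omega>) * \<xi> k i l \<omega> * \<xi> k j l \<omega>)) =
      A k \<omega> + 1/2 * (\<tau> (Suc k) - \<tau> k) * (\<Sum>i\<in>UNIV. \<Sum>j\<in>UNIV. \<Sum>l\<in>UNIV. Q k i j \<omega> * \<xi> k i l \<omega> * \<xi> k j l \<omega>)"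
      by (simp add: sum_distrib_left mult.assoc)
  qed
  show "S \<in> borel_measurable M"
  proof -
    have "(\<lambda>\<omega>. \<Sum>k<N. A k \<omega> + 1/2 * (\<tau> (Suc k) - \<tau> k) *
            (\<Sum>i\<in>UNIV. \<Sum>j\<in>UNIV. \<Sum>l\<in>UNIV. Q k i j \<omega> * \<xi> k i l \<omega> * \<xi> k j l \<omega>)) \<in> borel_measurable M"
      using mA toM[OF mQ] toM[OF m\<xi>]
      by (intro borel_measurable_sum borel_measurable_add borel_measurable_times borel_measurable_const) auto
    then show ?thesis by (subst measurable_cong[OF S_eq])
  qed
  show "\<bar>S \<omega>\<bar> \<le> B * T1 + n * B * N0 + n * B * N0" if \<omega>: "\<omega> \<in> space M" for \<omega>
  proof -
    have Ak: "\<bar>A k \<omega>\<bar> \<le> B * (\<tau> (Suc k) - \<tau> k) + n * B * (of_bool (w (Suc k) \<omega>) * norm (\<Delta> k \<omega>))" if k: "k < N" for k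
    proof (cases "w (Suc k) \<omega>")
      case True
      have less: "\<tau> k < \<tau> (Suc k)" using \<tau>(3)[OF k] .
      have le: "T - T1 \<le> T - \<tau> (Suc k)" "T - \<tau> (Suc k) \<le> T - \<tau> k" using range[of "Suc k"] k less by auto
      have "0 < T - T1" using T by simp
      from C12_increment[OF u this K(1,2) \<O> Zb[OF True] \<Delta>r[OF True] le]
      obtain c x where c: "c \<in> {T - \<tau> (Suc k)..T - \<tau> k}" and x: "x \<in> K"
        and incr: "u (T - \<tau> (Suc k)) (Z (Suc k) \<omega>) - u (T - \<tau> k) (Z (Suc k) \<omega> - \<Delta> k \<omega>) =
          - (T - \<tau> k - (T - \<tau> (Suc k))) * dt u c (Z (Suc k) \<omega>) + (\<Sum>i\<in>UNIV. dx i u (T - \<tau> k) x * \<Delta> k \<omega> $ i)"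
        by blast
      have cT: "c \<in> {T-T1..T}" using c le range[of k] k by auto
      have "\<bar>\<Sum>i\<in>UNIV. dx i u (T - \<tau> k) x * \<Delta> k \<omega> $ i\<bar> \<le> (\<Sum>i\<in>(UNIV::'n set). B * norm (\<Delta> k \<omega>))"
        using bound[OF times(1)[of k] x] k B0
        by (intro order_trans[OF sum_abs sum_mono]) (auto simp: abs_mult intro!: mult_mono component_le_norm_cart)
      then have 1: "\<bar>\<Sum>i\<in>UNIV. dx i u (T - \<tau> k) x * \<Delta> k \<omega> $ i\<bar> \<le> n * B * norm (\<Delta> k \<omega>)" by (simp add: n_def)
      have 2: "\<bar>- (T - \<tau> k - (T - \<tau> (Suc k))) * dt u c (Z (Suc k) \<omega>)\<bar> \<le> B * (\<tau> (Suc k) - \<tau> k)"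
        using bound[OF cT ZK[OF True]] less by (simp add: abs_mult mult.commute mult_right_mono)
      have "A k \<omega> = u (T - \<tau> (Suc k)) (Z (Suc k) \<omega>) - u (T - \<tau> k) (Z (Suc k) \<omega> - \<Delta> k \<omega>)"
        unfolding A_def \<phi>_def using ZK[OF True] Z\<Delta>K[OF True] True by simp
      then have "\<bar>A k \<omega>\<bar> \<le> B * (\<tau> (Suc k) - \<tau> k) + n * B * norm (\<Delta> k \<omega>)"
        unfolding incr using 1 2 by linarith
      then show ?thesis using True by simp
    next
      case False
      then show ?thesis using B0 \<tau>(3)[OF k] by (simp add: A_def)
    qed
    have Qk: "\<bar>1/2 * (\<tau> (Suc k) - \<tau> k) * (\<Sum>i\<in>UNIV. \<Sum>j\<in>UNIV. \<Sum>l\<in>UNIV. Q k i j \<omega> * \<xi> k i l \<omega> * \<xi> k j l \<omega>)\<bar>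
      \<le> n * B * (of_bool (w k \<omega>) * ((\<tau> (Suc k) - \<tau> k) * frob (\<lambda>i l. \<xi> k i l \<omega>)))" if k: "k < N" for k
    proof -
      have less: "\<tau> k < \<tau> (Suc k)" using \<tau>(3)[OF k] .
      have "\<bar>\<Sum>i\<in>UNIV. \<Sum>j\<in>UNIV. \<Sum>l\<in>UNIV. Q k i j \<omega> * \<xi> k i l \<omega> * \<xi> k j l \<omega>\<bar>
        \<le> (\<Sum>i\<in>UNIV. \<Sum>j\<in>UNIV. \<Sum>l\<in>UNIV. (of_bool (w k \<omega>) * B) * \<bar>\<xi> k i l \<omega> * \<xi> k j l \<omega>\<bar>)"
      proof (rule order_trans[OF sum_abs sum_mono], rule order_trans[OF sum_abs sum_mono], rule order_trans[OF sum_abs sum_mono])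
        fix i j l
        have "\<bar>Q k i j \<omega>\<bar> \<le> of_bool (w k \<omega>) * B"
          using b\<phi>(4)[OF times(1)[of k]] k by (auto simp: Q_def of_bool_def)
        then have "\<bar>Q k i j \<omega>\<bar> * \<bar>\<xi> k i l \<omega> * \<xi> k j l \<omega>\<bar> \<le> (of_bool (w k \<omega>) * B) * \<bar>\<xi> k i l \<omega> * \<xi> k j l \<omega>\<bar>"
          by (rule mult_right_mono) simp
        then show "\<bar>Q k i j \<omega> * \<xi> k i l \<omega> * \<xi> k j l \<omega>\<bar> \<le> (of_bool (w k \<omega>) * B) * \<bar>\<xi> k i l \<omega> * \<xi> k j l \<omega>\<bar>"
          by (simp only: abs_mult mult.assoc)
      qed
      also have "\<dots> = (of_bool (w k \<omega>) * B) * (\<Sum>i\<in>UNIV. \<Sum>j\<in>UNIV. \<Sum>l\<in>UNIV. \<bar>\<xi> k i l \<omega> * \<xi> k j l \<omega>\<bar>)"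
        by (simp only: sum_distrib_left)
      also have "\<dots> \<le> (of_bool (w k \<omega>) * B) * (2 * n * frob (\<lambda>i l. \<xi> k i l \<omega>))"
        unfolding n_def using sum_abs_products_le[of "\<lambda>i l. \<xi> k i l \<omega>"] B0 by (intro mult_left_mono) auto
      finally have "1/2 * (\<tau> (Suc k) - \<tau> k) * \<bar>\<Sum>i\<in>UNIV. \<Sum>j\<in>UNIV. \<Sum>l\<in>UNIV. Q k i j \<omega> * \<xi> k i l \<omega> * \<xi> k j l \<omega>\<bar>
         \<le> 1/2 * (\<tau> (Suc k) - \<tau> k) * ((of_bool (w k \<omega>) * B) * (2 * n * frob (\<lambda>i l. \<xi> k i l \<omega>)))"
        using less by (intro mult_left_mono) auto
      also have "\<dots> = n * B * (of_bool (w k \<omega>) * ((\<tau> (Suc k) - \<tau> k) * frob (\<lambda>i l. \<xi> k i l \<omega>)))" by simp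
      finally show ?thesis using less by (simp add: abs_mult)
    qed
    have s1: "(\<Sum>k<N. of_bool (w (Suc k) \<omega>) * norm (\<Delta> k \<omega>)) \<le> N0"
    proof (rule stopped_sum_le)
      show "(\<Sum>j\<le>k. norm (\<Delta> j \<omega>)) \<le> N0" if "w (Suc k) \<omega>" for k
        using that unfolding w_def by (simp add: lessThan_Suc_atMost)
    qed (use w_prev N0 in auto)
    have s2: "(\<Sum>k<N. of_bool (w k \<omega>) * ((\<tau> (Suc k) - \<tau> k) * frob (\<lambda>i l. \<xi> k i l \<omega>))) \<le> N0"
    proof (rule stopped_sum_le)
      show "(\<Sum>j\<le>k. (\<tau> (Suc j) - \<tau> j) * frob (\<lambda>i l. \<xi> j i l \<omega>)) \<le> N0" if "k < N" "w k \<omega>" for k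
      proof -
        have "{..k} \<inter> {..<N} = {..k}" using that by auto
        then show ?thesis using that unfolding w_def by simp
      qed
      show "0 \<le> (\<tau> (Suc k) - \<tau> k) * frob (\<lambda>i l. \<xi> k i l \<omega>)" if "k < N" for k
        using \<tau>(3)[OF that] frob_nonneg by (intro mult_nonneg_nonneg) auto
    qed (use w_prev N0 in auto)
    have "\<bar>S \<omega>\<bar> \<le> (\<Sum>k<N. B * (\<tau> (Suc k) - \<tau> k) + n * B * (of_bool (w (Suc k) \<omega>) * norm (\<Delta> k \<omega>))
        + n * B * (of_bool (w k \<omega>) * ((\<tau> (Suc k) - \<tau> k) * frob (\<lambda>i l. \<xi> k i l \<omega>))))"
      unfolding S_eq
      by (rule order_trans[OF sum_abs sum_mono], rule order_trans[OF abs_triangle_ineq add_mono]) (use Ak Qk in auto)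
    also have "\<dots> = B * (\<Sum>k<N. \<tau> (Suc k) - \<tau> k) + n * B * (\<Sum>k<N. of_bool (w (Suc k) \<omega>) * norm (\<Delta> k \<omega>))
        + n * B * (\<Sum>k<N. of_bool (w k \<omega>) * ((\<tau> (Suc k) - \<tau> k) * frob (\<lambda>i l. \<xi> k i l \<omega>)))"
      by (simp only: sum.distrib sum_distrib_left)
    also have "(\<Sum>k<N. \<tau> (Suc k) - \<tau> k) = T1"
      by (subst sum_lessThan_telescope) (simp add: \<tau>)
    also have "B * T1 + n * B * (\<Sum>k<N. of_bool (w (Suc k) \<omega>) * norm (\<Delta> k \<omega>))
        + n * B * (\<Sum>k<N. of_bool (w k \<omega>) * ((\<tau> (Suc k) - \<tau> k) * frob (\<lambda>i l. \<xi> k i l \<omega>)))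
        \<le> B * T1 + n * B * N0 + n * B * N0"
      using s1 s2 n B0 by (intro add_mono mult_left_mono order_refl) auto
    finally show ?thesis .
  qed
  show "(\<lambda>\<omega>. of_bool (w N \<omega>) * (indicator K (Z N \<omega>) * u (T - T1) (Z N \<omega>))) \<in> borel_measurable M"
    using toM[OF m\<Phi>[of N]] unfolding \<Phi>_def \<phi>_def \<tau>(2) by simp
  have "(\<integral>\<omega>. \<Phi> N \<omega> \<partial>M) \<le> (\<integral>\<omega>. \<Phi> 0 \<omega> \<partial>M)
      + (\<integral>\<omega>. (\<Sum>k<N. A k \<omega> + 1/2 * (\<tau> (Suc k) - \<tau> k) *
            (\<Sum>i\<in>UNIV. \<Sum>j\<in>UNIV. \<Sum>l\<in>UNIV. Q k i j \<omega> * \<xi> k i l \<omega> * \<xi> k j l \<omega>)) \<partial>M)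
      + (e * (n ^ 5 * X\<^sup>2) + C * (3 * n ^ 10 * X ^ 4) * \<delta>) * \<tau> N"
    unfolding n_def
  proof (rule discrete_supermartingale_bound[where P=R and Y=Y and B=B])
    show "\<bar>R k i \<omega>\<bar> \<le> B" if "k < N" for k i \<omega>
      using b\<phi>(3)[OF times(1)[of k]] that B0 by (auto simp: R_def of_bool_def)
    show "\<bar>Q k i j \<omega>\<bar> \<le> B" if "k < N" for k i j \<omega>
      using b\<phi>(4)[OF times(1)[of k]] that B0 by (auto simp: Q_def of_bool_def)
    show "Y k \<omega> - \<Phi> k \<omega> \<le> (\<Sum>i\<in>UNIV. R k i \<omega> * (\<chi> i. \<Sum>l\<in>UNIV. \<xi> k i l \<omega> * (W (\<tau> (Suc k)) \<omega> - W (\<tau> k) \<omega>) $ l) $ i) +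
      1/2 * (\<Sum>i\<in>UNIV. \<Sum>j\<in>UNIV. Q k i j \<omega> * (\<chi> i. \<Sum>l\<in>UNIV. \<xi> k i l \<omega> * (W (\<tau> (Suc k)) \<omega> - W (\<tau> k) \<omega>) $ l) $ i *
         (\<chi> i. \<Sum>l\<in>UNIV. \<xi> k i l \<omega> * (W (\<tau> (Suc k)) \<omega> - W (\<tau> k) \<omega>) $ l) $ j) +
      e * (norm (\<chi> i. \<Sum>l\<in>UNIV. \<xi> k i l \<omega> * (W (\<tau> (Suc k)) \<omega> - W (\<tau> k) \<omega>) $ l))\<^sup>2 +
      C * norm (\<chi> i. \<Sum>l\<in>UNIV. \<xi> k i l \<omega> * (W (\<tau> (Suc k)) \<omega> - W (\<tau> k) \<omega>) $ l) ^ 4" if k: "k < N" for k \<omega>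
      unfolding v_def[symmetric]
    proof (cases "w k \<omega>")
      case True
      have "T - \<tau> k \<in> {T-T1..T}" using times(1)[of k] k by simp
      from taylor[OF this Zb[OF True], of "v k \<omega>"] show "Y k \<omega> - \<Phi> k \<omega> \<le> (\<Sum>i\<in>UNIV. R k i \<omega> * v k \<omega> $ i) +
      1/2 * (\<Sum>i\<in>UNIV. \<Sum>j\<in>UNIV. Q k i j \<omega> * v k \<omega> $ i * v k \<omega> $ j) + e * (norm (v k \<omega>))\<^sup>2 + C * norm (v k \<omega>) ^ 4"
        using True ZK[OF True] by (simp add: Y_def \<Phi>_def R_def Q_def p_def q_def \<phi>_def)
    next
      case False
      then show "Y k \<omega> - \<Phi> k \<omega> \<le> (\<Sum>i\<in>UNIV. R k i \<omega> * v k \<omega> $ i) +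
      1/2 * (\<Sum>i\<in>UNIV. \<Sum>j\<in>UNIV. Q k i j \<omega> * v k \<omega> $ i * v k \<omega> $ j) + e * (norm (v k \<omega>))\<^sup>2 + C * norm (v k \<omega>) ^ 4"
        using eC by (simp add: Y_def \<Phi>_def R_def Q_def)
    qed
    show "\<Phi> (Suc k) \<omega> \<le> A k \<omega> + Y k \<omega>" if k: "k < N" for k \<omega>
    proof (cases "w (Suc k) \<omega>")
      case True
      then show ?thesis using w_prev[OF True k] by (simp add: \<Phi>_def A_def Y_def Zv[OF k])
    next
      case False
      then show ?thesis using b\<phi>(1)[OF times(1)[of k]] k by (simp add: \<Phi>_def A_def Y_def)
    qed
    show "\<bar>\<xi> k i l \<omega>\<bar> \<le> X" if "\<omega> \<in> space M" for k i l \<omega>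
      using L(2)[OF that] by (simp add: \<xi>_def)
  qed (use \<tau> mR mQ m\<xi> eC int\<Phi> intA intY in auto)
  then show "(\<integral>\<omega>. of_bool (w N \<omega>) * (indicator K (Z N \<omega>) * u (T - T1) (Z N \<omega>)) \<partial>M)
      \<le> (\<integral>\<omega>. of_bool (w 0 \<omega>) * (indicator K (Z 0 \<omega>) * u T (Z 0 \<omega>)) \<partial>M) + (\<integral>\<omega>. S \<omega> \<partial>M)
        + (e * (n ^ 5 * X\<^sup>2) + C * (3 * n ^ 10 * X ^ 4) * \<delta>) * T1"
    unfolding S_eq \<Phi>_def \<phi>_def \<tau>(1,2) by simp
qed

end

section \<open>Exploding paths\<close>

lemma space_state_algebra: "space (state_algebra \<O>) = insert None (Some ` \<O>)"
  by (simp add: state_algebra_def space_measure_of_conv)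

lemma openin_state_algebra:
  assumes "openin (Alexandroff_compactification (top_of_set \<O>)) V"
  shows "V \<in> sets (state_algebra \<O>)"
proof -
  let ?A = "Alexandroff_compactification (top_of_set \<O>)"
  have "U \<subseteq> insert None (Some ` \<O>)" if "openin ?A U" for U
    using openin_subset[OF that] by simp
  then have "Collect (openin ?A) \<subseteq> Pow (insert None (Some ` \<O>))" by blast
  then show ?thesis
    unfolding state_algebra_def by (subst sets_measure_of) (auto intro: sigma_sets.Basic assms)
qed

lemma openin_Some_image:
  assumes "open U" "U \<subseteq> \<O>"
  shows "openin (Alexandroff_compactification (top_of_set \<O>)) (Some ` U)"
  using assms by (simp add: open_subset)

lemma closedin_Some_image:
  fixes C :: "'a::t2_space set"
  assumes "compact C" "C \<subseteq> \<O>"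
  shows "closedin (Alexandroff_compactification (top_of_set \<O>)) (Some ` C)"
  using assms by (auto simp: compactin_subtopology intro!: closed_subset compact_imp_closed)

text \<open>The complement of a compact set is a neighbourhood of the cemetery, hence open in the
  compactification.\<close>

lemma Some_compact_state_algebra:
  fixes C :: "'a::t2_space set"
  assumes "compact C" "C \<subseteq> \<O>"
  shows "Some ` C \<in> sets (state_algebra \<O>)"
proof -
  let ?A = "Alexandroff_compactification (top_of_set \<O>)"
  have "topspace ?A - Some ` C \<in> sets (state_algebra \<O>)"
    using closedin_Some_image[OF assms] by (intro openin_state_algebra) (simp add: closedin_def)
  from sets.compl_sets[OF this] have "space (state_algebra \<O>) - (topspace ?A - Some ` C) \<in> sets (state_algebra \<O>)" .
  moreover have "space (state_algebra \<O>) - (topspace ?A - Some ` C) = Some ` C"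
    using assms by (auto simp: space_state_algebra)
  ultimately show ?thesis by simp
qed

lemma state_vector_measurable:
  fixes \<O> :: "(real^'n) set"
  assumes "open \<O>"
  shows "state_vector \<in> state_algebra \<O> \<rightarrow>\<^sub>M borel"
proof (rule borel_measurableI)
  fix U :: "(real^'n) set" assume U: "open U"
  have 1: "Some ` (U \<inter> \<O>) \<in> sets (state_algebra \<O>)"
    using U assms by (intro openin_state_algebra openin_Some_image) auto
  have "Some ` \<O> \<in> sets (state_algebra \<O>)"
    using assms by (intro openin_state_algebra openin_Some_image) auto
  from sets.compl_sets[OF this] have 2: "{None} \<in> sets (state_algebra \<O>)"
    by (auto simp: space_state_algebra insert_Diff_if)
  have "state_vector -` U \<inter> space (state_algebra \<O>) = Some ` (U \<inter> \<O>) \<union> (if 0 \<in> U then {None} else {})"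
    by (auto simp: space_state_algebra state_vector_def)
  then show "state_vector -` U \<inter> space (state_algebra \<O>) \<in> sets (state_algebra \<O>)"
    using sets.Un[OF 1 2] 1 by (auto simp del: Un_insert_right)
qed

lemma explosive_path_preimage_closed:
  fixes \<O> :: "'a::t2_space set"
  assumes "w \<in> explosive_paths \<O>" "compact C" "C \<subseteq> \<O>"
  shows "closed {s\<in>{0..}. w s \<in> Some ` C}"
proof -
  have "continuous_map (top_of_set {0..}) (Alexandroff_compactification (top_of_set \<O>)) w"
    using assms by (simp add: explosive_paths_def)
  from closedin_continuous_map_preimage[OF this closedin_Some_image[OF assms(2,3)]]
  have "closedin (top_of_set {0..}) {s\<in>{0..}. w s \<in> Some ` C}" by simp
  then show ?thesis by (rule closedin_closed_trans) simp
qed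

lemma explosive_path_preimage_open:
  assumes "w \<in> explosive_paths \<O>" "open D" "D \<subseteq> \<O>"
  shows "openin (top_of_set {0..}) {s\<in>{0..}. w s \<in> Some ` D}"
proof -
  have "continuous_map (top_of_set {0..}) (Alexandroff_compactification (top_of_set \<O>)) w"
    using assms by (simp add: explosive_paths_def)
  from openin_continuous_map_preimage[OF this openin_Some_image[OF assms(2,3)]]
  show ?thesis by simp
qed

lemma exit_time_nonneg: "0 \<le> exit_time D w"
  unfolding exit_time_def by (rule Inf_greatest) auto

lemma less_exit_time:
  assumes "0 \<le> s" "ereal s < exit_time D w"
  shows "w s \<in> Some ` D"
proof (rule ccontr)
  assume "w s \<notin> Some ` D"
  then have "exit_time D w \<le> ereal s"
    unfolding exit_time_def using assms(1) by (intro Inf_lower) auto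
  with assms(2) show False by simp
qed

text \<open>The image of an open set is open in the compactification, so by continuity a path inside
  it at time \<open>\<rho>\<close> stays inside a little longer, and \<open>\<rho>\<close> could not
  be the infimum.\<close>

lemma exit_time_attained:
  assumes w: "w \<in> explosive_paths \<O>" "open D" "D \<subseteq> \<O>" and \<rho>: "exit_time D w = ereal \<rho>"
  shows "0 \<le> \<rho>" "w \<rho> \<notin> Some ` D"
proof -
  show 0: "0 \<le> \<rho>" using exit_time_nonneg[of D w] \<rho> by simp
  show "w \<rho> \<notin> Some ` D"
  proof
    assume "w \<rho> \<in> Some ` D"
    then have "\<rho> \<in> {s\<in>{0..}. w s \<in> Some ` D}" using 0 by simp
    with explosive_path_preimage_open[OF w] obtain e where e: "0 < e"
      and sub: "\<And>s. 0 \<le> s \<Longrightarrow> dist s \<rho> < e \<Longrightarrow> w s \<in> Some ` D"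
      unfolding openin_euclidean_subtopology_iff by blast
    have "ereal (\<rho> + e) \<le> exit_time D w"
      unfolding exit_time_def
    proof (rule Inf_greatest, clarify)
      fix t assume t: "0 \<le> t" "w t \<notin> Some ` D"
      have "\<rho> \<le> t"
      proof (rule ccontr)
        assume "\<not> \<rho> \<le> t"
        then have "ereal t < exit_time D w" using \<rho> by simp
        with less_exit_time t show False by blast
      qed
      moreover have "\<not> dist t \<rho> < e" using sub[OF t(1)] t(2) by blast
      ultimately show "ereal (\<rho> + e) \<le> ereal t" by (simp add: dist_real_def)
    qed
    then show False using \<rho> e by simp
  qed
qed

text \<open>Before the explosion the image of \<open>{0..T}\<close> is compact and avoids the
  cemetery; the interiors of the exhausting sets cover it, and an increasing finite subcover reduces
  to one of them.\<close>

lemma explosive_path_compact: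
  fixes \<O> :: "'a::euclidean_space set"
  assumes w: "w \<in> explosive_paths \<O>" and T: "0 \<le> T" "ereal T < exit_time \<O> w"
    and C: "\<And>n. C n \<subseteq> interior (C (Suc n))" "\<Union>(range C) = \<O>"
  shows "\<exists>n::nat. \<forall>s\<in>{0..T}. w s \<in> Some ` C n"
proof -
  let ?A = "Alexandroff_compactification (top_of_set \<O>)"
  have cont: "continuous_map (top_of_set {0..}) ?A w" using w by (simp add: explosive_paths_def)
  have "compactin (top_of_set {0..}) {0..T}" by (simp add: compactin_subtopology)
  from image_compactin[OF this cont] have comp: "compactin ?A (w ` {0..T})" .
  have sub: "C n \<subseteq> \<O>" for n using C(2) by blast
  have "\<forall>V\<in>range (\<lambda>n. Some ` interior (C n)). openin ?A V"
    using interior_subset[of "C _"] sub by (auto intro!: open_subset)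
  moreover have "w ` {0..T} \<subseteq> \<Union>(range (\<lambda>n. Some ` interior (C n)))"
  proof clarify
    fix s assume s: "s \<in> {0..T}"
    have "ereal s < exit_time \<O> w" using s T(2) by (intro le_less_trans[of "ereal s" "ereal T"]) auto
    from less_exit_time[OF _ this] s obtain z where "w s = Some z" "z \<in> \<O>" by auto
    moreover from this obtain n where "z \<in> C n" using C(2) by blast
    ultimately show "w s \<in> \<Union>(range (\<lambda>n. Some ` interior (C n)))" using C(1)[of n] by auto
  qed
  ultimately obtain \<F> where F: "finite \<F>" "\<F> \<subseteq> range (\<lambda>n. Some ` interior (C n))" "w ` {0..T} \<subseteq> \<Union>\<F>"
    using comp unfolding compactin_def by meson
  then obtain J where J: "finite J" "\<F> = (\<lambda>n. Some ` interior (C n)) ` J"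
    using finite_subset_image by metis
  obtain m where m: "\<And>j. j \<in> J \<Longrightarrow> j \<le> m" using J(1) finite_nat_set_iff_bounded_le by auto
  have mono: "C j \<subseteq> C m" if "j \<le> m" for j m
    using that
  proof (induction rule: inc_induct)
    case (step k) then show ?case using C(1)[of k] interior_subset by blast
  qed simp
  have "w s \<in> Some ` C m" if s: "s \<in> {0..T}" for s
  proof -
    obtain j where "j \<in> J" "w s \<in> Some ` interior (C j)" using F(3) J(2) imageI[OF s, of w] by blast
    then show ?thesis using mono[OF m, of j] interior_subset[of "C j"] by blast
  qed
  then show ?thesis by blast
qed

text \<open>\<open>Z\<close> may lie \<open>r\<close> away from a point of \<open>K0\<close>, and
  the ball of radius \<open>r\<close> around \<open>Z\<close> must still be in \<open>K\<close> for
  the Taylor and drift estimates, hence \<open>2 * r\<close>. The balls of radius \<open>r\<close>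
  in \<open>D\<close> ensure that leaving \<open>D\<close> means moving \<open>r\<close> away from
  \<open>K0\<close>. The closure of \<open>D\<close> has to fit into \<open>K\<close> because the
  path is followed up to and including its exit from \<open>D\<close>.\<close>

lemma compact_neighbourhood:
  fixes \<O> K0 :: "(real^'n) set"
  assumes "open \<O>" "compact K0" "K0 \<subseteq> \<O>"
  obtains r K D where "0 < r" "compact K" "K \<subseteq> \<O>" "\<And>z. z \<in> K0 \<Longrightarrow> cball z (2 * r) \<subseteq> K"
    "open D" "closure D \<subseteq> K" "\<And>z. z \<in> K0 \<Longrightarrow> ball z r \<subseteq> D"
proof -
  obtain e where e: "0 < e" "(\<Union>x\<in>K0. cball x e) \<subseteq> \<O>"
    using compact_subset_open_imp_cball_epsilon_subset[OF assms(2,1,3)] by blast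
  define r where "r = e / 2"
  have *: "(\<Union>x\<in>K0. cball x s) = (\<Union>x\<in>K0. \<Union>y\<in>cball 0 s. {x + y})" for s :: real
  proof -
    have "\<exists>y\<in>cball 0 s. p = x + y" if "p \<in> cball x s" for p x :: "real^'n"
      using that by (intro bexI[of _ "p - x"]) (auto simp: dist_norm norm_minus_commute)
    moreover have "x + y \<in> cball x s" if "y \<in> cball 0 s" for x y :: "real^'n"
      using that by (simp add: dist_norm)
    ultimately show ?thesis by blast
  qed
  have comp: "compact (\<Union>x\<in>K0. cball x s)" for s
    unfolding * by (rule compact_sums') (use assms in auto)
  show ?thesis
  proof
    show "0 < r" using e by (simp add: r_def)
    show "compact (\<Union>x\<in>K0. cball x (2 * r))" by (rule comp)
    show "(\<Union>x\<in>K0. cball x (2 * r)) \<subseteq> \<O>" using e by (simp add: r_def)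
    show "cball z (2 * r) \<subseteq> (\<Union>x\<in>K0. cball x (2 * r))" if "z \<in> K0" for z using that by blast
    show "open (\<Union>x\<in>K0. ball x r)" by auto
    show "ball z r \<subseteq> (\<Union>x\<in>K0. ball x r)" if "z \<in> K0" for z using that by blast
    have "(\<Union>x\<in>K0. ball x r) \<subseteq> (\<Union>x\<in>K0. cball x (2 * r))" using \<open>0 < r\<close> by fastforce
    then show "closure (\<Union>x\<in>K0. ball x r) \<subseteq> (\<Union>x\<in>K0. cball x (2 * r))"
      by (rule closure_minimal) (rule compact_imp_closed[OF comp])
  qed
qed

lemma set_integrable_square:
  fixes f :: "real \<Rightarrow> real"
  assumes "(\<lambda>s. indicator A s * f s) \<in> borel_measurable lborel"
    and "(\<integral>\<^sup>+s\<in>A. ennreal ((f s)\<^sup>2) \<partial>lborel) \<le> ennreal c" "0 \<le> c"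
  shows "set_integrable lborel A (\<lambda>s. (f s)\<^sup>2)" "(LINT s:A|lborel. (f s)\<^sup>2) \<le> c"
proof -
  have m: "(\<lambda>s. indicator A s * (f s)\<^sup>2) \<in> borel_measurable lborel"
  proof -
    have "(\<lambda>s. (indicator A s * f s)\<^sup>2) \<in> borel_measurable lborel" using assms(1) by (rule borel_measurable_power)
    moreover have "(\<lambda>s. (indicator A s * f s)\<^sup>2) = (\<lambda>s. indicator A s * (f s)\<^sup>2)"
      by (auto simp: fun_eq_iff indicator_def)
    ultimately show ?thesis by simp
  qed
  have eq: "(\<integral>\<^sup>+s. ennreal (indicator A s * (f s)\<^sup>2) \<partial>lborel) = (\<integral>\<^sup>+s\<in>A. ennreal ((f s)\<^sup>2) \<partial>lborel)"
    by (rule nn_integral_cong) (auto simp: indicator_def)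
  have i: "integrable lborel (\<lambda>s. indicator A s * (f s)\<^sup>2)"
    by (rule integrableI_nonneg[OF m]) (use assms(2) eq in \<open>auto intro: le_less_trans\<close>)
  then show "set_integrable lborel A (\<lambda>s. (f s)\<^sup>2)" by (simp add: set_integrable_def)
  have "ennreal (LINT s:A|lborel. (f s)\<^sup>2) = (\<integral>\<^sup>+s. ennreal (indicator A s * (f s)\<^sup>2) \<partial>lborel)"
    unfolding set_lebesgue_integral_def using i by (subst nn_integral_eq_integral) auto
  then show "(LINT s:A|lborel. (f s)\<^sup>2) \<le> c"
    using assms(2,3) eq by (metis ennreal_le_iff)
qed

lemma set_integral_frob:
  fixes x :: "real \<Rightarrow> 'n::finite \<Rightarrow> 'n \<Rightarrow> real"
  assumes "\<And>i l. set_integrable lborel A (\<lambda>s. (x s i l)\<^sup>2)"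
  shows "set_integrable lborel A (\<lambda>s. frob (x s))"
    "(LINT s:A|lborel. frob (x s)) = (\<Sum>i\<in>UNIV. \<Sum>l\<in>UNIV. LINT s:A|lborel. (x s i l)\<^sup>2)"
proof -
  have i: "set_integrable lborel A (\<lambda>s. \<Sum>l\<in>UNIV. (x s i l)\<^sup>2)" for i
    by (rule set_integrable_sum_fun) (rule assms)
  show "set_integrable lborel A (\<lambda>s. frob (x s))"
    unfolding frob_def by (rule set_integrable_sum_fun) (rule i)
  show "(LINT s:A|lborel. frob (x s)) = (\<Sum>i\<in>UNIV. \<Sum>l\<in>UNIV. LINT s:A|lborel. (x s i l)\<^sup>2)"
    unfolding frob_def by (subst set_integral_sum_fun[OF i]) (simp add: set_integral_sum_fun[OF assms])
qed

section \<open>Comparison for weak solutions\<close>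

text \<open>One weak solution, stopped at the exit from one \<open>D\<close> and observed up to one
  horizon. The approximations \<open>L\<close> belong to the data because their rate refers to
  \<open>T1\<close>; a single solution gives one instance for each horizon.\<close>

locale stopped_solution = brownian M F W
  for M :: "'w measure" and F :: "real \<Rightarrow> 'w measure" and W :: "real \<Rightarrow> 'w \<Rightarrow> real^'n" +
  fixes \<O> D :: "(real^'n) set" and b :: "real^'n \<Rightarrow> real^'n" and \<sigma> :: "real^'n \<Rightarrow> real^'n^'n" and x0 :: "real^'n"
    and X :: "real \<Rightarrow> 'w \<Rightarrow> (real^'n) option" and T1 :: real
    and I :: "'n \<Rightarrow> 'n \<Rightarrow> real \<Rightarrow> 'w \<Rightarrow> real" and L :: "'n \<Rightarrow> 'n \<Rightarrow> nat \<Rightarrow> 'w elementary"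
    and S :: "'w \<Rightarrow> ereal" and stopped :: "real \<Rightarrow> 'w \<Rightarrow> real" and H :: "'n \<Rightarrow> 'n \<Rightarrow> real \<Rightarrow> 'w \<Rightarrow> real"
  assumes \<O>: "open \<O>" and D: "open D" "D \<subseteq> \<O>" and T1: "0 < T1"
    and S_def: "\<And>\<omega>. S \<omega> = exit_time D (\<lambda>t. X t \<omega>)"
    and stopped_def: "\<And>t \<omega>. stopped t \<omega> = real_of_ereal (min (ereal t) (S \<omega>))"
    and H_def: "\<And>i l s \<omega>. H i l s \<omega> = (if ereal s \<le> S \<omega> then extend_by_zero (\<lambda>y. \<sigma> y $ i $ l) (X s \<omega>) else 0)"
    and X_adapted: "\<And>t. 0 \<le> t \<Longrightarrow> X t \<in> F t \<rightarrow>\<^sub>M state_algebra \<O>"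
    and X_path: "\<And>\<omega>. \<omega> \<in> space M \<Longrightarrow> (\<lambda>t. X t \<omega>) \<in> explosive_paths \<O>"
    and X_0: "AE \<omega> in M. X 0 \<omega> = Some x0"
    and b_int: "AE \<omega> in M. \<forall>t\<ge>0. \<forall>i. set_integrable lborel {0..stopped t \<omega>} (\<lambda>s. extend_by_zero (\<lambda>y. b y $ i) (X s \<omega>))"
    and ito: "\<And>i l. is_ito_integral M F (\<lambda>t \<omega>. W t \<omega> $ l) (H i l) (I i l)"
    and equation: "AE \<omega> in M. \<forall>t\<ge>0. X (stopped t \<omega>) \<omega> = Some (\<chi> i. x0 $ i + (\<Sum>l\<in>UNIV. I i l t \<omega>)
                     + (LINT s:{0..stopped t \<omega>}|lborel. extend_by_zero (\<lambda>y. b y $ i) (X s \<omega>)))"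
    and L: "\<And>i l m. elementary M F (L i l m)"
    and L_lim: "\<And>i l. AE \<omega> in M. \<forall>\<^sub>F m in sequentially.
      ito_close T1 (\<lambda>t \<omega>. W t \<omega> $ l) (H i l) (I i l) (L i l m) m \<omega>"
begin

definition Mm :: "nat \<Rightarrow> real \<Rightarrow> 'w \<Rightarrow> real^'n" where
  "Mm m t \<omega> = (\<chi> i. \<Sum>l\<in>UNIV. elementary_integral (\<lambda>t \<omega>. W t \<omega> $ l) (L i l m) t \<omega>)"

text \<open>\<open>I i l\<close> is only measurable with respect to \<open>M\<close>; the limit of the approximating integrals is a
  version of it that is adapted to \<open>F\<close>.\<close>

definition I' :: "real \<Rightarrow> 'w \<Rightarrow> real^'n" where
  "I' t \<omega> = (\<chi> i. \<Sum>l\<in>UNIV. lim (\<lambda>m. elementary_integral (\<lambda>t \<omega>. W t \<omega> $ l) (L i l m) t \<omega>))"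

definition \<rho> :: "'w \<Rightarrow> real" where
  "\<rho> \<omega> = real_of_ereal (min (ereal T1) (S \<omega>))"

text \<open>Cutting the drift off after the exit makes it integrable over the whole of
  \<open>{0..T1}\<close>, although nothing is known about it beyond the exit time.\<close>

definition \<beta> :: "'w \<Rightarrow> real \<Rightarrow> 'n \<Rightarrow> real" where
  "\<beta> \<omega> s i = (if ereal s \<le> S \<omega> then extend_by_zero (\<lambda>y. b y $ i) (X s \<omega>) else 0)"

abbreviation V :: "real \<Rightarrow> 'w \<Rightarrow> real^'n" where
  "V t \<omega> \<equiv> state_vector (X t \<omega>)"

lemma \<rho>: "ereal (\<rho> \<omega>) = min (ereal T1) (S \<omega>)" "0 \<le> \<rho> \<omega>" "\<rho> \<omega> \<le> T1" "ereal (\<rho> \<omega>) \<le> S \<omega>"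
proof -
  have S0: "0 \<le> S \<omega>" by (simp add: S_def exit_time_nonneg)
  show eq: "ereal (\<rho> \<omega>) = min (ereal T1) (S \<omega>)"
    unfolding \<rho>_def using S0 by (cases "S \<omega>") (auto simp: min_def)
  have "ereal 0 \<le> ereal (\<rho> \<omega>)" unfolding eq using S0 T1 by (simp add: zero_ereal_def[symmetric])
  then show "0 \<le> \<rho> \<omega>" by simp
  have "ereal (\<rho> \<omega>) \<le> ereal T1" "ereal (\<rho> \<omega>) \<le> S \<omega>" unfolding eq by auto
  then show "\<rho> \<omega> \<le> T1" "ereal (\<rho> \<omega>) \<le> S \<omega>" by auto
qed

lemma le_S_iff: "s \<le> T1 \<Longrightarrow> ereal s \<le> S \<omega> \<longleftrightarrow> s \<le> \<rho> \<omega>"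
proof -
  assume "s \<le> T1"
  then have "ereal s \<le> S \<omega> \<longleftrightarrow> ereal s \<le> ereal (\<rho> \<omega>)" unfolding \<rho>(1) by auto
  then show ?thesis by simp
qed

lemma stopped_eq: "0 \<le> s \<Longrightarrow> s \<le> \<rho> \<omega> \<Longrightarrow> stopped s \<omega> = s"
proof -
  assume "s \<le> \<rho> \<omega>"
  then have "ereal s \<le> S \<omega>" using \<rho>(4)[of \<omega>] order_trans[of "ereal s" "ereal (\<rho> \<omega>)" "S \<omega>"] by simp
  then show ?thesis by (simp add: stopped_def min_absorb1)
qed

lemma stopped_T1: "stopped T1 \<omega> = \<rho> \<omega>"
  by (simp add: stopped_def \<rho>_def)

lemma V_measurable: "0 \<le> t \<Longrightarrow> V t \<in> borel_measurable (F t)"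
  using measurable_compose[OF X_adapted state_vector_measurable[OF \<O>]] .

lemma W_component: "0 \<le> t \<Longrightarrow> (\<lambda>\<omega>. W t \<omega> $ l) \<in> borel_measurable (F t)"
  using measurable_compose[OF W_F, of t "\<lambda>x. x $ l" borel] by simp

lemma I'_measurable: "0 \<le> t \<Longrightarrow> I' t \<in> borel_measurable (F t)"
  unfolding I'_def
  by (intro borel_measurable_vec_lambda borel_measurable_sum borel_measurable_lim_metric
      elementary_integral_measurable L W_component)

text \<open>Only finitely many almost sure statements enter, so a single null set serves all times,
  components and approximations, and what follows can be argued path by path. The last inequality is
  the supersolution inequality at time \<open>T - s\<close>, where reversed time produces the minus
  sign.\<close>

lemma ae_pathwise:
  fixes N :: "nat \<Rightarrow> nat" and \<tau> :: "nat \<Rightarrow> nat \<Rightarrow> real"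
  assumes K0: "\<And>z. z \<in> K0 \<Longrightarrow> ball z r \<subseteq> D" and r: "0 < r" and K: "closure D \<subseteq> K" "K \<subseteq> \<O>" and x0: "x0 \<in> D"
    and T: "T1 < T" and super: "classical_supersolution \<O> b \<sigma> u"
    and grid: "\<And>m. \<tau> m 0 = 0" "\<And>m. \<tau> m (N m) = T1" "\<And>m k. k < N m \<Longrightarrow> \<tau> m k < \<tau> m (Suc k)"
      "\<And>m k. k < N m \<Longrightarrow> \<tau> m (Suc k) - \<tau> m k \<le> (1/2)^m"
      "\<And>m p k i l. p \<in> endpoints (L i l m) \<Longrightarrow> k < N m \<Longrightarrow> p \<le> \<tau> m k \<or> \<tau> m (Suc k) \<le> p"
  shows "AE \<omega> in M. X 0 \<omega> = Some x0 \<and> I' 0 \<omega> = 0 \<and>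
    approximated_path (\<lambda>t. X t \<omega>) (\<lambda>t. V t \<omega>) (\<lambda>t. I' t \<omega>) x0 (\<beta> \<omega>) (\<lambda>s i l. H i l s \<omega>) (\<rho> \<omega>) T1 r K0 N \<tau>
      (\<lambda>m k i l. elementary_process (L i l m) (\<tau> m (Suc k)) \<omega>) (\<lambda>m s i l. elementary_process (L i l m) s \<omega>) (\<lambda>m t. Mm m t \<omega>) \<and>
    (\<forall>s. 0 \<le> s \<longrightarrow> s \<le> \<rho> \<omega> \<longrightarrow> V s \<omega> \<in> K \<and> - dt u (T - s) (V s \<omega>) + (\<Sum>i\<in>UNIV. dx i u (T - s) (V s \<omega>) * \<beta> \<omega> s i)
        + 1/2 * (\<Sum>i\<in>UNIV. \<Sum>j\<in>UNIV. \<Sum>l\<in>UNIV. dx j (dx i u) (T - s) (V s \<omega>) * H i l s \<omega> * H j l s \<omega>) \<le> 0)"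
proof -
  have L_all: "AE \<omega> in M. \<forall>i\<in>UNIV. \<forall>l\<in>UNIV. \<forall>\<^sub>F m in sequentially.
      ito_close T1 (\<lambda>t \<omega>. W t \<omega> $ l) (H i l) (I i l) (L i l m) m \<omega>"
    by (intro AE_finite_allI L_lim) auto
  have H_all: "AE \<omega> in M. \<forall>i\<in>UNIV. \<forall>l\<in>UNIV. \<forall>T\<ge>0. (\<integral>\<^sup>+s\<in>{0..T}. ennreal ((H i l s \<omega>)\<^sup>2) \<partial>lborel) < \<infinity>"
    using ito unfolding is_ito_integral_def by (intro AE_finite_allI) auto
  have H_prog: "progressive F (H i l)" for i l
    using ito[of l i] unfolding is_ito_integral_def by blast
  have I_cont: "continuous_on {0..} (\<lambda>t. I i l t \<omega>)" if "\<omega> \<in> space M" for i l \<omega>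
    using ito[of l i] that unfolding is_ito_integral_def by blast
  define n where "n = real CARD('n)"
  have half: "(\<lambda>m. (1/2::real)^m) \<longlonglongrightarrow> 0" by (rule LIMSEQ_power_zero) simp
  have half': "\<forall>\<^sub>F m in sequentially. n * n * (1/2)^m \<le> e" if "0 < e" for e :: real
  proof -
    have "(\<lambda>m. n * n * (1/2)^m) \<longlonglongrightarrow> n * n * 0" by (intro tendsto_intros half)
    then have "\<forall>\<^sub>F m in sequentially. n * n * (1/2)^m < e" using that by (intro order_tendstoD(2)) auto
    then show ?thesis by eventually_elim simp
  qed
  show ?thesis
    using AE_space X_0 b_int equation L_all H_all
  proof eventually_elim
    case (elim \<omega>)
    note path = X_path[OF elim(1)]
    have Llim: "\<forall>\<^sub>F m in sequentially. \<forall>i l.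
      ito_close T1 (\<lambda>t \<omega>. W t \<omega> $ l) (H i l) (I i l) (L i l m) m \<omega>"
      using elim(5) by (simp add: eventually_all_finite)
    \<comment> \<open>On this path the geometric bound in \<open>ito_close\<close> forces
      convergence of the elementary integrals, so the limits that define \<open>I'\<close> agree
      with \<open>I\<close>.\<close>
    have I'_eq: "I' t \<omega> = (\<chi> i. \<Sum>l\<in>UNIV. I i l t \<omega>)" if t: "t \<in> {0..T1}" for t
    proof -
      have "(\<lambda>m. elementary_integral (\<lambda>t \<omega>. W t \<omega> $ l) (L i l m) t \<omega>) \<longlonglongrightarrow> I i l t \<omega>" for i l
      proof (rule LIM_zero_cancel, rule Lim_null_comparison[OF _ half])
        show "\<forall>\<^sub>F m in sequentially. norm (elementary_integral (\<lambda>t \<omega>. W t \<omega> $ l) (L i l m) t \<omega> - I i l t \<omega>) \<le> (1/2)^m"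
          using Llim by eventually_elim (use t in auto)
      qed
      then have "lim (\<lambda>m. elementary_integral (\<lambda>t \<omega>. W t \<omega> $ l) (L i l m) t \<omega>) = I i l t \<omega>" for i l
        by (rule limI)
      then show ?thesis by (simp add: I'_def)
    qed
    have X_eq: "X s \<omega> = Some (x0 + I' s \<omega> + (\<chi> i. LINT t:{0..s}|lborel. \<beta> \<omega> t i))" if s: "s \<in> {0..\<rho> \<omega>}" for s
    proof -
      have st: "stopped s \<omega> = s" using stopped_eq s by simp
      have "(LINT t:{0..s}|lborel. extend_by_zero (\<lambda>y. b y $ i) (X t \<omega>)) = (LINT t:{0..s}|lborel. \<beta> \<omega> t i)" for i
        by (rule set_lebesgue_integral_cong) (use s \<rho>[of \<omega>] le_S_iff in \<open>auto simp: \<beta>_def\<close>)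
      moreover have "X s \<omega> = Some (\<chi> i. x0 $ i + (\<Sum>l\<in>UNIV. I i l s \<omega>)
                     + (LINT t:{0..s}|lborel. extend_by_zero (\<lambda>y. b y $ i) (X t \<omega>)))"
      proof -
        have "0 \<le> s" using s by simp
        from elim(4)[rule_format, OF this] show ?thesis unfolding st .
      qed
      ultimately show ?thesis
        using s \<rho>[of \<omega>] by (simp add: I'_eq vec_eq_iff)
    qed
    have XV: "X s \<omega> = Some (V s \<omega>)" if "s \<in> {0..\<rho> \<omega>}" for s
      using X_eq[OF that] by simp
    have I'_0: "I' 0 \<omega> = 0"
      unfolding I'_def using elementary_integral_0[OF L] by (simp add: vec_eq_iff)
    have AP: "approximated_path (\<lambda>t. X t \<omega>) (\<lambda>t. V t \<omega>) (\<lambda>t. I' t \<omega>) x0 (\<beta> \<omega>) (\<lambda>s i l. H i l s \<omega>) (\<rho> \<omega>) T1 r K0 N \<tau>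
      (\<lambda>m k i l. elementary_process (L i l m) (\<tau> m (Suc k)) \<omega>) (\<lambda>m s i l. elementary_process (L i l m) s \<omega>) (\<lambda>m t. Mm m t \<omega>)"
    proof (unfold_locales)
      show "0 < T1" "0 \<le> \<rho> \<omega>" "\<rho> \<omega> \<le> T1" "0 < r" using T1 \<rho> r by auto
      show "X s \<omega> = Some (V s \<omega>)" if "s \<in> {0..\<rho> \<omega>}" for s using XV[OF that] .
      show "V s \<omega> = x0 + I' s \<omega> + (\<chi> i. LINT t:{0..s}|lborel. \<beta> \<omega> t i)" if "s \<in> {0..\<rho> \<omega>}" for s
        using X_eq[OF that] by simp
      have "continuous_on {0..T1} (\<lambda>t. \<chi> i. \<Sum>l\<in>UNIV. I i l t \<omega>)"
        by (intro continuous_intros continuous_on_subset[OF I_cont[OF elim(1)]]) auto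
      then show "continuous_on {0..T1} (\<lambda>t. I' t \<omega>)"
        by (subst continuous_on_cong[OF refl I'_eq]) auto
      show "set_integrable lborel {0..T1} (\<lambda>s. \<beta> \<omega> s i)" for i
      proof -
        have "set_integrable lborel {0..\<rho> \<omega>} (\<lambda>s. extend_by_zero (\<lambda>y. b y $ i) (X s \<omega>))"
          using elim(3)[rule_format, of T1 i] T1 unfolding stopped_T1 by simp
        moreover have "indicator {0..\<rho> \<omega>} s *\<^sub>R extend_by_zero (\<lambda>y. b y $ i) (X s \<omega>) = indicator {0..T1} s *\<^sub>R \<beta> \<omega> s i" for s
          using \<rho>[of \<omega>] le_S_iff[of s \<omega>] by (auto simp: \<beta>_def indicator_def)
        ultimately show ?thesis unfolding set_integrable_def by simp
      qed
      show "set_integrable lborel {0..T1} (\<lambda>s. frob (\<lambda>i l. H i l s \<omega>))"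
      proof (rule set_integral_frob)
        fix i l
        have fin: "(\<integral>\<^sup>+s\<in>{0..T1}. ennreal ((H i l s \<omega>)\<^sup>2) \<partial>lborel) < \<infinity>" using elim(6) T1 by auto
        show "set_integrable lborel {0..T1} (\<lambda>s. (H i l s \<omega>)\<^sup>2)"
          by (rule set_integrable_square[OF progressive_section[OF H_prog _ elim(1)],
              where c="enn2real (\<integral>\<^sup>+s\<in>{0..T1}. ennreal ((H i l s \<omega>)\<^sup>2) \<partial>lborel)"])
            (use T1 fin in auto)
      qed
      show "r \<le> norm (V (\<rho> \<omega>) \<omega> - z)" if lt: "\<rho> \<omega> < T1" and z: "z \<in> K0" for z
      proof -
        have "S \<omega> = ereal (\<rho> \<omega>)" using lt \<rho>(1)[of \<omega>] by (auto simp: min_def split: if_splits)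
        then have "X (\<rho> \<omega>) \<omega> \<notin> Some ` D"
          using exit_time_attained(2)[OF path D] by (simp add: S_def)
        moreover have "X (\<rho> \<omega>) \<omega> = Some (V (\<rho> \<omega>) \<omega>)" using XV[of "\<rho> \<omega>"] \<rho>(2)[of \<omega>] by simp
        ultimately have "V (\<rho> \<omega>) \<omega> \<notin> D" using imageI[of "V (\<rho> \<omega>) \<omega>" D Some] by argo
        then have "V (\<rho> \<omega>) \<omega> \<notin> ball z r" using K0[OF z] by blast
        then show ?thesis by (simp add: dist_norm norm_minus_commute)
      qed
      show "\<tau> m 0 = 0" "\<tau> m (N m) = T1" for m using grid by auto
      show "\<tau> m k < \<tau> m (Suc k)" "\<tau> m (Suc k) - \<tau> m k \<le> (1/2)^m" if "k < N m" for m k using grid that by auto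
      show "(\<lambda>i l. elementary_process (L i l m) s \<omega>) = (\<lambda>i l. elementary_process (L i l m) (\<tau> m (Suc k)) \<omega>)"
        if "k < N m" "s \<in> {\<tau> m k<..\<tau> m (Suc k)}" for m k s
        by (intro ext elementary_process_const[OF L grid(5)[OF _ that(1)]]) (use that in auto)
      show "\<forall>\<^sub>F m in sequentially. \<forall>t\<in>{0..T1}. norm (Mm m t \<omega> - I' t \<omega>) \<le> e" if "0 < e" for e
        using Llim half'[OF that]
      proof eventually_elim
        case (elim m)
        show ?case
        proof
          fix t assume t: "t \<in> {0..T1}"
          have "norm (Mm m t \<omega> - I' t \<omega>) \<le> (\<Sum>i\<in>UNIV. \<bar>(Mm m t \<omega> - I' t \<omega>) $ i\<bar>)" by (rule norm_le_l1_cart)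
          also have "\<dots> \<le> (\<Sum>i\<in>(UNIV::'n set). \<Sum>l\<in>(UNIV::'n set). (1/2)^m)"
          proof (rule sum_mono)
            fix i
            have "(Mm m t \<omega> - I' t \<omega>) $ i = (\<Sum>l\<in>UNIV. elementary_integral (\<lambda>t \<omega>. W t \<omega> $ l) (L i l m) t \<omega> - I i l t \<omega>)"
              by (simp add: Mm_def I'_eq[OF t] sum_subtractf)
            also have "\<bar>\<dots>\<bar> \<le> (\<Sum>l\<in>(UNIV::'n set). (1/2)^m)"
              by (rule order_trans[OF sum_abs sum_mono]) (use elim(1) t in auto)
            finally show "\<bar>(Mm m t \<omega> - I' t \<omega>) $ i\<bar> \<le> (\<Sum>l\<in>(UNIV::'n set). (1/2)^m)" .
          qed
          also have "\<dots> = n * n * (1/2)^m" by (simp add: n_def)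
          finally show "norm (Mm m t \<omega> - I' t \<omega>) \<le> e" using elim(2) by simp
        qed
      qed
      show "\<forall>\<^sub>F m in sequentially.
        set_integrable lborel {0..T1} (\<lambda>s. frob (\<lambda>i l. elementary_process (L i l m) s \<omega> - H i l s \<omega>)) \<and>
        (LINT s:{0..T1}|lborel. frob (\<lambda>i l. elementary_process (L i l m) s \<omega> - H i l s \<omega>)) \<le> e" if "0 < e" for e
        using Llim half'[OF that]
      proof eventually_elim
        case (elim m)
        have sq: "set_integrable lborel {0..T1} (\<lambda>s. (elementary_process (L i l m) s \<omega> - H i l s \<omega>)\<^sup>2)"
          "(LINT s:{0..T1}|lborel. (elementary_process (L i l m) s \<omega> - H i l s \<omega>)\<^sup>2) \<le> (1/2)^m" for i l
        proof -
          have "(\<lambda>s. elementary_process (L i l m) s \<omega>) \<in> borel_measurable borel"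
            using measurable_compose[OF measurable_Pair2'[OF \<open>\<omega> \<in> space M\<close>] elementary_process_measurable_joint[OF L]] by simp
          then have "(\<lambda>s. indicator {0..T1} s * elementary_process (L i l m) s \<omega>) \<in> borel_measurable lborel"
            by (intro borel_measurable_times) auto
          then have "(\<lambda>s. indicator {0..T1} s * elementary_process (L i l m) s \<omega> - indicator {0..T1} s * H i l s \<omega>) \<in> borel_measurable lborel"
            by (rule borel_measurable_diff) (use progressive_section[OF H_prog _ \<open>\<omega> \<in> space M\<close>, of T1 i l] T1 in simp)
          then have m: "(\<lambda>s. indicator {0..T1} s * (elementary_process (L i l m) s \<omega> - H i l s \<omega>)) \<in> borel_measurable lborel"
            by (simp add: right_diff_distrib)
          show "set_integrable lborel {0..T1} (\<lambda>s. (elementary_process (L i l m) s \<omega> - H i l s \<omega>)\<^sup>2)"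
            "(LINT s:{0..T1}|lborel. (elementary_process (L i l m) s \<omega> - H i l s \<omega>)\<^sup>2) \<le> (1/2)^m"
            using set_integrable_square[OF m, of "(1/2)^m"] elim(1) by auto
        qed
        have "(LINT s:{0..T1}|lborel. frob (\<lambda>i l. elementary_process (L i l m) s \<omega> - H i l s \<omega>))
          = (\<Sum>i\<in>UNIV. \<Sum>l\<in>UNIV. LINT s:{0..T1}|lborel. (elementary_process (L i l m) s \<omega> - H i l s \<omega>)\<^sup>2)"
          by (rule set_integral_frob(2)) (rule sq)
        also have "\<dots> \<le> (\<Sum>i\<in>(UNIV::'n set). \<Sum>l\<in>(UNIV::'n set). (1/2)^m)"
          by (intro sum_mono sq)
        also have "\<dots> = n * n * (1/2)^m" by (simp add: n_def)
        finally show ?case using elim(2) set_integral_frob(1)[OF sq(1)] by simp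
      qed
    qed
    have V_D: "V s \<omega> \<in> D" if "0 \<le> s" "s < \<rho> \<omega>" for s
    proof -
      have "ereal s < S \<omega>" using that \<rho>(4)[of \<omega>] less_le_trans[of "ereal s" "ereal (\<rho> \<omega>)" "S \<omega>"] by simp
      then have "X s \<omega> \<in> Some ` D" using less_exit_time[OF that(1)] by (simp add: S_def)
      then show ?thesis by auto
    qed
    have \<rho>_pos: "0 < \<rho> \<omega>"
    proof (rule ccontr)
      assume "\<not> 0 < \<rho> \<omega>"
      then have "\<rho> \<omega> = 0" using \<rho>(2)[of \<omega>] by simp
      then have "S \<omega> = ereal 0" using \<rho>(1)[of \<omega>] T1 by (auto simp: min_def split: if_splits)
      then have "X 0 \<omega> \<notin> Some ` D" using exit_time_attained(2)[OF path D] by (simp add: S_def)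
      then show False using elim(2) x0 by auto
    qed
    \<comment> \<open>At the exit time the position is no longer in the open set \<open>D\<close>;
      continuity still puts it into the closure. This uses \<open>0 < \<rho> \<omega>\<close>, which
      makes the half-open interval dense in the closed one.\<close>
    have V_K: "V s \<omega> \<in> K" if s: "0 \<le> s" "s \<le> \<rho> \<omega>" for s
    proof -
      have cl: "closure {0..<\<rho> \<omega>} = {0..\<rho> \<omega>}" using \<rho>_pos by simp
      have "(\<lambda>t. V t \<omega>) ` closure {0..<\<rho> \<omega>} \<subseteq> closure D"
      proof (rule image_closure_subset)
        show "continuous_on (closure {0..<\<rho> \<omega>}) (\<lambda>t. V t \<omega>)"
          unfolding cl by (rule approximated_path.y_cont[OF AP])
        show "(\<lambda>t. V t \<omega>) ` {0..<\<rho> \<omega>} \<subseteq> closure D" using V_D closure_subset by fastforce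
      qed simp
      moreover have "V s \<omega> \<in> (\<lambda>t. V t \<omega>) ` closure {0..<\<rho> \<omega>}" unfolding cl using s by (intro imageI) simp
      ultimately show ?thesis using K(1) by blast
    qed
    have PDE: "- dt u (T - s) (V s \<omega>) + (\<Sum>i\<in>UNIV. dx i u (T - s) (V s \<omega>) * \<beta> \<omega> s i)
        + 1/2 * (\<Sum>i\<in>UNIV. \<Sum>j\<in>UNIV. \<Sum>l\<in>UNIV. dx j (dx i u) (T - s) (V s \<omega>) * H i l s \<omega> * H j l s \<omega>) \<le> 0"
      if s: "0 \<le> s" "s \<le> \<rho> \<omega>" for s
    proof -
      define z where "z = V s \<omega>"
      have z: "z \<in> \<O>" using V_K[OF s] K unfolding z_def by blast
      have "s \<le> T1" using s \<rho>(3)[of \<omega>] by simp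
      then have sS: "ereal s \<le> S \<omega>" using le_S_iff s by simp
      have X: "X s \<omega> = Some z" using XV s unfolding z_def by simp
      have \<beta>: "\<beta> \<omega> s i = b z $ i" for i by (simp add: \<beta>_def sS extend_by_zero_def X)
      have H: "H i l s \<omega> = \<sigma> z $ i $ l" for i l by (simp add: H_def sS extend_by_zero_def X)
      have "0 < T - s" using \<open>s \<le> T1\<close> T by simp
      then have ineq: "dt u (T - s) z
          - 1/2 * (\<Sum>i\<in>UNIV. \<Sum>j\<in>UNIV. (\<sigma> z ** transpose (\<sigma> z)) $ i $ j * dx j (dx i u) (T - s) z)
          - (\<Sum>i\<in>UNIV. b z $ i * dx i u (T - s) z) \<ge> 0"
        using super z unfolding classical_supersolution_def by blast
      have "(\<sigma> z ** transpose (\<sigma> z)) $ i $ j * dx j (dx i u) (T - s) z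
        = (\<Sum>l\<in>UNIV. dx j (dx i u) (T - s) z * H i l s \<omega> * H j l s \<omega>)" for i j
        unfolding H by (simp add: matrix_matrix_mult_def transpose_def sum_distrib_right sum_distrib_left mult_ac)
      then show ?thesis using ineq unfolding z_def[symmetric] \<beta> by (simp add: mult.commute)
    qed
    show ?case using elim(2) I'_0 AP V_K PDE by blast
  qed
qed

end

section \<open>Choice of the grids and passage to the limit\<close>

context stopped_solution
begin

text \<open>For a continuous path the times spent in a compact set form a closed set, so rational
  times in the open interval decide.\<close>

lemma staying_measurable:
  assumes K0: "compact K0" "K0 \<subseteq> \<O>" and T: "0 < t"
  shows "{\<omega>\<in>space M. \<forall>s\<in>{0..t}. X s \<omega> \<in> Some ` K0} \<in> sets M"
proof -
  have m: "{\<omega>\<in>space M. X s \<omega> \<in> Some ` K0} \<in> sets M" if "0 \<le> s" for s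
    using measurable_sets[OF measurable_F_M[OF X_adapted[OF that] that] Some_compact_state_algebra[OF K0]]
    by (simp add: vimage_def Int_def conj_commute)
  have "(\<forall>s\<in>{0..t}. X s \<omega> \<in> Some ` K0) \<longleftrightarrow> (\<forall>s\<in>\<rat> \<inter> {0<..<t}. X s \<omega> \<in> Some ` K0)" if \<omega>: "\<omega> \<in> space M" for \<omega>
  proof
    assume *: "\<forall>s\<in>\<rat> \<inter> {0<..<t}. X s \<omega> \<in> Some ` K0"
    have "closure (\<rat> \<inter> {0<..<t}) \<subseteq> {s\<in>{0..}. X s \<omega> \<in> Some ` K0}"
      by (rule closure_minimal) (use * explosive_path_preimage_closed[OF X_path[OF \<omega>] K0] in auto)
    then show "\<forall>s\<in>{0..t}. X s \<omega> \<in> Some ` K0"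
      using Icc_subset_closure_rationals[OF T] by blast
  qed auto
  then have "{\<omega>\<in>space M. \<forall>s\<in>{0..t}. X s \<omega> \<in> Some ` K0} = {\<omega>\<in>space M. \<forall>s\<in>\<rat> \<inter> {0<..<t}. X s \<omega> \<in> Some ` K0}"
    by auto
  also have "\<dots> = space M - (\<Union>s\<in>\<rat> \<inter> {0<..<t}. space M - {\<omega>\<in>space M. X s \<omega> \<in> Some ` K0})"
    by auto
  also have "\<dots> \<in> sets M"
    by (intro sets.Diff sets.top sets.countable_UN') (auto intro!: m simp: countable_rat)
  finally show ?thesis .
qed

text \<open>All data chosen for the \<open>m\<close>-th approximation in one predicate, so that they
  can be selected for all \<open>m\<close> at once. The last line bounds the error term of
  \<open>weighted_bound\<close> by a null sequence.\<close>

definition schedule ::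
    "(real \<Rightarrow> real^'n \<Rightarrow> real) \<Rightarrow> (real^'n) set \<Rightarrow> real \<Rightarrow> real \<Rightarrow> nat \<Rightarrow>
     nat \<Rightarrow> (nat \<Rightarrow> real) \<Rightarrow> real \<Rightarrow> real \<Rightarrow> real \<Rightarrow> real \<Rightarrow> bool" where
  "schedule u K r T m N \<tau> e C \<delta> Xb \<longleftrightarrow> 0 \<le> e \<and> 0 \<le> C \<and>
    (\<forall>s\<in>{T-T1..T}. \<forall>z. cball z r \<subseteq> K \<longrightarrow> (\<forall>v.
     indicator K (z + v) * u s (z + v) - u s z \<le> (\<Sum>i\<in>UNIV. dx i u s z * v $ i)
       + 1/2 * (\<Sum>i\<in>UNIV. \<Sum>j\<in>UNIV. dx j (dx i u) s z * v $ i * v $ j) + e * (norm v)\<^sup>2 + C * norm v ^ 4)) \<and>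
    (\<forall>i l t. \<forall>\<omega>\<in>space M. \<bar>elementary_process (L i l m) t \<omega>\<bar> \<le> Xb) \<and>
    \<tau> 0 = (0::real) \<and> \<tau> N = T1 \<and> (\<forall>k<N. \<tau> k < \<tau> (Suc k) \<and> \<tau> (Suc k) - \<tau> k \<le> \<delta> \<and> \<tau> (Suc k) - \<tau> k \<le> (1/2)^m) \<and>
    (\<forall>i l. \<forall>p\<in>endpoints (L i l m). \<forall>k<N. p \<le> \<tau> k \<or> \<tau> (Suc k) \<le> p) \<and>
    (e * (real CARD('n) ^ 5 * Xb\<^sup>2) + C * (3 * real CARD('n) ^ 10 * Xb ^ 4) * \<delta>) * T1 \<le> (1/2)^m"

text \<open>The order of the choices matters: \<open>Xb\<close> comes with the elementary
  integrands, \<open>e\<close> is chosen against \<open>Xb\<close>, the Taylor bound returns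
  \<open>C\<close> for this \<open>e\<close>, and finally the mesh is chosen against
  \<open>C\<close> and \<open>Xb\<close>.\<close>

lemma approximation_schedule:
  assumes \<O>': "open \<O>" and u: "C12 \<O> u" and K: "compact K" "K \<subseteq> \<O>" and T: "T1 < T" and r: "0 < r"
  shows "\<exists>N \<tau> e C \<delta> Xb. schedule u K r T m N \<tau> e C \<delta> Xb"
proof -
  have "\<forall>i l. \<exists>C. \<forall>\<omega>\<in>space M. \<forall>t. \<bar>elementary_process (L i l m) t \<omega>\<bar> \<le> C"
    using elementary_process_bounded[OF L] by blast
  then obtain Cb where Cb: "\<And>i l \<omega> t. \<omega> \<in> space M \<Longrightarrow> \<bar>elementary_process (L i l m) t \<omega>\<bar> \<le> Cb i l"
    unfolding choice_iff by blast
  define Xb where "Xb = Max (range (\<lambda>(i, l). Cb i l))"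
  have Xb: "\<bar>elementary_process (L i l m) t \<omega>\<bar> \<le> Xb" if "\<omega> \<in> space M" for i l t \<omega>
  proof -
    have "Cb i l \<le> Xb" unfolding Xb_def by (rule Max_ge) (auto intro: range_eqI[of _ _ "(i, l)"])
    then show ?thesis using Cb[OF that] order_trans by blast
  qed
  define A1 where "A1 = real CARD('n) ^ 5 * Xb\<^sup>2"
  define A2 where "A2 = 3 * real CARD('n) ^ 10 * Xb ^ 4"
  have A: "0 \<le> A1" "0 \<le> A2" by (auto simp: A1_def A2_def)
  \<comment> \<open>Half of the error budget, one share for each of the two error terms.\<close>
  define h where "h = (1/2::real)^m / 2"
  have h: "0 < h" "h + h = (1/2)^m" by (auto simp: h_def)
  \<comment> \<open>The added 1 keeps the denominator positive when \<open>A1\<close> vanishes; the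
    choice of \<open>\<delta>\<close> below uses the same device.\<close>
  define e where "e = h / (A1 * T1 + 1)"
  have d1: "0 < A1 * T1 + 1" using A T1 by (simp add: add_nonneg_pos)
  have e: "0 < e" using h d1 by (simp add: e_def)
  have e1: "e * A1 * T1 \<le> h"
  proof -
    have "e * (A1 * T1) \<le> e * (A1 * T1 + 1)" using e by (intro mult_left_mono) auto
    also have "\<dots> = h" using d1 by (simp add: e_def)
    finally show ?thesis by (simp add: mult.assoc)
  qed
  have "0 < T - T1" using T by simp
  from C12_taylor_bound[OF u this K \<O>' r e, of T] obtain C where C: "0 \<le> C" and tay:
    "\<forall>s\<in>{T-T1..T}. \<forall>z. cball z r \<subseteq> K \<longrightarrow> (\<forall>v.
     indicator K (z + v) * u s (z + v) - u s z \<le> (\<Sum>i\<in>UNIV. dx i u s z * v $ i)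
       + 1/2 * (\<Sum>i\<in>UNIV. \<Sum>j\<in>UNIV. dx j (dx i u) s z * v $ i * v $ j) + e * (norm v)\<^sup>2 + C * norm v ^ 4)"
    by blast
  define \<delta> where "\<delta> = min ((1/2)^m) (h / (C * A2 * T1 + 1))"
  have d2: "0 < C * A2 * T1 + 1" using A T1 C by (simp add: add_nonneg_pos)
  have \<delta>: "0 < \<delta>" using h d2 by (simp add: \<delta>_def)
  have e2: "C * A2 * \<delta> * T1 \<le> h"
  proof -
    have "\<delta> * (C * A2 * T1) \<le> h / (C * A2 * T1 + 1) * (C * A2 * T1 + 1)"
      using A T1 C h d2 by (intro mult_mono) (auto simp: \<delta>_def)
    also have "\<dots> = h" using d2 by simp
    finally show ?thesis by (simp add: mult_ac)
  qed
  have fin: "finite (\<Union>i. \<Union>l. endpoints (L i l m))" by (simp add: finite_endpoints)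
  obtain \<tau> and N where g: "\<tau> 0 = 0" "\<tau> N = T1"
    "\<And>k. k < N \<Longrightarrow> \<tau> k < \<tau> (Suc k)" "\<And>k. k < N \<Longrightarrow> \<tau> (Suc k) - \<tau> k \<le> \<delta>"
    "\<And>p k. p \<in> (\<Union>i. \<Union>l. endpoints (L i l m)) \<Longrightarrow> k < N \<Longrightarrow> p \<le> \<tau> k \<or> \<tau> (Suc k) \<le> p"
    by (rule refining_partition[OF fin T1 \<delta>]) (rule that)
  have "schedule u K r T m N \<tau> e C \<delta> Xb"
    unfolding schedule_def A1_def[symmetric] A2_def[symmetric] mult.assoc[of 3, symmetric]
  proof (intro conjI tay g(1,2))
    show "0 \<le> e" "0 \<le> C" using e C by auto
    show "\<forall>i l t. \<forall>\<omega>\<in>space M. \<bar>elementary_process (L i l m) t \<omega>\<bar> \<le> Xb"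
      using Xb by blast
    show "\<forall>k<N. \<tau> k < \<tau> (Suc k) \<and> \<tau> (Suc k) - \<tau> k \<le> \<delta> \<and> \<tau> (Suc k) - \<tau> k \<le> (1/2)^m"
    proof (intro allI impI conjI)
      fix k assume k: "k < N"
      show "\<tau> k < \<tau> (Suc k)" "\<tau> (Suc k) - \<tau> k \<le> \<delta>" using g(3,4)[OF k] .
      have "\<delta> \<le> (1/2)^m" by (simp add: \<delta>_def)
      then show "\<tau> (Suc k) - \<tau> k \<le> (1/2)^m" using g(4)[OF k] by linarith
    qed
    show "\<forall>i l. \<forall>p\<in>endpoints (L i l m). \<forall>k<N. p \<le> \<tau> k \<or> \<tau> (Suc k) \<le> p"
      using g(5) by blast
    show "(e * A1 + C * A2 * \<delta>) * T1 \<le> (1/2)^m"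
      using e1 e2 h(2) by (simp add: distrib_right)
  qed
  then show ?thesis by blast
qed

text \<open>Two limits are taken in a fixed order. For fixed \<open>N0\<close> the sums
  \<open>Sm N0 m\<close> are bounded uniformly in \<open>m\<close>, so dominated convergence applies
  as \<open>m\<close> grows; only then is the cut-off \<open>N0\<close> released. By
  \<open>variation_bounded\<close> almost every path that stays in \<open>K0\<close> has a finite
  cut-off, so nothing of the event is lost.\<close>

lemma staying_probability_bound:
  assumes K0: "compact K0" "K0 \<subseteq> \<O>" "x0 \<in> K0" and r: "0 < r" and K: "compact K" "K \<subseteq> \<O>" "\<And>z. z \<in> K0 \<Longrightarrow> cball z (2 * r) \<subseteq> K"
    and DK: "closure D \<subseteq> K" "\<And>z. z \<in> K0 \<Longrightarrow> ball z r \<subseteq> D"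
    and T: "T1 < T" and super: "classical_supersolution \<O> b \<sigma> u" and u0: "\<And>t z. 0 \<le> t \<Longrightarrow> z \<in> \<O> \<Longrightarrow> 0 \<le> u t z"
    and c: "0 \<le> c" "\<And>z. z \<in> K \<Longrightarrow> c \<le> u (T - T1) z"
  shows "c * prob {\<omega>\<in>space M. \<forall>s\<in>{0..T1}. X s \<omega> \<in> Some ` K0} \<le> u T x0"
proof -
  define E where "E = {\<omega>\<in>space M. \<forall>s\<in>{0..T1}. X s \<omega> \<in> Some ` K0}"
  have E[measurable]: "E \<in> sets M" unfolding E_def by (rule staying_measurable[OF K0(1,2) T1])
  have C12: "C12 \<O> u" using super by (simp add: classical_supersolution_def)
  have T0: "0 < T" "0 < T - T1" using T T1 by auto
  have x0O: "x0 \<in> \<O>" using K0 by blast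
  have x0D: "x0 \<in> D" using DK(2)[OF K0(3)] r by (auto simp: subset_iff)
  obtain B where B0: "0 \<le> B" and bound: "\<And>s z. s \<in> {T-T1..T} \<Longrightarrow> z \<in> K \<Longrightarrow> \<bar>u s z\<bar> \<le> B \<and> \<bar>dt u s z\<bar> \<le> B \<and> (\<forall>i. \<bar>dx i u s z\<bar> \<le> B) \<and>
       (\<forall>i j. \<bar>dx j (dx i u) s z\<bar> \<le> B)"
    using C12_bounds[OF C12 T0(2) K(1,2), of T] by blast
  have "\<forall>m. \<exists>N \<tau> e C \<delta> Xb. schedule u K r T m N \<tau> e C \<delta> Xb"
    using approximation_schedule[OF \<O> C12 K(1,2) T r] by blast
  then obtain N \<tau> e C \<delta> Xb where sch: "\<And>m. schedule u K r T m (N m) (\<tau> m) (e m) (C m) (\<delta> m) (Xb m)"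
    unfolding choice_iff by blast
  note c1 = sch[unfolded schedule_def]
  note c2 = c1[THEN conjunct2]
  note c3 = c2[THEN conjunct2]
  note c4 = c3[THEN conjunct2]
  note c5 = c4[THEN conjunct2]
  note c6 = c5[THEN conjunct2]
  note c7 = c6[THEN conjunct2]
  note c8 = c7[THEN conjunct2]
  have eC: "0 \<le> e m" "0 \<le> C m" for m
    using c1[THEN conjunct1] c2[THEN conjunct1] .
  have tay: "indicator K (z + v) * u s (z + v) - u s z \<le> (\<Sum>i\<in>UNIV. dx i u s z * v $ i)
       + 1/2 * (\<Sum>i\<in>UNIV. \<Sum>j\<in>UNIV. dx j (dx i u) s z * v $ i * v $ j) + e m * (norm v)\<^sup>2 + C m * norm v ^ 4"
    if "s \<in> {T-T1..T}" "cball z r \<subseteq> K" for m s z v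
    using c3[THEN conjunct1, rule_format, OF that] .
  have Xb: "\<bar>elementary_process (L i l m) t \<omega>\<bar> \<le> Xb m" if "\<omega> \<in> space M" for m i l t \<omega>
    using c4[THEN conjunct1, rule_format, OF that] .
  have grid: "\<tau> m 0 = 0" "\<tau> m (N m) = T1" for m
    using c5[THEN conjunct1] c6[THEN conjunct1] .
  have grid': "\<tau> m k < \<tau> m (Suc k)" "\<tau> m (Suc k) - \<tau> m k \<le> \<delta> m" "\<tau> m (Suc k) - \<tau> m k \<le> (1/2)^m" if "k < N m" for m k
    using c7[THEN conjunct1, rule_format, OF that] by auto
  have grid_pts: "p \<le> \<tau> m k \<or> \<tau> m (Suc k) \<le> p" if "p \<in> endpoints (L i l m)" "k < N m" for m p k i l
    using c8[THEN conjunct1, rule_format, OF that] .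
  have err: "(e m * (real CARD('n) ^ 5 * (Xb m)\<^sup>2) + C m * (3 * real CARD('n) ^ 10 * Xb m ^ 4) * \<delta> m) * T1 \<le> (1/2)^m" for m
    using c8[THEN conjunct2] .
  define P where "P t \<omega> \<longleftrightarrow> X t \<omega> \<in> Some ` K0" for t \<omega>
  define \<xi> where "\<xi> m k i l \<omega> = elementary_process (L i l m) (\<tau> m (Suc k)) \<omega>" for m k i l \<omega>
  define Z where "Z m k \<omega> = V (\<tau> m k) \<omega> + Mm m (\<tau> m k) \<omega> - I' (\<tau> m k) \<omega>" for m k \<omega>
  define \<Delta> where "\<Delta> m k \<omega> = (V (\<tau> m (Suc k)) \<omega> - I' (\<tau> m (Suc k)) \<omega>) - (V (\<tau> m k) \<omega> - I' (\<tau> m k) \<omega>)" for m k \<omega>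
  define w where "w N0 m k \<omega> \<longleftrightarrow> (\<forall>j\<le>k. P (\<tau> m j) \<omega> \<and> norm (Mm m (\<tau> m j) \<omega> - I' (\<tau> m j) \<omega>) \<le> r) \<and> (\<forall>j<k. norm (\<Delta> m j \<omega>) \<le> r) \<and>
      (\<Sum>j<k. norm (\<Delta> m j \<omega>)) \<le> N0 \<and>
      (\<Sum>j\<in>{..k} \<inter> {..<N m}. (\<tau> m (Suc j) - \<tau> m j) * frob (\<lambda>i l. \<xi> m j i l \<omega>)) \<le> N0" for N0 :: real and m k \<omega>
  define Sm where "Sm N0 m \<omega> = (\<Sum>k<N m. of_bool (w N0 m (Suc k) \<omega>) * (u (T - \<tau> m (Suc k)) (Z m (Suc k) \<omega>) - u (T - \<tau> m k) (Z m (Suc k) \<omega> - \<Delta> m k \<omega>))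
      + 1/2 * (\<tau> m (Suc k) - \<tau> m k) * (of_bool (w N0 m k \<omega>) *
          (\<Sum>i\<in>UNIV. \<Sum>j\<in>UNIV. \<Sum>l\<in>UNIV. dx j (dx i u) (T - \<tau> m k) (Z m k \<omega>) * \<xi> m k i l \<omega> * \<xi> m k j l \<omega>)))" for N0 m \<omega>
  define \<Phi> where "\<Phi> N0 m \<omega> = of_bool (w N0 m (N m) \<omega>) * (indicator K (Z m (N m) \<omega>) * u (T - T1) (Z m (N m) \<omega>))" for N0 m \<omega>
  define \<Phi>0 where "\<Phi>0 N0 m \<omega> = of_bool (w N0 m 0 \<omega>) * (indicator K (Z m 0 \<omega>) * u T (Z m 0 \<omega>))" for N0 m \<omega>
  have P_meas: "{\<omega>\<in>space M. P t \<omega>} \<in> sets (F t)" if "0 \<le> t" for t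
    using measurable_sets[OF X_adapted[OF that] Some_compact_state_algebra[OF K0(1,2)]] that
    by (simp add: P_def vimage_def Int_def conj_commute)
  have P_V: "V t \<omega> \<in> K0" if "P t \<omega>" for t \<omega> using that by (auto simp: P_def)
  have u_pos: "0 \<le> u t z" if "0 < t" "z \<in> \<O>" for t z using u0 that by simp
  {
    fix N0 :: real and m :: nat assume N0: "0 \<le> N0"
    note WB = weighted_bound[where \<O>=\<O> and K=K and ?K0.0=K0 and u=u and V=V and I'=I' and P=P and L="\<lambda>i l. L i l m"
      and \<tau>="\<tau> m" and ?N0.0=N0 and r=r and T=T and N="N m" and ?T1.0=T1 and B=B and e="e m" and C="C m" and X="Xb m" and \<delta>="\<delta> m",
      OF \<O> C12 K T N0 r B0 u_pos bound tay eC V_measurable I'_measurable P_meas P_V L Xb grid grid'(1,2) grid_pts]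
    have 1: "Sm N0 m \<in> borel_measurable M"
      unfolding \<Phi>_def \<Phi>0_def Sm_def w_def \<Delta>_def Z_def \<xi>_def Mm_def by (rule WB(1)) assumption+
    have 2: "\<bar>Sm N0 m \<omega>\<bar> \<le> B * T1 + real CARD('n) * B * N0 + real CARD('n) * B * N0" if \<omega>: "\<omega> \<in> space M" for \<omega>
      unfolding \<Phi>_def \<Phi>0_def Sm_def w_def \<Delta>_def Z_def \<xi>_def Mm_def by (rule WB(2)) (assumption | rule \<omega>)+
    have 3: "\<Phi> N0 m \<in> borel_measurable M"
      unfolding \<Phi>_def \<Phi>0_def Sm_def w_def \<Delta>_def Z_def \<xi>_def Mm_def by (rule WB(3)) assumption+
    have 4: "(\<integral>\<omega>. \<Phi> N0 m \<omega> \<partial>M) \<le> (\<integral>\<omega>. \<Phi>0 N0 m \<omega> \<partial>M) + (\<integral>\<omega>. Sm N0 m \<omega> \<partial>M) +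
        (e m * (real CARD('n) ^ 5 * (Xb m)\<^sup>2) + C m * (3 * real CARD('n) ^ 10 * Xb m ^ 4) * \<delta> m) * T1"
      unfolding \<Phi>_def \<Phi>0_def Sm_def w_def \<Delta>_def Z_def \<xi>_def Mm_def by (rule WB(4)) assumption+
    have 5: "cball (Z m k \<omega>) r \<subseteq> K" if w: "w N0 m k \<omega>" for k \<omega>
      unfolding \<Phi>_def \<Phi>0_def Sm_def w_def \<Delta>_def Z_def \<xi>_def Mm_def by (rule WB(5)) (assumption | rule w[unfolded w_def \<Delta>_def Z_def \<xi>_def Mm_def])+
    have 6: "w N0 m k \<omega>" if w: "w N0 m (Suc k) \<omega>" and k: "k < N m" for k \<omega>
      unfolding \<Phi>_def \<Phi>0_def Sm_def w_def \<Delta>_def Z_def \<xi>_def Mm_def by (rule WB(6)) (assumption | rule w[unfolded w_def \<Delta>_def Z_def \<xi>_def Mm_def] | rule k)+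
    note 1 2 3 4 5 6
  }
  note S_meas = this(1) and S_bound = this(2) and \<Phi>_meas = this(3) and \<Phi>_exp0 = this(4)
    and w_cball = this(5) and w_prev = this(6)
  have \<Phi>_exp: "(\<integral>\<omega>. \<Phi> N0 m \<omega> \<partial>M) \<le> (\<integral>\<omega>. \<Phi>0 N0 m \<omega> \<partial>M) + (\<integral>\<omega>. Sm N0 m \<omega> \<partial>M) + (1/2)^m" if "0 \<le> N0" for N0 m
    using \<Phi>_exp0[OF that, of m] err[of m] by linarith
  have \<tau>_range: "0 \<le> \<tau> m k \<and> \<tau> m k \<le> T1" if "k \<le> N m" for m k
    by (rule partition_range) (use grid grid'(1) that in auto)
  have AP: "AE \<omega> in M. X 0 \<omega> = Some x0 \<and> I' 0 \<omega> = 0 \<and>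
    approximated_path (\<lambda>t. X t \<omega>) (\<lambda>t. V t \<omega>) (\<lambda>t. I' t \<omega>) x0 (\<beta> \<omega>) (\<lambda>s i l. H i l s \<omega>) (\<rho> \<omega>) T1 r K0 N \<tau>
      (\<lambda>m k i l. elementary_process (L i l m) (\<tau> m (Suc k)) \<omega>) (\<lambda>m s i l. elementary_process (L i l m) s \<omega>) (\<lambda>m t. Mm m t \<omega>) \<and>
    (\<forall>s. 0 \<le> s \<longrightarrow> s \<le> \<rho> \<omega> \<longrightarrow> V s \<omega> \<in> K \<and> - dt u (T - s) (V s \<omega>) + (\<Sum>i\<in>UNIV. dx i u (T - s) (V s \<omega>) * \<beta> \<omega> s i)
        + 1/2 * (\<Sum>i\<in>UNIV. \<Sum>j\<in>UNIV. \<Sum>l\<in>UNIV. dx j (dx i u) (T - s) (V s \<omega>) * H i l s \<omega> * H j l s \<omega>) \<le> 0)"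
    by (rule ae_pathwise[OF DK(2) r DK(1) K(2) x0D T super grid grid'(1,3) grid_pts]) assumption+
  \<comment> \<open>Only an upper bound on the limit superior is available along each path, hence
    the positive part.\<close>
  have S_lim: "AE \<omega> in M. (\<lambda>m. max (Sm N0 m \<omega>) 0) \<longlonglongrightarrow> 0" if N0: "0 \<le> N0" for N0
    using AP
  proof eventually_elim
    case (elim \<omega>)
    interpret A: approximated_path "\<lambda>t. X t \<omega>" "\<lambda>t. V t \<omega>" "\<lambda>t. I' t \<omega>" x0 "\<beta> \<omega>" "\<lambda>s i l. H i l s \<omega>" "\<rho> \<omega>" T1 r K0 N \<tau>
      "\<lambda>m k i l. elementary_process (L i l m) (\<tau> m (Suc k)) \<omega>" "\<lambda>m s i l. elementary_process (L i l m) s \<omega>" "\<lambda>m t. Mm m t \<omega>"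
      using elim by blast
    have Zeq: "A.Zm m k = Z m k \<omega>" and \<Delta>eq: "A.\<Delta>m m k = \<Delta> m k \<omega>" for m k
      by (simp_all add: A.Zm_def Z_def A.\<Delta>m_def A.Bv_def \<Delta>_def)
    have "\<forall>\<^sub>F m in sequentially. Sm N0 m \<omega> \<le> e'" if e': "0 < e'" for e'
    proof -
      have "\<forall>\<^sub>F m in sequentially. (\<Sum>k<N m. of_bool (w N0 m (Suc k) \<omega>) * (u (T - \<tau> m (Suc k)) (A.Zm m (Suc k)) - u (T - \<tau> m k) (A.Zm m (Suc k) - A.\<Delta>m m k))
      + 1/2 * (\<tau> m (Suc k) - \<tau> m k) * (of_bool (w N0 m k \<omega>) *
          (\<Sum>i\<in>UNIV. \<Sum>j\<in>UNIV. \<Sum>l\<in>UNIV. dx j (dx i u) (T - \<tau> m k) (A.Zm m k) *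
             elementary_process (L i l m) (\<tau> m (Suc k)) \<omega> * elementary_process (L j l m) (\<tau> m (Suc k)) \<omega>))) \<le> e'"
      proof (rule A.limsup_path_sum_nonpos[OF \<O> C12 K T _ _ _ e'])
        fix s assume "0 \<le> s" "s \<le> \<rho> \<omega>"
        then show "V s \<omega> \<in> K \<and> - dt u (T - s) (V s \<omega>) + (\<Sum>i\<in>UNIV. dx i u (T - s) (V s \<omega>) * \<beta> \<omega> s i)
        + 1/2 * (\<Sum>i\<in>UNIV. \<Sum>j\<in>UNIV. \<Sum>l\<in>UNIV. dx j (dx i u) (T - s) (V s \<omega>) * H i l s \<omega> * H j l s \<omega>) \<le> 0"
          using elim by blast
      next
        fix m k assume k: "k < N m" and w: "w N0 m (Suc k) \<omega>"
        have "norm (\<Delta> m k \<omega>) \<le> r" using w unfolding w_def by blast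
        then show "w N0 m k \<omega> \<and> norm (A.\<Delta>m m k) \<le> r" using w_prev[OF N0 w k] by (simp add: \<Delta>eq)
      next
        fix m k assume "w N0 m k \<omega>"
        then show "X (\<tau> m k) \<omega> \<in> Some ` K0 \<and> norm (Mm m (\<tau> m k) \<omega> - I' (\<tau> m k) \<omega>) \<le> r"
          unfolding w_def P_def by blast
      qed
      then show ?thesis unfolding Zeq \<Delta>eq Sm_def \<xi>_def .
    qed
    note ev = this
    show "(\<lambda>m. max (Sm N0 m \<omega>) 0) \<longlonglongrightarrow> 0"
    proof (rule tendstoI)
      fix e' :: real assume "0 < e'"
      then have "0 < e' / 2" by simp
      from ev[OF this] show "\<forall>\<^sub>F m in sequentially. dist (max (Sm N0 m \<omega>) 0) 0 < e'"
        by eventually_elim (use \<open>0 < e'\<close> in \<open>auto simp: dist_real_def\<close>)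
    qed
  qed
  \<comment> \<open>The paths of \<open>E\<close> on which the cut-off \<open>N0\<close> does not
    bind for any approximation; on almost all of them the weight survives to the last grid time once
    \<open>m\<close> is large.\<close>
  define EN where "EN N0 = {\<omega>\<in>E. \<forall>m. (\<Sum>k<N m. norm (\<Delta> m k \<omega>)) \<le> N0 \<and>
      (\<Sum>k<N m. (\<tau> m (Suc k) - \<tau> m k) * frob (\<lambda>i l. \<xi> m k i l \<omega>)) \<le> N0}" for N0 :: real
  have EN[measurable]: "EN N0 \<in> sets M" for N0
  proof -
    have 1: "V (\<tau> m k) \<in> borel_measurable M" "I' (\<tau> m k) \<in> borel_measurable M" if "k \<le> N m" for m k
      using measurable_F_M[OF V_measurable] measurable_F_M[OF I'_measurable] \<tau>_range[OF that] by auto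
    have [measurable]: "\<Delta> m k \<in> borel_measurable M" if "k \<in> {..<N m}" for m k
      unfolding \<Delta>_def using 1[of k m] 1[of "Suc k" m] that by (intro borel_measurable_diff) auto
    have [measurable]: "\<xi> m k i l \<in> borel_measurable M" for m k i l
    proof -
      have "(\<lambda>\<omega>. elementary_process (L i l m) (\<tau> m (Suc k)) \<omega>) \<in> borel_measurable M"
        using measurable_compose[OF measurable_Pair1' elementary_process_measurable_joint[OF L[of i l m]], of "\<tau> m (Suc k)"] by simp
      then show ?thesis by (simp add: \<xi>_def[abs_def])
    qed
    have "EN N0 = E \<inter> {\<omega>\<in>space M. \<forall>m. (\<Sum>k<N m. norm (\<Delta> m k \<omega>)) \<le> N0 \<and>
      (\<Sum>k<N m. (\<tau> m (Suc k) - \<tau> m k) * frob (\<lambda>i l. \<xi> m k i l \<omega>)) \<le> N0}"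
      using sets.sets_into_space[OF E] by (auto simp: EN_def)
    also have "\<dots> \<in> sets M" unfolding frob_def by measurable
    finally show ?thesis .
  qed
  have on_E: "AE \<omega> in M. \<omega> \<in> E \<longrightarrow> (\<exists>n::nat. \<omega> \<in> EN n) \<and> (\<forall>N0. \<omega> \<in> EN N0 \<longrightarrow> (\<forall>\<^sub>F m in sequentially. w N0 m (N m) \<omega>))"
    using AP
  proof eventually_elim
    case (elim \<omega>)
    interpret A: approximated_path "\<lambda>t. X t \<omega>" "\<lambda>t. V t \<omega>" "\<lambda>t. I' t \<omega>" x0 "\<beta> \<omega>" "\<lambda>s i l. H i l s \<omega>" "\<rho> \<omega>" T1 r K0 N \<tau>
      "\<lambda>m k i l. elementary_process (L i l m) (\<tau> m (Suc k)) \<omega>" "\<lambda>m s i l. elementary_process (L i l m) s \<omega>" "\<lambda>m t. Mm m t \<omega>"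
      using elim by blast
    have \<Delta>eq: "A.\<Delta>m m k = \<Delta> m k \<omega>" for m k
      by (simp add: A.\<Delta>m_def A.Bv_def \<Delta>_def)
    show ?case
    proof
      assume \<omega>: "\<omega> \<in> E"
      then have stay: "X s \<omega> \<in> Some ` K0" if "s \<in> {0..T1}" for s using that by (auto simp: E_def)
      \<comment> \<open>At an early exit the path would have distance at least \<open>r\<close> from
        every point of \<open>K0\<close>, among them its own position.\<close>
      have \<rho>T: "\<rho> \<omega> = T1"
      proof (rule ccontr)
        assume "\<rho> \<omega> \<noteq> T1"
        then have lt: "\<rho> \<omega> < T1" using \<rho>(3)[of \<omega>] by simp
        obtain z where z: "z \<in> K0" "X (\<rho> \<omega>) \<omega> = Some z" using stay[of "\<rho> \<omega>"] \<rho>(2,3)[of \<omega>] by auto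
        from A.exit[OF lt z(1)] show False using z(2) r by simp
      qed
      have ex: "\<exists>n::nat. \<omega> \<in> EN n"
        using A.variation_bounded[OF \<rho>T] \<omega> unfolding \<Delta>eq EN_def \<xi>_def by blast
      have ev: "\<forall>\<^sub>F m in sequentially. (\<forall>k\<le>N m. norm (Mm m (\<tau> m k) \<omega> - I' (\<tau> m k) \<omega>) \<le> r) \<and> (\<forall>k<N m. norm (A.\<Delta>m m k) \<le> r)"
        by (rule A.weights_eventually[OF \<rho>T]) (rule stay)
      have "\<forall>\<^sub>F m in sequentially. w N0 m (N m) \<omega>" if "\<omega> \<in> EN N0" for N0
        using ev
      proof eventually_elim
        case (elim m)
        have "{..N m} \<inter> {..<N m} = {..<N m}" by auto
        then show ?case
          unfolding w_def P_def using elim that stay \<tau>_range by (auto simp: EN_def \<Delta>eq)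
      qed
      with ex show "(\<exists>n::nat. \<omega> \<in> EN n) \<and> (\<forall>N0. \<omega> \<in> EN N0 \<longrightarrow> (\<forall>\<^sub>F m in sequentially. w N0 m (N m) \<omega>))" by blast
    qed
  qed
  have \<Phi>_range: "0 \<le> \<Phi> N0 m \<omega>" "\<bar>\<Phi> N0 m \<omega>\<bar> \<le> B" for N0 m \<omega>
    unfolding \<Phi>_def using u_pos[OF T0(2)] bound[of "T - T1"] B0 K(2) T0 T1 by (auto simp: indicator_def of_bool_def)
  have bound_EN: "c * prob (EN N0) \<le> u T x0" if N0: "0 \<le> N0" for N0
  proof -
    \<comment> \<open>The amount by which \<open>\<Phi>\<close> falls short of \<open>c\<close> on
      \<open>EN N0\<close>. It is bounded by \<open>c\<close> and almost surely eventually 0, so its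
      expectation tends to 0 whether or not \<open>\<Phi>\<close> converges.\<close>
    define G where "G m \<omega> = max (c * indicator (EN N0) \<omega> - \<Phi> N0 m \<omega>) 0" for m \<omega>
    note \<Phi>m[measurable] = \<Phi>_meas[OF N0] and Sm[measurable] = S_meas[OF N0]
    have Gm[measurable]: "G m \<in> borel_measurable M" for m unfolding G_def by measurable
    have G_lim: "AE \<omega> in M. (\<lambda>m. G m \<omega>) \<longlonglongrightarrow> 0"
      using on_E
    proof eventually_elim
      case (elim \<omega>)
      show ?case
      proof (cases "\<omega> \<in> EN N0")
        case True
        then have "\<forall>\<^sub>F m in sequentially. w N0 m (N m) \<omega>" using elim by (auto simp: EN_def)
        then have "\<forall>\<^sub>F m in sequentially. G m \<omega> = 0"
        proof eventually_elim
          case (elim m)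
          have "Z m (N m) \<omega> \<in> K" using w_cball[OF N0 elim] r by (auto simp: subset_iff)
          then have "c \<le> \<Phi> N0 m \<omega>" using elim c(2) by (simp add: \<Phi>_def)
          then show ?case using True by (simp add: G_def)
        qed
        then show ?thesis by (rule tendsto_eventually)
      next
        case False
        then have "G m \<omega> = 0" for m using \<Phi>_range(1)[of N0 m \<omega>] by (simp add: G_def)
        then show ?thesis by simp
      qed
    qed
    have G_int: "(\<lambda>m. \<integral>\<omega>. G m \<omega> \<partial>M) \<longlonglongrightarrow> (\<integral>\<omega>. 0 \<partial>M)"
    proof (rule integral_dominated_convergence[where w="\<lambda>_. c"])
      show "AE \<omega> in M. norm (G m \<omega>) \<le> c" for m
      proof (rule AE_I2)
        fix \<omega>
        have "c * indicator (EN N0) \<omega> \<le> c" using c(1) by (simp add: indicator_def)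
        then show "norm (G m \<omega>) \<le> c" using \<Phi>_range(1)[of N0 m \<omega>] c(1) by (auto simp: G_def)
      qed
    qed (use G_lim in auto)
    have S_int: "(\<lambda>m. \<integral>\<omega>. max (Sm N0 m \<omega>) 0 \<partial>M) \<longlonglongrightarrow> (\<integral>\<omega>. 0 \<partial>M)"
    proof (rule integral_dominated_convergence[where w="\<lambda>_. \<bar>B * T1 + real CARD('n) * B * N0 + real CARD('n) * B * N0\<bar>"])
      show "AE \<omega> in M. norm (max (Sm N0 m \<omega>) 0) \<le> \<bar>B * T1 + real CARD('n) * B * N0 + real CARD('n) * B * N0\<bar>" for m
      proof (rule AE_I2)
        fix \<omega> assume "\<omega> \<in> space M"
        from S_bound[OF N0 this, of m] show "norm (max (Sm N0 m \<omega>) 0) \<le> \<bar>B * T1 + real CARD('n) * B * N0 + real CARD('n) * B * N0\<bar>"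
          unfolding real_norm_def by linarith
      qed
    qed (use S_lim[OF N0] in auto)
    have int\<Phi>: "integrable M (\<Phi> N0 m)" for m
      by (rule integrable_const_bound[of _ B]) (use \<Phi>_range in auto)
    have intS: "integrable M (Sm N0 m)" for m
      by (rule integrable_const_bound[of _ "B * T1 + real CARD('n) * B * N0 + real CARD('n) * B * N0"])
        (use S_bound[OF N0] in auto)
    have intS': "integrable M (\<lambda>\<omega>. max (Sm N0 m \<omega>) 0)" for m
      using intS[of m] by (intro integrable_max) auto
    have intG: "integrable M (G m)" for m
      unfolding G_def using int\<Phi>[of m] by (intro integrable_max Bochner_Integration.integrable_diff integrable_mult_right integrable_real_indicator) (auto simp: emeasure_eq_measure)
    have le: "c * prob (EN N0) \<le> u T x0 + (\<integral>\<omega>. max (Sm N0 m \<omega>) 0 \<partial>M) + (1/2)^m + (\<integral>\<omega>. G m \<omega> \<partial>M)" for m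
    proof -
      have "c * prob (EN N0) = (\<integral>\<omega>. c * indicator (EN N0) \<omega> \<partial>M)" by simp
      also have "\<dots> \<le> (\<integral>\<omega>. \<Phi> N0 m \<omega> + G m \<omega> \<partial>M)"
        by (rule integral_mono) (use int\<Phi> intG in \<open>auto simp: G_def emeasure_eq_measure intro!: integrable_mult_right integrable_real_indicator\<close>)
      also have "\<dots> = (\<integral>\<omega>. \<Phi> N0 m \<omega> \<partial>M) + (\<integral>\<omega>. G m \<omega> \<partial>M)"
        using int\<Phi> intG by simp
      finally have 1: "c * prob (EN N0) \<le> (\<integral>\<omega>. \<Phi> N0 m \<omega> \<partial>M) + (\<integral>\<omega>. G m \<omega> \<partial>M)" .
      have 2: "(\<integral>\<omega>. Sm N0 m \<omega> \<partial>M) \<le> (\<integral>\<omega>. max (Sm N0 m \<omega>) 0 \<partial>M)"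
        by (rule integral_mono[OF intS intS']) simp
      have 3: "(\<integral>\<omega>. \<Phi>0 N0 m \<omega> \<partial>M) \<le> u T x0"
      \<comment> \<open>A nonintegrable function has integral 0 by convention, and
        \<open>u T x0\<close> is nonnegative, so the estimate holds in both cases.\<close>
      proof (cases "integrable M (\<Phi>0 N0 m)")
        case True
        have "AE \<omega> in M. \<Phi>0 N0 m \<omega> \<le> u T x0"
          using AP
        proof eventually_elim
          case (elim \<omega>)
          have "Mm m 0 \<omega> = 0" by (simp add: Mm_def vec_eq_iff elementary_integral_0[OF L])
          then have "Z m 0 \<omega> = x0" using elim by (simp add: Z_def grid)
          then show ?case using u0[of T x0] T0 x0O by (auto simp: \<Phi>0_def indicator_def of_bool_def)
        qed
        from integral_le_const[OF True this] show ?thesis .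
      next
        case False
        then show ?thesis using u0[of T x0] T0 x0O by (simp add: not_integrable_integral_eq)
      qed
      show ?thesis using 1 2 3 \<Phi>_exp[OF N0, of m] by linarith
    qed
    have "(\<lambda>m. (1/2::real)^m) \<longlonglongrightarrow> 0" by (rule LIMSEQ_power_zero) simp
    then have "(\<lambda>m. u T x0 + (\<integral>\<omega>. max (Sm N0 m \<omega>) 0 \<partial>M) + (1/2)^m + (\<integral>\<omega>. G m \<omega> \<partial>M)) \<longlonglongrightarrow> u T x0 + 0 + 0 + 0"
      using G_int S_int by (intro tendsto_intros) auto
    from LIMSEQ_le_const[OF this] show ?thesis using le by auto
  qed
  have inc: "incseq (\<lambda>n::nat. EN n)"
    unfolding incseq_def EN_def by (auto intro: order_trans)
  have "(\<lambda>n::nat. prob (EN n)) \<longlonglongrightarrow> prob (\<Union>n::nat. EN n)"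
    by (rule finite_Lim_measure_incseq[OF _ inc]) auto
  then have "(\<lambda>n::nat. c * prob (EN n)) \<longlonglongrightarrow> c * prob (\<Union>n::nat. EN n)"
    by (intro tendsto_intros)
  from LIMSEQ_le_const2[OF this] have "c * prob (\<Union>n::nat. EN n) \<le> u T x0" using bound_EN by auto
  moreover have "prob E \<le> prob (\<Union>n::nat. EN n)"
  proof (rule finite_measure_mono_AE)
    show "AE \<omega> in M. \<omega> \<in> E \<longrightarrow> \<omega> \<in> (\<Union>n::nat. EN n)"
      using on_E by eventually_elim blast
  qed (auto intro!: sets.countable_UN)
  ultimately show ?thesis
    using mult_left_mono[OF _ c(1)] order_trans unfolding E_def by blast
qed

end

text \<open>The grid argument runs up to \<open>T1 = t - \<delta>\<close>, so that \<open>u\<close>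
  is differentiable at all times it meets. Continuity of \<open>u\<close> down to time 0, uniform on
  a compact cylinder, gives \<open>u \<delta> \<ge> 1 - \<eta>\<close> on \<open>K\<close>, and
  staying in \<open>K0\<close> up to \<open>t\<close> implies staying there up to \<open>T1\<close>.
  The final step sends \<open>\<eta>\<close> to 0.\<close>

lemma weak_solution_staying_bound:
  fixes \<O> :: "(real^'n) set" and M :: "'w measure"
  assumes \<O>: "open \<O>" and sol: "weak_solution \<O> b \<sigma> x M F W X"
    and super: "classical_supersolution \<O> b \<sigma> u" and u0: "\<And>t z. 0 \<le> t \<Longrightarrow> z \<in> \<O> \<Longrightarrow> 0 \<le> u t z"
    and x: "x \<in> \<O>" and t: "0 < t" and K0: "compact K0" "K0 \<subseteq> \<O>"
  shows "{\<omega>\<in>space M. \<forall>s\<in>{0..t}. X s \<omega> \<in> Some ` K0} \<in> sets M"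
    and "measure M {\<omega>\<in>space M. \<forall>s\<in>{0..t}. X s \<omega> \<in> Some ` K0} \<le> u t x"
proof -
  have filt: "filtered_prob_space M F" and bm: "brownian_motion M F W"
    and X_adapted: "\<And>t. 0 \<le> t \<Longrightarrow> X t \<in> F t \<rightarrow>\<^sub>M state_algebra \<O>"
    and X_path: "\<And>\<omega>. \<omega> \<in> space M \<Longrightarrow> (\<lambda>t. X t \<omega>) \<in> explosive_paths \<O>"
    and X_0: "AE \<omega> in M. X 0 \<omega> = Some x"
    using sol unfolding weak_solution_def by blast+
  interpret prob_space M using filt by (simp add: filtered_prob_space_def)
  interpret brownian M F W by unfold_locales (rule filt bm)+
  obtain r K D where r: "0 < r" and K: "compact K" "K \<subseteq> \<O>" "\<And>z. z \<in> K0 \<Longrightarrow> cball z (2 * r) \<subseteq> K"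
    and D: "open D" "closure D \<subseteq> K" "\<And>z. z \<in> K0 \<Longrightarrow> ball z r \<subseteq> D"
    using compact_neighbourhood[OF \<O> K0] by blast
  have DO: "closure D \<subseteq> \<O>" "D \<subseteq> \<O>" using D K closure_subset by blast+
  have cD: "compact (closure D)"
    using compact_Int_closed[OF K(1), of "closure D"] D(2) by (simp add: Int_absorb1)
  define S where "S \<omega> = exit_time D (\<lambda>t. X t \<omega>)" for \<omega>
  define stopped where "stopped t \<omega> = real_of_ereal (min (ereal t) (S \<omega>))" for t \<omega>
  define H where "H i l s \<omega> = (if ereal s \<le> S \<omega> then extend_by_zero (\<lambda>y. \<sigma> y $ i $ l) (X s \<omega>) else 0)" for i l s \<omega>
  have D_sol: "(AE \<omega> in M. \<forall>t\<ge>0. \<forall>i.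
              set_integrable lborel {0..stopped t \<omega>} (\<lambda>s. extend_by_zero (\<lambda>y. b y $ i) (X s \<omega>))) \<and>
           (\<exists>I. (\<forall>i k. is_ito_integral M F (\<lambda>t \<omega>. W t \<omega> $ k) (H i k) (I i k)) \<and>
                (AE \<omega> in M. \<forall>t\<ge>0.
                   X (stopped t \<omega>) \<omega> = Some (\<chi> i. x $ i
                     + (\<Sum>k\<in>UNIV. I i k t \<omega>)
                     + (LINT s:{0..stopped t \<omega>}|lborel. extend_by_zero (\<lambda>y. b y $ i) (X s \<omega>)))))"
    using sol[unfolded weak_solution_def, THEN conjunct2, THEN conjunct2, THEN conjunct2, THEN conjunct2, THEN conjunct2,
      THEN spec[of _ D], THEN mp, OF conjI[OF D(1) conjI[OF cD DO(1)]]]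
    unfolding Let_def stopped_def H_def[abs_def] S_def .
  note b_int = D_sol[THEN conjunct1]
  from D_sol[THEN conjunct2] obtain I where I: "(\<forall>i k. is_ito_integral M F (\<lambda>t \<omega>. W t \<omega> $ k) (H i k) (I i k)) \<and>
                (AE \<omega> in M. \<forall>t\<ge>0.
                   X (stopped t \<omega>) \<omega> = Some (\<chi> i. x $ i
                     + (\<Sum>k\<in>UNIV. I i k t \<omega>)
                     + (LINT s:{0..stopped t \<omega>}|lborel. extend_by_zero (\<lambda>y. b y $ i) (X s \<omega>))))" ..
  note eqn = I[THEN conjunct2]
  have ito: "is_ito_integral M F (\<lambda>t \<omega>. W t \<omega> $ l) (H i l) (I i l)" for i l
    using I[THEN conjunct1] by blast
  have Wm: "(\<lambda>\<omega>. W t \<omega> $ l) \<in> borel_measurable (F t)" if "0 \<le> t" for t l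
    using measurable_compose[OF W_F[OF that], of "\<lambda>x. x $ l" borel] by simp
  have Wc: "continuous_on {0..} (\<lambda>t. W t \<omega> $ l)" if "\<omega> \<in> space M" for \<omega> l
    using bm that unfolding brownian_motion_def by (intro continuous_intros) blast
  have scheme: "\<exists>L. stopped_solution M F W \<O> D b \<sigma> x X T1 I L S stopped H" if T1: "0 < T1" for T1
  proof -
    have "\<forall>i l. \<exists>L. (\<forall>m. elementary M F (L m)) \<and> (AE \<omega> in M. \<forall>\<^sub>F m in sequentially.
      ito_close T1 (\<lambda>t \<omega>. W t \<omega> $ l) (H i l) (I i l) (L m) m \<omega>)"
      by (intro allI ito_integral_ae_approximation[OF ito Wm Wc T1])
    then obtain L where L: "\<And>i l. (\<forall>m. elementary M F (L i l m)) \<and> (AE \<omega> in M. \<forall>\<^sub>F m in sequentially.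
      ito_close T1 (\<lambda>t \<omega>. W t \<omega> $ l) (H i l) (I i l) (L i l m) m \<omega>)"
      unfolding choice_iff by (elim exE) (rule that, elim allE)
    have "stopped_solution M F W \<O> D b \<sigma> x X T1 I L S stopped H"
    proof unfold_locales
      show "AE \<omega> in M. \<forall>\<^sub>F m in sequentially.
      ito_close T1 (\<lambda>t \<omega>. W t \<omega> $ l) (H i l) (I i l) (L i l m) m \<omega>" for i l
        using L[THEN conjunct2] .
      show "elementary M F (L i l m)" for i l m
        using L[THEN conjunct1, rule_format] .
    qed (fact \<O> D(1) DO(2) T1 S_def stopped_def H_def X_adapted X_path X_0 b_int ito eqn)+
    then show ?thesis by blast
  qed
  obtain L0 where "stopped_solution M F W \<O> D b \<sigma> x X t I L0 S stopped H" using scheme[OF t] by blast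
  from stopped_solution.staying_measurable[OF this K0]
  have meas: "{\<omega>\<in>space M. \<forall>s\<in>{0..t'}. X s \<omega> \<in> Some ` K0} \<in> sets M" if "0 < t'" for t' using that .
  show "{\<omega>\<in>space M. \<forall>s\<in>{0..t}. X s \<omega> \<in> Some ` K0} \<in> sets M" using meas[OF t] .
  let ?E = "\<lambda>t. {\<omega>\<in>space M. \<forall>s\<in>{0..t}. X s \<omega> \<in> Some ` K0}"
  show "measure M (?E t) \<le> u t x"
  proof (cases "x \<in> K0")
    \<comment> \<open>A start outside \<open>K0\<close> makes the event null, and nonnegativity of
      \<open>u\<close> is enough.\<close>
    case False
    have "prob (?E t) \<le> prob {}"
    proof (rule finite_measure_mono_AE)
      show "AE \<omega> in M. \<omega> \<in> ?E t \<longrightarrow> \<omega> \<in> {}"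
        using X_0
      proof eventually_elim
        case (elim \<omega>)
        have "\<not> (\<forall>s\<in>{0..t}. X s \<omega> \<in> Some ` K0)"
          using elim False t by (intro notI) (drule bspec[of _ _ 0], auto)
        then show ?case by blast
      qed
    qed simp
    then show ?thesis using u0[of t x] t x by simp
  next
    case True
    have bound: "(1 - \<eta>) * prob (?E t) \<le> u t x" if \<eta>: "0 < \<eta>" "\<eta> < 1" for \<eta>
    proof -
      have "continuous_on ({0..t} \<times> K) (\<lambda>(s, z). u s z)"
        using super K(2) unfolding classical_supersolution_def by (auto elim: continuous_on_subset)
      then have "uniformly_continuous_on ({0..t} \<times> K) (\<lambda>(s, z). u s z)"
        by (intro compact_uniformly_continuous compact_Times K) auto
      then obtain d where d: "0 < d" and close: "\<And>p q. p \<in> {0..t} \<times> K \<Longrightarrow> q \<in> {0..t} \<times> K \<Longrightarrow> dist q p < d \<Longrightarrow>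
          dist ((\<lambda>(s, z). u s z) q) ((\<lambda>(s, z). u s z) p) < \<eta>"
        unfolding uniformly_continuous_on_def using \<eta>(1) by blast
      \<comment> \<open>The minimum keeps \<open>T1\<close> positive and the time distance to 0
        strictly below \<open>d\<close>.\<close>
      define \<delta> where "\<delta> = min (t / 2) (d / 2)"
      have \<delta>: "0 < \<delta>" "\<delta> < t" "\<delta> < d" using t d by (auto simp: \<delta>_def)
      have low: "1 - \<eta> \<le> u \<delta> z" if z: "z \<in> K" for z
      proof -
        have "dist (u \<delta> z) (u 0 z) < \<eta>"
          using close[of "(0, z)" "(\<delta>, z)"] z \<delta> t by (simp add: dist_Pair_Pair)
        moreover have "1 \<le> u 0 z" using super z K(2) unfolding classical_supersolution_def by blast
        ultimately show ?thesis by (simp add: dist_real_def)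
      qed
      define T1 where "T1 = t - \<delta>"
      have T1: "0 < T1" "T1 < t" "t - T1 = \<delta>" using \<delta> by (auto simp: T1_def)
      obtain L where "stopped_solution M F W \<O> D b \<sigma> x X T1 I L S stopped H" using scheme[OF T1(1)] by blast
      from stopped_solution.staying_probability_bound[OF this K0 True r K D(2,3) T1(2) super u0, of "1 - \<eta>"]
      have "(1 - \<eta>) * prob (?E T1) \<le> u t x" using low \<eta> T1(3) by simp
      moreover have "prob (?E t) \<le> prob (?E T1)"
        by (rule finite_measure_mono) (use T1 meas[OF T1(1)] in auto)
      ultimately show ?thesis using \<eta> by (meson diff_ge_0_iff_ge less_imp_le mult_left_mono order_trans)
    qed
    have "prob (?E t) \<le> u t x + e" if e: "0 < e" for e
    proof -
      define \<eta> where "\<eta> = min (1/2) e"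
      have \<eta>: "0 < \<eta>" "\<eta> < 1" "\<eta> \<le> e" using e by (auto simp: \<eta>_def)
      have "\<eta> * prob (?E t) \<le> \<eta> * 1" using \<eta> by (intro mult_left_mono) auto
      moreover have "(1 - \<eta>) * prob (?E t) = prob (?E t) - \<eta> * prob (?E t)" by (simp add: left_diff_distrib)
      ultimately show ?thesis using bound[OF \<eta>(1,2)] \<eta>(3) by linarith
    qed
    then show ?thesis by (rule field_le_epsilon)
  qed
qed

text \<open>Exhaust the domain by compact sets \<open>C n\<close>. A path that survives beyond
  \<open>t\<close> has a compact image in the domain up to \<open>t\<close> and so stays in some
  \<open>C n\<close>. Conversely, staying in \<open>C n\<close> up to \<open>t\<close> excludes an
  explosion at \<open>t\<close> itself, since the exit time is attained. The event is thus an
  increasing union of the events already estimated.\<close>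

lemma weak_solution_survival_bound:
  fixes \<O> :: "(real^'n) set" and M :: "'w measure"
  assumes \<O>: "open \<O>" and sol: "weak_solution \<O> b \<sigma> x M F W X"
    and super: "classical_supersolution \<O> b \<sigma> u" and u0: "\<And>t z. 0 \<le> t \<Longrightarrow> z \<in> \<O> \<Longrightarrow> 0 \<le> u t z"
    and x: "x \<in> \<O>" and t: "0 < t"
  shows "{\<omega>\<in>space M. ereal t < exit_time \<O> (\<lambda>s. X s \<omega>)} \<in> sets M"
    and "measure M {\<omega>\<in>space M. ereal t < exit_time \<O> (\<lambda>s. X s \<omega>)} \<le> u t x"
proof -
  interpret prob_space M using sol by (simp add: weak_solution_def filtered_prob_space_def)
  have X_path: "\<And>\<omega>. \<omega> \<in> space M \<Longrightarrow> (\<lambda>t. X t \<omega>) \<in> explosive_paths \<O>"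
    using sol unfolding weak_solution_def by blast
  obtain C :: "nat \<Rightarrow> (real^'n) set" where C: "\<And>n. compact (C n)" "\<And>n. C n \<subseteq> \<O>" "\<And>n. C n \<subseteq> interior (C (Suc n))" "\<Union>(range C) = \<O>"
    using open_Union_compact_subsets[OF \<O>] by metis
  define E where "E n = {\<omega>\<in>space M. \<forall>s\<in>{0..t}. X s \<omega> \<in> Some ` C n}" for n
  note B = weak_solution_staying_bound[OF \<O> sol super u0 x t C(1,2)]
  have E: "E n \<in> sets M" "prob (E n) \<le> u t x" for n
    using B unfolding E_def by auto
  have Cm: "C n \<subseteq> C (Suc n)" for n using C(3) interior_subset by blast
  have inc: "incseq E"
    by (rule incseq_SucI) (use Cm in \<open>fastforce simp: E_def\<close>)
  have closed_exit: "ereal t < exit_time \<O> (\<lambda>s. X s \<omega>)" if \<omega>: "\<omega> \<in> space M" and stay: "\<forall>s\<in>{0..t}. X s \<omega> \<in> Some ` C n" for \<omega> n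
  proof -
    have "ereal t \<le> exit_time \<O> (\<lambda>s. X s \<omega>)"
      unfolding exit_time_def
    proof (rule Inf_greatest, clarify)
      fix s assume s: "0 \<le> s" "X s \<omega> \<notin> Some ` \<O>"
      show "ereal t \<le> ereal s"
      proof (rule ccontr)
        assume "\<not> ereal t \<le> ereal s"
        then have "X s \<omega> \<in> Some ` C n" using stay s by auto
        then show False using s C(2) by blast
      qed
    qed
    moreover have "exit_time \<O> (\<lambda>s. X s \<omega>) \<noteq> ereal t"
    proof
      assume "exit_time \<O> (\<lambda>s. X s \<omega>) = ereal t"
      from exit_time_attained(2)[OF X_path[OF \<omega>] \<O> order_refl this] have "X t \<omega> \<notin> Some ` \<O>" .
      moreover have "X t \<omega> \<in> Some ` C n" using stay t by auto
      ultimately show False using C(2) by blast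
    qed
    ultimately show ?thesis by (simp add: less_le)
  qed
  have eq: "{\<omega>\<in>space M. ereal t < exit_time \<O> (\<lambda>s. X s \<omega>)} = (\<Union>n. E n)"
  proof (intro set_eqI iffI)
    fix \<omega> assume "\<omega> \<in> {\<omega>\<in>space M. ereal t < exit_time \<O> (\<lambda>s. X s \<omega>)}"
    then have \<omega>: "\<omega> \<in> space M" "ereal t < exit_time \<O> (\<lambda>s. X s \<omega>)" by auto
    from explosive_path_compact[OF X_path[OF \<omega>(1)] _ \<omega>(2) C(3,4)] t
    show "\<omega> \<in> (\<Union>n. E n)" using \<omega>(1) by (auto simp: E_def)
  next
    fix \<omega> assume "\<omega> \<in> (\<Union>n. E n)"
    then obtain n where "\<omega> \<in> space M" "\<forall>s\<in>{0..t}. X s \<omega> \<in> Some ` C n" by (auto simp: E_def)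
    with closed_exit show "\<omega> \<in> {\<omega>\<in>space M. ereal t < exit_time \<O> (\<lambda>s. X s \<omega>)}" by blast
  qed
  show "{\<omega>\<in>space M. ereal t < exit_time \<O> (\<lambda>s. X s \<omega>)} \<in> sets M"
    unfolding eq using E(1) by auto
  have "(\<lambda>n. prob (E n)) \<longlonglongrightarrow> prob (\<Union>n. E n)"
    by (rule finite_Lim_measure_incseq[OF _ inc]) (use E(1) in auto)
  from LIMSEQ_le_const2[OF this] have "prob (\<Union>n. E n) \<le> u t x" using E(2) by auto
  then show "prob {\<omega>\<in>space M. ereal t < exit_time \<O> (\<lambda>s. X s \<omega>)} \<le> u t x" unfolding eq .
qed

text \<open>No measurability of \<open>f\<close> or \<open>A\<close> is needed: \<open>distr\<close> is the null measure unless the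
  preimages under \<open>f\<close> define a measure, and measures vanish on nonmeasurable sets.\<close>

lemma measure_distr_le:
  assumes "finite_measure M" "B \<in> sets M" "f -` A \<inter> space M \<subseteq> B"
  shows "measure (distr M N f) A \<le> measure M B"
proof -
  interpret finite_measure M by fact
  have "emeasure (distr M N f) A \<le> emeasure M (f -` A \<inter> space M)"
    unfolding distr_def by (simp add: emeasure_measure_of_conv)
  also have "\<dots> \<le> emeasure M B" using assms by (intro emeasure_mono)
  finally have "emeasure (distr M N f) A \<le> emeasure M B" .
  then show ?thesis
    unfolding measure_def by (rule enn2real_mono) (simp add: less_top[symmetric])
qed

theorem theorem1p2:
  fixes \<O> :: "(real^'n) set"
    and b :: "real^'n \<Rightarrow> real^'n"
    and \<sigma> :: "real^'n \<Rightarrow> real^'n^'n"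
    and \<U> :: "real \<Rightarrow> real^'n \<Rightarrow> real"
  assumes "open \<O>" and "connected \<O>" and "\<O> \<noteq> {}"
    and "b \<in> restrict_space borel \<O> \<rightarrow>\<^sub>M borel"
    and "\<sigma> \<in> restrict_space borel \<O> \<rightarrow>\<^sub>M borel"
    and "\<forall>x\<in>\<O>. \<exists>!Q. is_solution_law TYPE('w) \<O> b \<sigma> x Q"
    and "classical_supersolution \<O> b \<sigma> \<U>"
    and "\<forall>t\<ge>0. \<forall>x\<in>\<O>. \<U> t x \<ge> 0"
  shows "\<forall>t\<ge>0. \<forall>x\<in>\<O>. explosion_tail TYPE('w) \<O> b \<sigma> t x \<le> \<U> t x"
proof (intro allI impI ballI)
  fix t :: real and x assume t: "0 \<le> t" and x: "x \<in> \<O>"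
  define Q where "Q = solution_law TYPE('w) \<O> b \<sigma> x"
  have "\<exists>!Q. is_solution_law TYPE('w) \<O> b \<sigma> x Q" using assms(6) x by blast
  \<comment> \<open>Uniqueness makes \<open>THE\<close> denote an actual law; the bound can then be
    read off from any weak solution that realises it.\<close>
  from theI'[OF this] have "is_solution_law TYPE('w) \<O> b \<sigma> x Q"
    unfolding Q_def solution_law_def .
  then obtain M :: "'w measure" and F W X where sol: "weak_solution \<O> b \<sigma> x M F W X"
    and Q: "Q = distr M (path_space \<O>) (\<lambda>\<omega>. restrict (\<lambda>t. X t \<omega>) {0..})"
    unfolding is_solution_law_def by blast
  interpret prob_space M using sol by (simp add: weak_solution_def filtered_prob_space_def)
  have exit_restrict: "exit_time \<O> (restrict w {0..}) = exit_time \<O> w" for w :: "real \<Rightarrow> (real^'n) option"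
    unfolding exit_time_def by (rule arg_cong[where f=Inf]) auto
  show "explosion_tail TYPE('w) \<O> b \<sigma> t x \<le> \<U> t x"
  proof (cases "t = 0")
    case True
    \<comment> \<open>At time 0 it suffices to compare the total mass with the initial condition;
      the survival bound concerns positive times.\<close>
    have "measure Q A \<le> measure M (space M)" for A
      unfolding Q by (rule measure_distr_le) (auto intro: finite_measure_axioms)
    then have "explosion_tail TYPE('w) \<O> b \<sigma> t x \<le> 1"
      unfolding explosion_tail_def Q_def[symmetric] by (simp add: prob_space)
    moreover have "1 \<le> \<U> 0 x" using assms(7) x by (simp add: classical_supersolution_def)
    ultimately show ?thesis using True by simp
  next
    case False
    then have t: "0 < t" using t by simp
    have "\<And>t z. 0 \<le> t \<Longrightarrow> z \<in> \<O> \<Longrightarrow> 0 \<le> \<U> t z" using assms(8) by blast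
    note surv = weak_solution_survival_bound[OF assms(1) sol assms(7) this x t]
    have "explosion_tail TYPE('w) \<O> b \<sigma> t x \<le> prob {\<omega>\<in>space M. ereal t < exit_time \<O> (\<lambda>s. X s \<omega>)}"
      unfolding explosion_tail_def Q_def[symmetric] Q
      by (rule measure_distr_le[OF finite_measure_axioms surv(1)]) (auto simp: exit_restrict)
    also have "\<dots> \<le> \<U> t x" by (rule surv(2))
    finally show ?thesis .
  qed
qed

end
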